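(* Let $\phi$ be a Bernstein function with characteristics $(a,k,\mu)$, and let $D^S$ be the corresponding killed subordinator with general inverse $E^S=(E^S_t)_{t\geq 0}$. Suppose that $a>0$ and $\mu((0,\infty))=\infty$, and let $w(z):=\mu((z,\infty))$ for $z>0$. Then, for every $f\in D(\mathcal{L})$, the function $$u(t,x):=\mathbb{E}\big(T_{E^S_t}f(x)\big),\qquad t\geq 0,$$ is the unique solution in $(\mathbb{B},\|\cdot\|)$ of the time-fractional equation $$(k\,\partial_t+\partial_t^w)\,u(t,x)=(\mathcal{L}-a)\,u(t,x)+a f(x)\quad (t>0),\qquad u(0,x)=f(x),$$ in the following sense (that is, $u$ has $u(0,\cdot)=f$ and the properties (i)--(iv), and any function with these properties coincides with $u$ in $\mathbb{B}$ for every $t\ge 0$): (i) $\sup_{t\geq 0}\|u(t,\cdot)\|<\infty$; (ii) $x\mapsto u(t,x)$ is in $D(\mathcal{L})$ for each $t\geq 0$, with $\sup_{t\geq 0}\|\mathcal{L}u(t,\cdot)\|<\infty$; (iii) both $t\mapsto u(t,\cdot)$ and $t\mapsto \mathcal{L}u(t,\cdot)$ are continuous in $(\mathbb{B},\|\cdot\|)$; (iv) for every $t>0$, $$\lim_{\delta\to 0}\frac1\delta\Big(k\big(u(t+\delta,x)-u(t,x)\big)+\int_0^{t+\delta}w(t+\delta-s)\big(u(s,x)-u(0,x)\big)\,ds-\int_0^{t}w(t-s)\big(u(s,x)-u(0,x)\big)\,ds\Big)$$ $$=\mathcal{L}u(t,x)-a\,u(t,x)+a f(x)\qquad\text{in 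}(\mathbb{B},\|\cdot\|).$$
   Context: $X=(X_t)_{t\geq 0}$ is a strong Markov process on a separable locally compact Hausdorff space $\mathbb{X}$ whose transition semigroup $(T_t)_{t\geq 0}$ is a uniformly bounded ($\sup_{t\ge 0}\|T_t\|<\infty$) and strongly continuous semigroup on a Banach space $(\mathbb{B},\|\cdot\|)$ of functions on $\mathbb{X}$ (for example $L^p(\mathbb{X};m)$ for a measure $m$ on $\mathbb{X}$ and $p\ge 1$). $\mathcal{L}$ denotes the generator of $(T_t)_{t\ge 0}$ and $D(\mathcal{L})\subset\mathbb{B}$ its domain. A function $\phi:(0,\infty)\to[0,\infty)$ is a Bernstein function if it is smooth and $(-1)^n\phi^{(n)}(\lambda)\leq 0$ for all $\lambda>0$ and $n\in\mathbb{N}$ ($n\ge 1$). Every Bernstein function has a unique representation $\phi(\lambda)=a+k\lambda+\int_0^\infty(1-e^{-\lambda z})\,\mu(dz)$ with $a,k\geq 0$ and $\mu$ a nonnegative Radon measure on $(0,\infty)$ with $\int_0^\infty(1\wedge z)\,\mu(dz)<\infty$; the triple $(a,k,\mu)$ is called the characteristics of $\phi$. The killed subordinator corresponding to $\phi$ (with $a>0$) is $D^S(t):=D_t$ for $t<S$ and $D^S(t):=\infty$ for $t\geq S$, where $D=(D_t)_{t\ge 0}$ is a subordinator (non-decreasing real-valued Lévy process), independent of $X$, with $D_0=0$ and $\mathbb{E}(e^{-\lambda D_t})=\exp\big(-t\,[k\lambda+\int_0^\infty(1-e^{-\lambda z})\,\mu(dz)]\big)$ for $\lambda>0$, and $S$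 is an exponentially distributed random variable independent of $D$ with density $ae^{-az}$, $z>0$. Thus $\mathbb{E}(e^{-\lambda D^S(t)})=e^{-t\phi(\lambda)}$. Its general inverse is $E^S_t:=\inf\{s>0: D^S(s)>t\}$, $t\geq 0$. $\mathbb{E}(T_{E^S_t}f)$ is the $\mathbb{B}$-valued integral of $r\mapsto T_rf$ against the distribution of $E^S_t$. The generalized time-fractional derivative is $\partial_t^w g(t):=\frac{d}{dt}\int_0^t w(t-s)(g(s)-g(0))\,ds$ for suitable $g$. *)

theory Defs
  imports "HOL-Probability.Probability"
begin

section \<open>Integration in non-separable Banach spaces\<close>

text \<open>The library's \<^const>\<open>has_bochner_integral\<close> requires a second countable range type, that is, a
  separable Banach space. The following is the same definition without that restriction.\<close>

definition has_B_integral ::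
    "'a measure \<Rightarrow> ('a \<Rightarrow> 'b::real_normed_vector) \<Rightarrow> 'b \<Rightarrow> bool" where
  "has_B_integral M f I \<longleftrightarrow>
     f \<in> borel_measurable M \<and>
     (\<exists>s. (\<forall>i::nat. Bochner_Integration.simple_bochner_integrable M (s i)) \<and>
          (\<lambda>i. \<integral>\<^sup>+x. ennreal (norm (f x - s i x)) \<partial>M) \<longlonglongrightarrow> 0 \<and>
          (\<lambda>i. Bochner_Integration.simple_bochner_integral M (s i)) \<longlonglongrightarrow> I)"

lemma has_B_integral_eq_has_bochner_integral:
  fixes f :: "'a \<Rightarrow> 'b::{real_normed_vector, second_countable_topology}"
  shows "has_B_integral M f I \<longleftrightarrow> has_bochner_integral M f I"
  unfolding has_B_integral_def has_bochner_integral.simps by auto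

definition B_integral :: "'a measure \<Rightarrow> ('a \<Rightarrow> 'b::real_normed_vector) \<Rightarrow> 'b" where
  "B_integral M f = (if \<exists>I. has_B_integral M f I then THE I. has_B_integral M f I else 0)"


section \<open>Markov processes and their transition semigroups\<close>

text \<open>The time set of the filtration is \<open>[0,\<infinity>]\<close>, so that stopping times may be infinite. No
  regularity of the paths is assumed; as usual it is part of the strong Markov property that
  \<open>X\<^sub>\<tau>\<close> is measurable with respect to the past of \<open>\<tau>\<close> on \<open>{\<tau> < \<infinity>}\<close>.\<close>

definition strong_markov_process ::
    "'o set \<Rightarrow> (ennreal \<Rightarrow> 'o measure) \<Rightarrow> ('x::t2_space \<Rightarrow> 'o measure) \<Rightarrow>
     (real \<Rightarrow> 'o \<Rightarrow> 'x) \<Rightarrow> bool" where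
  "strong_markov_process \<Omega> F P X \<longleftrightarrow>
     filtration \<Omega> F \<and>
     (\<forall>x. prob_space (P x) \<and> space (P x) = \<Omega> \<and> (\<forall>t. sets (F t) \<subseteq> sets (P x))) \<and>
     (\<forall>t\<ge>0. X t \<in> F (ennreal t) \<rightarrow>\<^sub>M borel) \<and>
     (\<forall>x. AE \<omega> in P x. X 0 \<omega> = x) \<and>
     (\<forall>t\<ge>0. \<forall>B\<in>sets borel.
        (\<lambda>x. measure (P x) {\<omega>\<in>\<Omega>. X t \<omega> \<in> B}) \<in> borel_measurable borel) \<and>
     (\<forall>\<tau>. stopping_time F \<tau> \<longrightarrow>
        (\<forall>B\<in>sets borel.
           {\<omega>\<in>\<Omega>. \<tau> \<omega> < \<infinity> \<and> X (enn2real (\<tau> \<omega>)) \<omega> \<in> B} \<in> sets (filtration.pre_sigma \<Omega> F \<tau>)) \<and>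
        (\<forall>x. \<forall>s\<ge>0. \<forall>B\<in>sets borel. \<forall>A\<in>sets (filtration.pre_sigma \<Omega> F \<tau>).
           measure (P x) {\<omega>\<in>A. \<tau> \<omega> < \<infinity> \<and> X (enn2real (\<tau> \<omega>) + s) \<omega> \<in> B} =
           (\<integral>\<omega>\<in>{\<omega>\<in>A. \<tau> \<omega> < \<infinity>}.
              measure (P (X (enn2real (\<tau> \<omega>)) \<omega>)) {\<omega>'\<in>\<Omega>. X s \<omega>' \<in> B} \<partial>P x)))"

text \<open>A Banach space \<open>'b\<close> of functions on \<open>'x\<close>, real or complex valued according to \<open>'k\<close>. The elements
  of \<open>'b\<close> are the classes \<open>cls f\<close>, \<open>f \<in> V\<close>, modulo equality \<open>m\<close>-almost everywhere. This covers
  \<open>L\<^sup>p(m)\<close>; it also covers spaces of genuine functions such as \<open>C\<^sub>0\<close>, since for the counting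
  measure on the Borel sets only the empty set is null.\<close>

definition function_space ::
    "'x::topological_space measure \<Rightarrow>
     ('x \<Rightarrow> 'k::{real_normed_field, banach, second_countable_topology}) set \<Rightarrow>
     (('x \<Rightarrow> 'k) \<Rightarrow> 'b::banach) \<Rightarrow> bool" where
  "function_space m V cls \<longleftrightarrow>
     sets m = sets borel \<and>
     V \<subseteq> borel_measurable borel \<and>
     (\<forall>f\<in>V. \<forall>g\<in>V. (\<lambda>x. f x + g x) \<in> V \<and> cls (\<lambda>x. f x + g x) = cls f + cls g) \<and>
     (\<forall>c. \<forall>f\<in>V. (\<lambda>x. c *\<^sub>R f x) \<in> V \<and> cls (\<lambda>x. c *\<^sub>R f x) = c *\<^sub>R cls f) \<and>
     (\<forall>f\<in>V. \<forall>g\<in>V. cls f = cls g \<longleftrightarrow> (AE x in m. f x = g x)) \<and>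
     cls ` V = UNIV"

text \<open>\<open>T t f (x) = \<bbbE>\<^sup>x f(X\<^sub>t)\<close>, the equality being that of the function space.\<close>

definition transition_semigroup ::
    "'x::t2_space measure \<Rightarrow>
     ('x \<Rightarrow> 'k::{real_normed_field, banach, second_countable_topology}) set \<Rightarrow>
     (('x \<Rightarrow> 'k) \<Rightarrow> 'b::banach) \<Rightarrow> ('x \<Rightarrow> 'o measure) \<Rightarrow> (real \<Rightarrow> 'o \<Rightarrow> 'x) \<Rightarrow>
     (real \<Rightarrow> 'b \<Rightarrow>\<^sub>L 'b) \<Rightarrow> bool" where
  "transition_semigroup m V cls P X T \<longleftrightarrow>
     (\<forall>t\<ge>0. \<forall>f\<in>V. \<forall>g\<in>V. cls g = blinfun_apply (T t) (cls f) \<longrightarrow>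
        (AE x in m. integrable (P x) (\<lambda>\<omega>. f (X t \<omega>)) \<and> g x = (\<integral>\<omega>. f (X t \<omega>) \<partial>P x)))"

text \<open>Only the values \<open>T t\<close> with \<open>t \<ge> 0\<close> matter.\<close>

definition strongly_continuous_semigroup :: "(real \<Rightarrow> 'b::banach \<Rightarrow>\<^sub>L 'b) \<Rightarrow> bool" where
  "strongly_continuous_semigroup T \<longleftrightarrow>
     T 0 = id_blinfun \<and>
     (\<forall>s\<ge>0. \<forall>t\<ge>0. T (s + t) = T s o\<^sub>L T t) \<and>
     (\<forall>f. ((\<lambda>t. blinfun_apply (T t) f) \<longlongrightarrow> f) (at_right 0))"

definition uniformly_bounded_semigroup :: "(real \<Rightarrow> 'b::banach \<Rightarrow>\<^sub>L 'b) \<Rightarrow> bool" where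
  "uniformly_bounded_semigroup T \<longleftrightarrow> bdd_above ((\<lambda>t. norm (T t)) ` {0..})"

definition generator_domain :: "(real \<Rightarrow> 'b::banach \<Rightarrow>\<^sub>L 'b) \<Rightarrow> 'b set" where
  "generator_domain T =
     {f. \<exists>g. ((\<lambda>t. (blinfun_apply (T t) f - f) /\<^sub>R t) \<longlongrightarrow> g) (at_right 0)}"

definition generator :: "(real \<Rightarrow> 'b::banach \<Rightarrow>\<^sub>L 'b) \<Rightarrow> 'b \<Rightarrow> 'b" where
  "generator T f = Lim (at_right 0) (\<lambda>t. (blinfun_apply (T t) f - f) /\<^sub>R t)"


section \<open>Bernstein functions and killed subordinators\<close>

definition bernstein_function :: "(real \<Rightarrow> real) \<Rightarrow> bool" where
  "bernstein_function \<phi> \<longleftrightarrow>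
     (\<forall>l>0. 0 \<le> \<phi> l) \<and>
     (\<forall>n. \<forall>l>0. (deriv ^^ n) \<phi> differentiable (at l)) \<and>
     (\<forall>n\<ge>1. \<forall>l>0. (-1) ^ n * (deriv ^^ n) \<phi> l \<le> 0)"

text \<open>\<open>\<mu>\<close> is a measure on the Borel sets of \<open>(0,\<infinity>)\<close>; the integrability condition makes it finite on
  compact subsets of \<open>(0,\<infinity>)\<close>, hence Radon.\<close>

definition characteristics :: "(real \<Rightarrow> real) \<Rightarrow> real \<Rightarrow> real \<Rightarrow> real measure \<Rightarrow> bool" where
  "characteristics \<phi> a k \<mu> \<longleftrightarrow>
     0 \<le> a \<and> 0 \<le> k \<and>
     sets \<mu> = sets (restrict_space borel {0<..}) \<and>
     (\<integral>\<^sup>+z. ennreal (min 1 z) \<partial>\<mu>) < \<infinity> \<and>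
     (\<forall>l>0. \<phi> l = a + k * l + (\<integral>z. (1 - exp (- l * z)) \<partial>\<mu>))"

text \<open>The left limits of the paths exist by monotonicity.\<close>

definition subordinator :: "'w measure \<Rightarrow> (real \<Rightarrow> 'w \<Rightarrow> real) \<Rightarrow> bool" where
  "subordinator M D \<longleftrightarrow>
     prob_space M \<and>
     (\<forall>t\<ge>0. D t \<in> borel_measurable M) \<and>
     (\<forall>\<omega>\<in>space M. D 0 \<omega> = 0 \<and> mono_on {0..} (\<lambda>t. D t \<omega>) \<and>
        (\<forall>t\<ge>0. continuous (at_right t) (\<lambda>s. D s \<omega>))) \<and>
     (\<forall>s\<ge>0. \<forall>t\<ge>0. distr M borel (\<lambda>\<omega>. D (s + t) \<omega> - D s \<omega>) = distr M borel (D t)) \<and>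
     (\<forall>r n. mono r \<and> 0 \<le> r 0 \<longrightarrow>
        prob_space.indep_vars M (\<lambda>_. borel) (\<lambda>i \<omega>. D (r (Suc i)) \<omega> - D (r i) \<omega>) {..<n::nat})"

definition laplace_exponent_of ::
    "'w measure \<Rightarrow> (real \<Rightarrow> 'w \<Rightarrow> real) \<Rightarrow> real \<Rightarrow> real measure \<Rightarrow> bool" where
  "laplace_exponent_of M D k \<mu> \<longleftrightarrow>
     (\<forall>t\<ge>0. \<forall>l>0. (\<integral>\<omega>. exp (- l * D t \<omega>) \<partial>M) =
        exp (- t * (k * l + (\<integral>z. (1 - exp (- l * z)) \<partial>\<mu>))))"

text \<open>\<open>S\<close> is exponentially distributed with parameter \<open>a\<close> and independent of the whole process \<open>D\<close>.\<close>

definition independent_killing_time ::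
    "'w measure \<Rightarrow> (real \<Rightarrow> 'w \<Rightarrow> real) \<Rightarrow> real \<Rightarrow> ('w \<Rightarrow> real) \<Rightarrow> bool" where
  "independent_killing_time M D a S \<longleftrightarrow>
     distributed M lborel S (exponential_density a) \<and>
     prob_space.indep_set M
       (sets (vimage_algebra (space M) (\<lambda>\<omega>. \<lambda>t\<in>{0..}. D t \<omega>) (PiM {0..} (\<lambda>_. borel))))
       (sets (vimage_algebra (space M) S borel))"

definition killed :: "(real \<Rightarrow> 'w \<Rightarrow> real) \<Rightarrow> ('w \<Rightarrow> real) \<Rightarrow> real \<Rightarrow> 'w \<Rightarrow> ereal" where
  "killed D S t \<omega> = (if t < S \<omega> then ereal (D t \<omega>) else \<infinity>)"

definition general_inverse :: "(real \<Rightarrow> 'w \<Rightarrow> ereal) \<Rightarrow> real \<Rightarrow> 'w \<Rightarrow> real" where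
  "general_inverse Y t \<omega> = Inf {s. 0 < s \<and> ereal t < Y s \<omega>}"

text \<open>\<open>\<bbbE>(T\<^sub>R f)\<close> for a random variable \<open>R \<ge> 0\<close>: the integral of \<open>r \<mapsto> T\<^sub>r f\<close>
  against the distribution of \<open>R\<close> on \<open>[0,\<infinity>)\<close>.\<close>

definition expected_semigroup ::
    "(real \<Rightarrow> 'b::banach \<Rightarrow>\<^sub>L 'b) \<Rightarrow> 'w measure \<Rightarrow> ('w \<Rightarrow> real) \<Rightarrow> 'b \<Rightarrow> 'b" where
  "expected_semigroup T M R f =
     B_integral (distr M (restrict_space borel {0..}) R) (\<lambda>r. blinfun_apply (T r) f)"


section \<open>The time-fractional equation\<close>

definition tail :: "real measure \<Rightarrow> real \<Rightarrow> real" where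
  "tail \<mu> z = measure \<mu> {z<..}"

text \<open>\<open>\<partial>\<^sub>t\<^sup>w u\<close> is the derivative of this function. For \<open>u\<close> continuous and \<open>w\<close> locally integrable, the
  Henstock-Kurzweil integral here coincides with the Bochner integral.\<close>

definition frac_convolution :: "(real \<Rightarrow> real) \<Rightarrow> (real \<Rightarrow> 'b::banach) \<Rightarrow> real \<Rightarrow> 'b" where
  "frac_convolution w u t = integral {0..t} (\<lambda>s. w (t - s) *\<^sub>R (u s - u 0))"

definition fractional_solution ::
    "(real \<Rightarrow> 'b::banach \<Rightarrow>\<^sub>L 'b) \<Rightarrow> real \<Rightarrow> real \<Rightarrow> (real \<Rightarrow> real) \<Rightarrow> 'b \<Rightarrow> (real \<Rightarrow> 'b) \<Rightarrow> bool"
  where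
  "fractional_solution T a k w f u \<longleftrightarrow>
     u 0 = f \<and>
     bdd_above ((\<lambda>t. norm (u t)) ` {0..}) \<and>
     (\<forall>t\<ge>0. u t \<in> generator_domain T) \<and>
     bdd_above ((\<lambda>t. norm (generator T (u t))) ` {0..}) \<and>
     continuous_on {0..} u \<and>
     continuous_on {0..} (\<lambda>t. generator T (u t)) \<and>
     (\<forall>t>0.
        ((\<lambda>\<delta>. (1 / \<delta>) *\<^sub>R
           (k *\<^sub>R (u (t + \<delta>) - u t) + frac_convolution w u (t + \<delta>) - frac_convolution w u t))
         \<longlongrightarrow> generator T (u t) - a *\<^sub>R u t + a *\<^sub>R f) (at 0))"

end

theory Submission
  imports Defs
begin

text \<open>Write \<open>\<phi> s = a + \<Phi> s\<close> for the Bernstein function, \<open>L\<close> for the generator and \<open>w\<close> for the tail of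
  \<open>\<mu>\<close>. The proof rests on one probabilistic fact (\<open>exponential_sampling\<close>): if \<open>t\<close> is an independent
  exponential time with rate \<open>s\<close>, then \<open>E t\<close> is exponential with rate \<open>\<phi> s\<close>, because \<open>r < E t\<close> means
  \<open>r < S\<close> and \<open>D r < t\<close> up to a null set, and the probability of \<open>r < S\<close>
  times the expectation of \<open>exp (- s * D r)\<close> is \<open>exp (- r * \<phi> s)\<close>. Hence the Laplace transform
  at \<open>s\<close> of \<open>t \<mapsto> Q t x\<close>, the expectation of \<open>T (E t) x\<close>, is \<open>\<phi> s / s\<close> times the
  resolvent of \<open>L\<close> at \<open>\<phi> s\<close> applied to \<open>x\<close> (\<open>laplace_Q\<close>).

  On the other side, the Laplace transform of \<open>w\<close> is \<open>\<integral>z. (1 - exp (- s * z)) \<partial>\<mu>\<close> divided by \<open>s\<close>, so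
  the operation \<open>k * (v - v 0) + w * (v - v 0)\<close>, with a convolution in the second term, amounts to
  multiplication by \<open>\<Phi> s / s\<close> of the transform of \<open>v - v 0\<close>. The integrated form of the equation therefore
  becomes an algebraic identity between resolvents. For \<open>v t = Q t f\<close> it is satisfied; and conversely,
  applying the resolvent at \<open>\<phi> s\<close> to the equation of an arbitrary solution determines its Laplace transform.
  A continuous function is determined by its Laplace transform (\<open>laplace_eq_0_imp_eq_0\<close>), which gives
  existence and uniqueness. That \<open>\<mu>\<close> has infinite mass makes \<open>D\<close> strictly increasing, hence \<open>E\<close>
  continuous with \<open>E 0 = 0\<close>, almost surely; this is the source of the continuity of \<open>Q t x\<close> in \<open>t\<close> and of
  the initial condition. That \<open>Q t\<close> maps the domain of \<open>L\<close> to itself and commutes with \<open>L\<close>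
  holds since \<open>Q t\<close> is bounded and commutes with the semigroup.

  The Banach space need not be separable, so all these arguments are carried out for the real functions
  \<open>t \<mapsto> l (v t)\<close>, for bounded linear functionals \<open>l\<close>: by Hahn--Banach (\<open>norming_functional\<close>) two
  vectors with the same image under every \<open>l\<close> are equal. Besides integrals of continuous functions over
  intervals, only two vector-valued integrals have to be shown to exist: the expectation of \<open>T (E t) x\<close>
  (\<open>has_B_integral_continuous_bounded\<close>) and the memory integral with its singular kernel (\<open>integrable_on_scaleR_continuous\<close>).\<close>

section \<open>Norming functionals\<close>

text \<open>Hahn--Banach, in the form needed here. A dominated functional on a subspace is encoded by its graph, a
  subspace of \<open>'b \<times> real\<close> lying below the graph of the norm; this already forces the graph to be
  single-valued. Zorn's lemma gives a maximal graph through \<open>(x, norm x)\<close>, and it is defined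
  everywhere because a value \<open>c\<close> at a further point can be chosen as a supremum.\<close>

lemma norming_functional:
  fixes x :: "'b::real_normed_vector"
  obtains l :: "'b \<Rightarrow> real" where "bounded_linear l" "l x = norm x" "\<And>y. \<bar>l y\<bar> \<le> norm y"
proof -
  define A where "A = {H :: ('b \<times> real) set. subspace H \<and> (\<forall>(y,b)\<in>H. b \<le> norm y) \<and> (x, norm x) \<in> H}"
  have base: "span {(x, norm x)} \<in> A"
  proof -
    have "c * norm x \<le> norm (c *\<^sub>R x)" for c
      by (simp add: abs_le_iff mult_right_mono)
    then show ?thesis
      unfolding A_def mem_Collect_eq
      by (intro conjI subspace_span span_base) (auto simp: span_singleton)
  qed
  have chain: "\<Union>C \<in> A" if C: "C \<noteq> {}" "subset.chain A C" for C
  proof -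
    have CA: "C \<subseteq> A" and tot: "\<And>H K. H \<in> C \<Longrightarrow> K \<in> C \<Longrightarrow> H \<subseteq> K \<or> K \<subseteq> H"
      using C(2) by (auto simp: subset.chain_def)
    have sub: "subspace G" and dom: "\<And>y b. (y, b) \<in> G \<Longrightarrow> b \<le> norm y" and xG: "(x, norm x) \<in> G"
      if "G \<in> C" for G
      using that CA unfolding A_def by blast+
    have "subspace (\<Union>C)"
    proof (rule subspaceI)
      show "0 \<in> \<Union>C" using C(1) sub subspace_0 by blast
      show "p + q \<in> \<Union>C" if pq: "p \<in> \<Union>C" "q \<in> \<Union>C" for p q
      proof -
        from pq obtain H K where HK: "H \<in> C" "K \<in> C" "p \<in> H" "q \<in> K" by blast
        then obtain G where "G \<in> C" "p \<in> G" "q \<in> G" using tot[of H K] by blast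
        then show ?thesis using subspace_add[OF sub] by blast
      qed
      show "c *\<^sub>R p \<in> \<Union>C" if "p \<in> \<Union>C" for c p
        using that subspace_scale[OF sub] by blast
    qed
    moreover have "\<forall>(y, b)\<in>\<Union>C. b \<le> norm y" using dom by blast
    moreover have "(x, norm x) \<in> \<Union>C" using C(1) xG by blast
    ultimately show ?thesis by (simp add: A_def)
  qed
  obtain H where H: "H \<in> A" and Hmax: "\<And>G. G \<in> A \<Longrightarrow> H \<subseteq> G \<Longrightarrow> G = H"
    using subset_Zorn_nonempty[of A, OF _ chain] base by (metis empty_iff)
  have sH: "subspace H" and dH: "\<And>y b. (y, b) \<in> H \<Longrightarrow> b \<le> norm y" and xH: "(x, norm x) \<in> H"
    using H unfolding A_def by blast+
  have ex: "\<exists>b. (y, b) \<in> H" for y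
  proof -
    define B where "B = (\<lambda>p. snd p - norm (fst p - y)) ` H"
    have key: "b - norm (z - y) \<le> norm (z' + y) - b'" if "(z, b) \<in> H" "(z', b') \<in> H" for z b z' b'
    proof -
      have "(z + z', b + b') \<in> H" using subspace_add[OF sH that] by simp
      from dH[OF this] have "b + b' \<le> norm ((z - y) + (z' + y))" by simp
      also have "\<dots> \<le> norm (z - y) + norm (z' + y)" by (rule norm_triangle_ineq)
      finally show ?thesis by simp
    qed
    \<comment> \<open>By \<open>key\<close>, each lower bound for the value at \<open>y\<close> is below each upper bound.\<close>
    have ne: "B \<noteq> {}" using xH by (auto simp: B_def)
    have bdd: "bdd_above B" using key[OF _ xH] by (fastforce simp: B_def intro!: bdd_aboveI)
    define c where "c = Sup B"
    have c1: "b - norm (z - y) \<le> c" if "(z, b) \<in> H" for z b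
      unfolding c_def by (rule cSup_upper[OF _ bdd]) (use that in \<open>force simp: B_def\<close>)
    have c2: "c \<le> norm (z + y) - b" if "(z, b) \<in> H" for z b
      unfolding c_def by (rule cSup_least[OF ne]) (use that key in \<open>auto simp: B_def\<close>)
    define G where "G = {p + q |p q. p \<in> H \<and> q \<in> span {(y, c)}}"
    have "H \<subseteq> G"
    proof
      fix p assume "p \<in> H"
      then have "p + 0 \<in> G" unfolding G_def using span_zero by blast
      then show "p \<in> G" by simp
    qed
    moreover have "G \<in> A"
    proof -
      have "subspace G" unfolding G_def by (rule subspace_sums[OF sH subspace_span])
      moreover have dG: "b + t * c \<le> norm (z + t *\<^sub>R y)" if zb: "(z, b) \<in> H" for z b t
      proof (cases t "0::real" rule: linorder_cases)
        case equal then show ?thesis using dH[OF zb] by simp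
      next
        case greater
        have "((1/t) *\<^sub>R z, (1/t) * b) \<in> H" using subspace_scale[OF sH zb, of "1/t"] by simp
        from c2[OF this] have "t * (c + b / t) \<le> t * norm ((1/t) *\<^sub>R z + y)" using greater by simp
        also have "\<dots> = norm (t *\<^sub>R ((1/t) *\<^sub>R z + y))" using greater by simp
        finally show ?thesis using greater by (simp add: algebra_simps)
      next
        case less
        define s where "s = - t"
        have s: "s > 0" using less by (simp add: s_def)
        have "((1/s) *\<^sub>R z, (1/s) * b) \<in> H" using subspace_scale[OF sH zb, of "1/s"] by simp
        from c1[OF this] have "s * (b / s - c) \<le> s * norm ((1/s) *\<^sub>R z - y)" using s by simp
        also have "\<dots> = norm (s *\<^sub>R ((1/s) *\<^sub>R z - y))" using s by simp
        finally show ?thesis using s by (simp add: algebra_simps s_def)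
      qed
      moreover have "\<forall>(y, b)\<in>G. b \<le> norm y" using dG by (auto simp: G_def span_singleton)
      ultimately show ?thesis
        using xH \<open>H \<subseteq> G\<close> unfolding A_def by blast
    qed
    ultimately have "G = H" by (intro Hmax)
    moreover have "0 + (y, c) \<in> G"
      unfolding G_def using subspace_0[OF sH] span_base[of "(y, c)" "{(y, c)}"] by blast
    ultimately show ?thesis by auto
  qed
  have uniq: "b = b'" if "(y, b) \<in> H" "(y, b') \<in> H" for y b b'
    using dH[of 0 "b - b'"] dH[of 0 "b' - b"] subspace_diff[OF sH that] subspace_diff[OF sH that(2) that(1)]
    by simp
  define l where "l = (\<lambda>y. THE b. (y, b) \<in> H)"
  have lH: "(y, l y) \<in> H" for y
    unfolding l_def using ex[of y] uniq by (metis theI)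
  have leq: "l y = b" if "(y, b) \<in> H" for y b using uniq[OF lH that] .
  have bound: "\<bar>l y\<bar> \<le> norm y" for y
    using dH[OF lH[of y]] dH[of "- y" "- l y"] subspace_neg[OF sH lH[of y]] by simp
  have "bounded_linear l"
  proof (rule bounded_linear_intro[where K = 1])
    show "l (y + z) = l y + l z" for y z
      by (rule leq) (use subspace_add[OF sH lH[of y] lH[of z]] in simp)
    show "l (r *\<^sub>R y) = r *\<^sub>R l y" for r y
      by (rule leq) (use subspace_scale[OF sH lH[of y], of r] in simp)
    show "norm (l y) \<le> norm y * 1" for y using bound by simp
  qed
  then show ?thesis using that leq[OF xH] bound by blast
qed

lemma eq_if_functionals_eq:
  fixes x y :: "'b::real_normed_vector"
  assumes "\<And>l :: 'b \<Rightarrow> real. bounded_linear l \<Longrightarrow> l x = l y"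
  shows "x = y"
proof -
  obtain l :: "'b \<Rightarrow> real" where l: "bounded_linear l" "l (x - y) = norm (x - y)"
    using norming_functional[of "x - y"] by metis
  then show ?thesis using assms[OF l(1)] by (simp add: bounded_linear.linear linear_diff)
qed

section \<open>Integrals of continuous vector-valued functions\<close>

text \<open>A contraction maps approximating simple functions to approximating simple functions, as it does not
  increase the integrals of the norms of the differences.\<close>

lemma has_B_integral_contraction:
  fixes l :: "'b::real_normed_vector \<Rightarrow> real"
  assumes l: "bounded_linear l" and bd: "\<And>y. \<bar>l y\<bar> \<le> norm y" and I: "has_B_integral M f I"
  shows "has_bochner_integral M (\<lambda>x. l (f x)) (l I)"
proof -
  interpret bounded_linear l by fact
  have [measurable]: "f \<in> borel_measurable M" using I by (simp add: has_B_integral_def)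
  have [measurable]: "l \<in> borel_measurable borel"
    by (intro borel_measurable_continuous_onI continuous_on continuous_on_id)
  obtain s where s: "\<And>i::nat. Bochner_Integration.simple_bochner_integrable M (s i)"
    and lim: "(\<lambda>i. \<integral>\<^sup>+x. ennreal (norm (f x - s i x)) \<partial>M) \<longlonglongrightarrow> 0"
    and sI: "(\<lambda>i. Bochner_Integration.simple_bochner_integral M (s i)) \<longlonglongrightarrow> I"
    using I by (auto simp: has_B_integral_def)
  show ?thesis
  proof (rule has_bochner_integral.intros[where s = "\<lambda>i x. l (s i x)"])
    show "(\<lambda>x. l (f x)) \<in> borel_measurable M" by measurable
    show "Bochner_Integration.simple_bochner_integrable M (\<lambda>x. l (s i x))" for i
      by (rule simple_bochner_integrable_compose2[where p = "\<lambda>x y. l x" and g = "s i"]) (simp_all add: s zero)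
    show "(\<lambda>i. \<integral>\<^sup>+x. ennreal (norm (l (f x) - l (s i x))) \<partial>M) \<longlonglongrightarrow> 0"
    proof (rule tendsto_sandwich[OF _ _ tendsto_const lim])
      show "\<forall>\<^sub>F i in sequentially. (\<integral>\<^sup>+x. ennreal (norm (l (f x) - l (s i x))) \<partial>M)
          \<le> (\<integral>\<^sup>+x. ennreal (norm (f x - s i x)) \<partial>M)"
        using bd by (intro always_eventually allI nn_integral_mono) (auto simp flip: diff)
    qed simp
    show "(\<lambda>i. Bochner_Integration.simple_bochner_integral M (\<lambda>x. l (s i x))) \<longlonglongrightarrow> l I"
      using tendsto[OF sI] by (simp add: simple_bochner_integral_linear[OF linear s])
  qed
qed

lemma has_B_integral_unique:
  assumes "has_B_integral M f I" "has_B_integral M f J"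
  shows "I = J"
proof -
  obtain l where l: "bounded_linear l" "l (I - J) = norm (I - J)" "\<And>y. \<bar>l y\<bar> \<le> norm y"
    using norming_functional[of "I - J"] by metis
  have "l I = l J"
    using has_bochner_integral_eq[OF has_B_integral_contraction[OF l(1,3) assms(1)]
        has_B_integral_contraction[OF l(1,3) assms(2)]] .
  then show ?thesis using l(1,2) by (simp add: bounded_linear.linear linear_diff)
qed

text \<open>Rounding the argument down to a multiple of \<open>2^-i\<close>, and cutting it off at \<open>i\<close>, produces simple
  functions that converge pointwise to a continuous function, so dominated convergence applies to the
  norm of the difference. That norm is measurable although the range may fail to be separable: it is a
  continuous function of the pair formed by the argument and its rounding.\<close>

lemma has_B_integral_continuous_bounded:
  fixes f :: "real \<Rightarrow> 'b::banach"
  assumes N: "finite_measure N" and sN: "sets N = sets (restrict_space borel {0..})"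
    and f: "continuous_on {0..} f" and C: "\<And>r. r \<ge> 0 \<Longrightarrow> norm (f r) \<le> C"
  shows "\<exists>I. has_B_integral N f I"
proof -
  interpret finite_measure N by fact
  have spN: "space N = {0..}" using sets_eq_imp_space_eq[OF sN] by (simp add: space_restrict_space)
  have [measurable]: "f \<in> borel_measurable N"
    using borel_measurable_continuous_on_restrict[OF f] measurable_cong_sets[OF sN refl] by blast
  have id: "(\<lambda>x. x) \<in> borel_measurable N"
    using measurable_restrict_space1[OF measurable_ident] measurable_cong_sets[OF sN refl] by (auto simp: id_def)
  define q :: "nat \<Rightarrow> real \<Rightarrow> real" where "q i x = of_int \<lfloor>2 ^ i * min x (real i)\<rfloor> / 2 ^ i" for i x
  have qm[measurable]: "q i \<in> borel_measurable N" for i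
  proof -
    have "(\<lambda>x. of_int \<lfloor>2 ^ i * min x (real i)\<rfloor> / 2 ^ i :: real) \<in> borel_measurable borel" by measurable
    from measurable_compose[OF id this] show ?thesis by (simp add: q_def[abs_def])
  qed
  have q0: "q i x \<ge> 0" if "x \<ge> 0" for i x using that by (simp add: q_def)
  have fq: "finite (q i ` space N)" for i
  proof (rule finite_subset)
    show "q i ` space N \<subseteq> (\<lambda>j. of_int j / 2 ^ i) ` {0..\<lfloor>2 ^ i * real i\<rfloor>}"
      by (auto simp: q_def spN intro!: imageI floor_mono)
  qed simp
  have qlim: "(\<lambda>i. q i x) \<longlonglongrightarrow> x" if "x \<ge> 0" for x
  proof (rule tendsto_sandwich)
    have ev: "\<forall>\<^sub>F i in sequentially. x \<le> real i" using eventually_ge_at_top[of "nat \<lceil>x\<rceil>"]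
      by eventually_elim linarith
    show "\<forall>\<^sub>F i in sequentially. x - (1/2) ^ i \<le> q i x"
      using ev
    proof eventually_elim
      case (elim i)
      have "2 ^ i * x - 1 \<le> of_int \<lfloor>2 ^ i * x\<rfloor>" by linarith
      then have "(2 ^ i * x - 1) / 2 ^ i \<le> of_int \<lfloor>2 ^ i * x\<rfloor> / 2 ^ i" by (intro divide_right_mono) auto
      then show ?case using elim by (simp add: q_def min_absorb1 diff_divide_distrib power_divide)
    qed
    show "\<forall>\<^sub>F i in sequentially. q i x \<le> x"
      using ev
    proof eventually_elim
      case (elim i)
      have "of_int \<lfloor>2 ^ i * x\<rfloor> / 2 ^ i \<le> (2 ^ i * x) / 2 ^ i" by (intro divide_right_mono) auto
      then show ?case using elim by (simp add: q_def min_absorb1)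
    qed
    show "(\<lambda>i. x - (1/2) ^ i) \<longlonglongrightarrow> x"
      using tendsto_diff[OF tendsto_const LIMSEQ_realpow_zero[of "1/2"], of x] by simp
  qed simp
  define s where "s i x = f (q i x)" for i x
  have sf: "simple_function N (s i)" for i
  proof -
    have "simple_function N (q i)" using fq by (rule simple_function_borel_measurable[rotated]) measurable
    then show ?thesis unfolding s_def by (rule simple_function_compose1)
  qed
  have sb: "Bochner_Integration.simple_bochner_integrable M (s i)" if "M = N" for i M
    unfolding that by (rule simple_bochner_integrable.intros[OF sf]) (simp add: emeasure_finite)
  have f': "continuous_on UNIV (\<lambda>x. f (max 0 x))"
    by (rule continuous_on_compose2[OF f]) (auto intro!: continuous_intros)
  have [measurable]: "(\<lambda>x. norm (f (max 0 x) - f (max 0 (q i x)))) \<in> borel_measurable N" for i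
  proof -
    have "continuous_on UNIV (\<lambda>p. norm (f (max 0 (fst p)) - f (max 0 (snd p))))"
      by (intro continuous_intros continuous_on_compose2[OF f']) auto
    then have "(\<lambda>p. norm (f (max 0 (fst p)) - f (max 0 (snd p)))) \<in> borel_measurable (borel \<Otimes>\<^sub>M borel)"
      unfolding borel_prod by (rule borel_measurable_continuous_onI)
    moreover have "(\<lambda>x. (x, q i x)) \<in> N \<rightarrow>\<^sub>M borel \<Otimes>\<^sub>M borel"
      using id qm by (rule measurable_Pair)
    ultimately have "(\<lambda>x. (\<lambda>p. norm (f (max 0 (fst p)) - f (max 0 (snd p)))) (x, q i x)) \<in> borel_measurable N"
      by (rule measurable_compose[rotated])
    then show ?thesis by (simp only: fst_conv snd_conv)
  qed
  have m: "(\<lambda>x. norm (f x - s i x)) \<in> borel_measurable N" for i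
  proof -
    have "(\<lambda>x. norm (f (max 0 x) - f (max 0 (q i x)))) \<in> borel_measurable N" by measurable
    also have "?this \<longleftrightarrow> ?thesis" using q0 by (intro measurable_cong) (auto simp: s_def spN max_absorb2)
    finally show ?thesis .
  qed
  have lim: "(\<lambda>i. \<integral>\<^sup>+x. ennreal (norm (f x - s i x)) \<partial>N) \<longlonglongrightarrow> (\<integral>\<^sup>+x. 0 \<partial>N)"
  proof (rule nn_integral_dominated_convergence[where w = "\<lambda>_. ennreal (2 * C)"])
    show "AE x in N. ennreal (norm (f x - s i x)) \<le> ennreal (2 * C)" for i
    proof (rule AE_I2)
      fix x assume "x \<in> space N"
      then have "norm (f x - s i x) \<le> C + C"
        unfolding s_def using C q0[of x i] by (intro order_trans[OF norm_triangle_ineq4 add_mono]) (auto simp: spN)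
      then show "ennreal (norm (f x - s i x)) \<le> ennreal (2 * C)" by (intro ennreal_leI) simp
    qed
    show "AE x in N. (\<lambda>i. ennreal (norm (f x - s i x))) \<longlonglongrightarrow> 0"
    proof (rule AE_I2)
      fix x assume "x \<in> space N"
      then have x: "x \<ge> 0" by (simp add: spN)
      have "(\<lambda>i. f (q i x)) \<longlonglongrightarrow> f x"
        by (rule continuous_on_tendsto_compose[OF f qlim[OF x]]) (auto simp: x q0)
      then have "(\<lambda>i. norm (f x - s i x)) \<longlonglongrightarrow> 0"
        unfolding s_def using tendsto_norm[OF tendsto_diff[OF tendsto_const[of "f x"]]] by fastforce
      then show "(\<lambda>i. ennreal (norm (f x - s i x))) \<longlonglongrightarrow> 0" using tendsto_ennrealI by fastforce
    qed
    show "(\<integral>\<^sup>+x. ennreal (2 * C) \<partial>N) < \<infinity>" by (simp add: ennreal_mult_eq_top_iff less_top[symmetric] emeasure_finite)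
  qed (use m in measurable)
  let ?S = "\<lambda>i. Bochner_Integration.simple_bochner_integral N (s i)"
  have lim0: "(\<lambda>i. \<integral>\<^sup>+x. ennreal (norm (f x - s i x)) \<partial>N) \<longlonglongrightarrow> 0" using lim by simp
  have "Cauchy ?S"
  proof (rule metric_CauchyI)
    fix e :: real assume e: "e > 0"
    have "\<forall>\<^sub>F i in sequentially. (\<integral>\<^sup>+x. ennreal (norm (f x - s i x)) \<partial>N) < ennreal (e / 2)"
      using e by (intro order_tendstoD(2)[OF lim0]) auto
    then obtain n where n: "\<And>i. i \<ge> n \<Longrightarrow> (\<integral>\<^sup>+x. ennreal (norm (f x - s i x)) \<partial>N) < ennreal (e / 2)"
      by (auto simp: eventually_sequentially)
    have "dist (?S i) (?S j) < e" if ij: "i \<ge> n" "j \<ge> n" for i j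
    proof -
      have dsb: "Bochner_Integration.simple_bochner_integrable N (\<lambda>x. s i x - s j x)"
        by (rule simple_bochner_integrable_compose2[where p = "(-)"]) (auto intro: sb)
      have nsb: "Bochner_Integration.simple_bochner_integrable N (\<lambda>x. norm (s i x - s j x))"
        by (rule simple_bochner_integrable_compose2[where p = "\<lambda>x y. norm (x - y)"]) (auto intro: sb)
      have "ennreal (norm (?S i - ?S j))
          = norm (Bochner_Integration.simple_bochner_integral N (\<lambda>x. s i x - s j x))"
        by (subst simple_bochner_integral_diff) (auto intro: sb)
      also have "\<dots> \<le> Bochner_Integration.simple_bochner_integral N (\<lambda>x. norm (s i x - s j x))"
        by (intro ennreal_leI simple_bochner_integral_norm_bound[OF dsb])
      also have "\<dots> = (\<integral>\<^sup>+x. norm (s i x - s j x) \<partial>N)"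
        by (rule simple_bochner_integral_eq_nn_integral[OF nsb]) simp
      also have "\<dots> \<le> (\<integral>\<^sup>+x. ennreal (norm (f x - s i x)) + ennreal (norm (f x - s j x)) \<partial>N)"
      proof (rule nn_integral_mono)
        fix x
        have "norm (s i x - s j x) \<le> norm (f x - s i x) + norm (f x - s j x)"
          by (metis dual_order.refl norm_diff_triangle_le norm_minus_commute)
        then show "ennreal (norm (s i x - s j x)) \<le> ennreal (norm (f x - s i x)) + ennreal (norm (f x - s j x))"
          by (metis ennreal_leI ennreal_plus norm_ge_zero)
      qed
      also have "\<dots> = (\<integral>\<^sup>+x. ennreal (norm (f x - s i x)) \<partial>N) + (\<integral>\<^sup>+x. ennreal (norm (f x - s j x)) \<partial>N)"
        by (rule nn_integral_add) (use m in measurable)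
      also have "\<dots> < ennreal (e / 2) + ennreal (e / 2)" using n ij by (intro add_strict_mono) auto
      also have "\<dots> = ennreal e" using e by (simp flip: ennreal_plus)
      finally show ?thesis using e by (simp add: dist_norm ennreal_less_iff)
    qed
    then show "\<exists>n. \<forall>i\<ge>n. \<forall>j\<ge>n. dist (?S i) (?S j) < e" by blast
  qed
  then obtain I where "?S \<longlonglongrightarrow> I" by (auto simp: Cauchy_convergent_iff convergent_def)
  then show ?thesis using sb lim0 by (auto simp: has_B_integral_def)
qed

text \<open>This characterises the integral among all vectors, by Hahn--Banach, and reduces every later computation
  with it to real-valued integrals.\<close>

lemma B_integral_functional:
  fixes f :: "real \<Rightarrow> 'b::banach" and l :: "'b \<Rightarrow> real"
  assumes N: "finite_measure N" and sN: "sets N = sets (restrict_space borel {0..})"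
    and f: "continuous_on {0..} f" and C: "\<And>r. r \<ge> 0 \<Longrightarrow> norm (f r) \<le> C"
    and l: "bounded_linear l"
  shows "l (B_integral N f) = (\<integral>r. l (f r) \<partial>N)"
proof -
  interpret l: bounded_linear l by fact
  have I: "has_B_integral N f (B_integral N f)"
    using has_B_integral_continuous_bounded[OF N sN f C] has_B_integral_unique[of N f]
    unfolding B_integral_def by (auto intro: theI2)
  obtain K where K: "K > 0" "\<And>y. norm (l y) \<le> norm y * K" using l.pos_bounded by blast
  have bl: "bounded_linear (\<lambda>y. l y / K)"
    using bounded_linear_compose[OF bounded_linear_divide l] by (simp add: o_def)
  have "has_bochner_integral N (\<lambda>r. l (f r) / K) (l (B_integral N f) / K)"
    using K by (intro has_B_integral_contraction[OF bl _ I]) (simp add: pos_divide_le_eq abs_divide)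
  from has_bochner_integral_integral_eq[OF this] show ?thesis using K(1) by simp
qed

text \<open>The Riemann sums of \<open>f\<close> and \<open>g\<close> differ by at most the Riemann sum of \<open>h\<close>, which is close to the
  small integral of \<open>h\<close>; so the Cauchy criterion passes from \<open>g\<close> to \<open>f\<close>.\<close>

lemma integrable_on_L1_limit:
  fixes f :: "real \<Rightarrow> 'b::banach"
  assumes "\<And>e. e > 0 \<Longrightarrow> \<exists>g h. g integrable_on {a..b} \<and> h integrable_on {a..b} \<and>
     integral {a..b} h < e \<and> (\<forall>x\<in>{a..b}. norm (f x - g x) \<le> (h x :: real))"
  shows "f integrable_on {a..b}"
proof -
  let ?S = "\<lambda>f p. \<Sum>(x, K)\<in>p. measure lborel K *\<^sub>R f x"
  have "\<exists>\<gamma>. gauge \<gamma> \<and> (\<forall>p1 p2. p1 tagged_division_of (cbox a b) \<and> \<gamma> fine p1 \<and>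
          p2 tagged_division_of (cbox a b) \<and> \<gamma> fine p2 \<longrightarrow> norm (?S f p1 - ?S f p2) < e)"
    if e: "e > 0" for e
  proof -
    obtain g h where g: "g integrable_on cbox a b" and h: "h integrable_on cbox a b"
      and he: "integral (cbox a b) h < e / 6" and fgh: "\<And>x. x \<in> cbox a b \<Longrightarrow> norm (f x - g x) \<le> h x"
      using assms[of "e / 6"] e by auto
    obtain \<gamma>1 where \<gamma>1: "gauge \<gamma>1" "\<And>p1 p2. p1 tagged_division_of (cbox a b) \<Longrightarrow> \<gamma>1 fine p1 \<Longrightarrow>
          p2 tagged_division_of (cbox a b) \<Longrightarrow> \<gamma>1 fine p2 \<Longrightarrow> norm (?S g p1 - ?S g p2) < e / 3"
      using g e unfolding integrable_Cauchy by (meson divide_pos_pos zero_less_numeral)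
    obtain \<gamma>2 where \<gamma>2: "gauge \<gamma>2" "\<And>p. p tagged_division_of (cbox a b) \<Longrightarrow> \<gamma>2 fine p \<Longrightarrow>
          norm (?S h p - integral (cbox a b) h) < e / 6"
      using integrable_integral[OF h] e unfolding has_integral by (metis divide_pos_pos zero_less_numeral)
    have close: "norm (?S f p - ?S g p) \<le> ?S h p" if p: "p tagged_division_of (cbox a b)" for p
    proof -
      have "?S f p - ?S g p = (\<Sum>(x,K)\<in>p. measure lborel K *\<^sub>R (f x - g x))"
        by (simp add: sum_subtractf[symmetric] split_def scaleR_diff_right)
      also have "norm \<dots> \<le> (\<Sum>(x,K)\<in>p. measure lborel K *\<^sub>R h x)"
      proof (rule sum_norm_le, clarify)
        fix x K assume "(x, K) \<in> p"
        then have "x \<in> cbox a b" using tagged_division_ofD(2,3)[OF p] by blast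
        then show "norm (measure lborel K *\<^sub>R (f x - g x)) \<le> measure lborel K *\<^sub>R h x"
          using fgh by (simp add: mult_left_mono)
      qed
      finally show ?thesis .
    qed
    show ?thesis
    proof (intro exI[of _ "\<lambda>x. \<gamma>1 x \<inter> \<gamma>2 x"] conjI allI impI)
      show "gauge (\<lambda>x. \<gamma>1 x \<inter> \<gamma>2 x)" using \<gamma>1 \<gamma>2 by (intro gauge_Int)
      fix p1 p2
      assume A: "p1 tagged_division_of (cbox a b) \<and> (\<lambda>x. \<gamma>1 x \<inter> \<gamma>2 x) fine p1 \<and>
          p2 tagged_division_of (cbox a b) \<and> (\<lambda>x. \<gamma>1 x \<inter> \<gamma>2 x) fine p2"
      then have fine: "\<gamma>1 fine p1" "\<gamma>2 fine p1" "\<gamma>1 fine p2" "\<gamma>2 fine p2"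
        and p1: "p1 tagged_division_of (cbox a b)" and p2: "p2 tagged_division_of (cbox a b)"
        by (auto simp: fine_Int)
      have 1: "norm (?S g p1 - ?S g p2) < e / 3" by (rule \<gamma>1(2)[OF p1 fine(1) p2 fine(3)])
      have 2: "?S h p1 < e / 3" "?S h p2 < e / 3"
      proof -
        have "\<bar>?S h p1 - integral (cbox a b) h\<bar> < e / 6" "\<bar>?S h p2 - integral (cbox a b) h\<bar> < e / 6"
          using \<gamma>2(2)[OF p1 fine(2)] \<gamma>2(2)[OF p2 fine(4)] unfolding real_norm_def .
        then show "?S h p1 < e / 3" "?S h p2 < e / 3" using he by linarith+
      qed
      have "norm (?S f p1 - ?S f p2)
          \<le> norm (?S f p1 - ?S g p1) + norm (?S g p1 - ?S g p2) + norm (?S f p2 - ?S g p2)"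
      proof -
        have tri: "norm (u - v) \<le> norm (u - u') + norm (u' - v') + norm (v - v')" for u v u' v' :: 'b
          using norm_triangle_ineq4[of "(u - u') + (u' - v')" "v - v'"] norm_triangle_ineq[of "u - u'" "u' - v'"]
          by simp
        show ?thesis by (rule tri)
      qed
      then show "norm (?S f p1 - ?S f p2) < e" using close[OF p1] close[OF p2] 1 2 by argo
    qed
  qed
  then have "f integrable_on cbox a b" unfolding integrable_Cauchy by blast
  then show ?thesis by simp
qed

text \<open>Needed for the memory integral, whose kernel is singular at one endpoint. On \<open>{a..b}\<close> the function \<open>y\<close>
  is uniformly approximated by step functions, and for a step function the product is a finite sum of
  vectors with real integrable coefficients.\<close>

lemma integrable_on_scaleR_continuous:
  fixes y :: "real \<Rightarrow> 'b::banach" and \<rho> :: "real \<Rightarrow> real"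
  assumes \<rho>: "\<rho> absolutely_integrable_on {a..b}" and \<rho>0: "\<And>x. x \<in> {a..b} \<Longrightarrow> \<rho> x \<ge> 0"
    and y: "continuous_on {a..b} y"
  shows "(\<lambda>x. \<rho> x *\<^sub>R y x) integrable_on {a..b}"
proof (cases "a \<le> b")
  case True
  show ?thesis
  proof (rule integrable_on_L1_limit)
    fix e :: real assume e: "e > 0"
    have \<rho>i: "\<rho> integrable_on {a..b}" using \<rho> by (rule set_lebesgue_integral_eq_integral)
    define J where "J = integral {a..b} \<rho>"
    have J0: "J \<ge> 0" unfolding J_def using \<rho>0 by (intro integral_nonneg[OF \<rho>i]) auto
    define \<epsilon> where "\<epsilon> = e / (J + 1)"
    have \<epsilon>: "\<epsilon> > 0" "\<epsilon> * J < e" using e J0 by (auto simp: \<epsilon>_def field_simps)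
    obtain d where d: "d > 0" "\<And>x x'. x \<in> {a..b} \<Longrightarrow> x' \<in> {a..b} \<Longrightarrow> dist x' x < d \<Longrightarrow> dist (y x') (y x) < \<epsilon>"
      using compact_uniformly_continuous[OF y] \<epsilon>(1) unfolding uniformly_continuous_on_def
      by (metis compact_Icc)
    \<comment> \<open>The left endpoint of the \<open>j\<close>-th cell, moved into \<open>{a..b}\<close> for the first cell.\<close>
    define q where "q j = max a (of_int j * (d / 2))" for j :: int
    define i where "i x = \<lfloor>x / (d / 2)\<rfloor>" for x
    define A where "A j = {a..b} \<inter> {x. i x = j}" for j
    define g where "g x = (\<Sum>j\<in>{i a..i b}. (if x \<in> {x. i x = j} then \<rho> x else 0) *\<^sub>R y (q j))" for x
    have gi: "g integrable_on {a..b}"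
      unfolding g_def
    proof (intro integrable_sum integrable_on_scaleR_left)
      fix j assume "j \<in> {i a..i b}"
      have "A j \<in> sets lborel" unfolding A_def i_def by measurable
      then have "\<rho> absolutely_integrable_on A j"
        by (intro set_integrable_subset[OF \<rho>]) (auto simp: A_def)
      then have "\<rho> integrable_on {a..b} \<inter> {x. i x = j}" unfolding A_def by (rule set_lebesgue_integral_eq_integral)
      then show "(\<lambda>x. if x \<in> {x. i x = j} then \<rho> x else 0) integrable_on {a..b}"
        by (subst integrable_restrict_Int) (simp add: Int_commute)
    qed simp
    have geq: "g x = \<rho> x *\<^sub>R y (q (i x))" if "x \<in> {a..b}" for x
    proof -
      have "i x \<in> {i a..i b}" using that d(1) by (auto simp: i_def intro!: floor_mono divide_right_mono)
      then show ?thesis unfolding g_def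
        by (subst sum.remove[of _ "i x"]) (auto intro!: sum.neutral)
    qed
    show "\<exists>g h. g integrable_on {a..b} \<and> h integrable_on {a..b} \<and>
       integral {a..b} h < e \<and> (\<forall>x\<in>{a..b}. norm (\<rho> x *\<^sub>R y x - g x) \<le> (h x :: real))"
    proof (intro exI[of _ g] exI[of _ "\<lambda>x. \<epsilon> * \<rho> x"] conjI ballI)
      show "integral {a..b} (\<lambda>x. \<epsilon> * \<rho> x) < e" using \<epsilon> by (simp add: J_def)
      show "(\<lambda>x. \<epsilon> * \<rho> x) integrable_on {a..b}" using integrable_on_cmult_left[OF \<rho>i, of \<epsilon>] by simp
      fix x assume x: "x \<in> {a..b}"
      have "of_int (i x) \<le> x / (d / 2)" "x / (d / 2) < of_int (i x) + 1" unfolding i_def by linarith+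
      then have "of_int (i x) * (d / 2) \<le> x" "x < of_int (i x) * (d / 2) + d / 2"
        using d(1) by (auto simp: field_simps)
      then have "q (i x) \<in> {a..b}" "dist (q (i x)) x < d" using x d(1) by (auto simp: q_def dist_real_def)
      then have "dist (y (q (i x))) (y x) < \<epsilon>" using d(2) x by blast
      then have "norm (y x - y (q (i x))) \<le> \<epsilon>" by (simp add: dist_norm norm_minus_commute)
      then have "\<rho> x * norm (y x - y (q (i x))) \<le> \<rho> x * \<epsilon>" by (rule mult_left_mono[OF _ \<rho>0[OF x]])
      then show "norm (\<rho> x *\<^sub>R y x - g x) \<le> \<epsilon> * \<rho> x"
        using \<rho>0[OF x] by (simp add: geq[OF x] scaleR_diff_right[symmetric] mult.commute)
    qed (rule gi)
  qed
qed (simp add: integrable_on_empty)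

section \<open>Laplace transforms of real functions\<close>

definition laplace :: "(real \<Rightarrow> real) \<Rightarrow> real \<Rightarrow> real" where
  "laplace h s = (LBINT t:{0..}. exp (- (s * t)) * h t)"

definition laplace_exists :: "(real \<Rightarrow> real) \<Rightarrow> real \<Rightarrow> bool" where
  "laplace_exists h s \<longleftrightarrow> set_integrable lborel {0..} (\<lambda>t. exp (- (s * t)) * h t)"

lemma
  fixes s :: real
  assumes s: "s > 0"
  shows set_integrable_exp_half_line: "set_integrable lborel {0..} (\<lambda>t. exp (- (s * t)))"
    and set_integral_exp_half_line: "(LBINT t:{0..}. exp (- (s * t))) = 1 / s"
proof -
  have *: "has_bochner_integral lborel (\<lambda>x. exp (- x) * indicator {0..} x :: real) 1"
    using has_bochner_integral_I0i_power_exp_m'[of 0] by simp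
  have **: "exp (- (0 + s * x)) * indicator {0..} (0 + s * x) = indicator {0..} x *\<^sub>R exp (- (s * x))" for x
    using s by (simp add: indicator_def zero_le_mult_iff)
  show "set_integrable lborel {0..} (\<lambda>t. exp (- (s * t)))"
    using lborel_integrable_real_affine[OF integrable.intros[OF *], of s 0] s
    unfolding ** by (simp add: set_integrable_def)
  show "(LBINT t:{0..}. exp (- (s * t))) = 1 / s"
    using lborel_integral_real_affine[of s "\<lambda>x. exp (- x) * indicator {0..} x" 0] s
      has_bochner_integral_integral_eq[OF *]
    unfolding ** by (simp add: set_lebesgue_integral_def field_simps)
qed

definition causal_convolution :: "(real \<Rightarrow> real) \<Rightarrow> (real \<Rightarrow> real) \<Rightarrow> real \<Rightarrow> real" where
  "causal_convolution w y t = (LBINT r:{0..t}. w (t - r) * y r)"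

text \<open>Linear growth is absorbed by half of the exponential decay.\<close>

lemma laplace_exists_exp_bounded:
  assumes s: "s > 0" and m: "set_borel_measurable lborel {0..} h"
    and b: "\<And>t. t \<ge> 0 \<Longrightarrow> \<bar>h t\<bar> \<le> C * (1 + t)"
  shows "laplace_exists h s"
proof -
  have C: "C \<ge> 0" using b[of 0] by simp
  have "set_integrable lborel {0..} (\<lambda>t. C * (1 + 2 / s) * exp (- ((s / 2) * t)))"
    by (intro set_integrable_mult_right set_integrable_exp_half_line) (use s in auto)
  then show ?thesis unfolding laplace_exists_def
  proof (rule set_integrable_bound)
    have [measurable]: "(\<lambda>t. indicator {0..} t * h t) \<in> borel_measurable borel"
      using m by (simp add: set_borel_measurable_def)
    have "(\<lambda>t. exp (- (s * t)) * (indicator {0..} t * h t)) \<in> borel_measurable borel" by measurable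
    then show "set_borel_measurable lborel {0..} (\<lambda>t. exp (- (s * t)) * h t)"
      by (simp add: set_borel_measurable_def ac_simps)
    show "AE t in lborel. t \<in> {0..} \<longrightarrow>
        norm (exp (- (s * t)) * h t) \<le> norm (C * (1 + 2 / s) * exp (- ((s / 2) * t)))"
    proof (rule AE_I2, rule impI)
      fix t :: real assume t: "t \<in> {0..}"
      have "t * (s / 2) \<le> exp (t * (s / 2))" by (rule order_trans[OF _ exp_ge_add_one_self]) simp
      then have 1: "t \<le> (2 / s) * exp (t * (s / 2))" using s by (simp add: field_simps)
      have "1 \<le> exp (t * (s / 2))" using t s by simp
      then have 2: "1 + t \<le> (1 + 2 / s) * exp (t * (s / 2))" using 1 by (simp only: distrib_right)
      have "exp (- (s * t)) * \<bar>h t\<bar> \<le> exp (- (s * t)) * (C * (1 + t))"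
        using b[of t] t by (intro mult_left_mono) auto
      also have "\<dots> \<le> exp (- (s * t)) * (C * ((1 + 2 / s) * exp (t * (s / 2))))"
        using 2 C by (intro mult_left_mono) auto
      also have "\<dots> = C * (1 + 2 / s) * (exp (- (s * t)) * exp (t * (s / 2)))" by simp
      also have "exp (- (s * t)) * exp (t * (s / 2)) = exp (- ((s / 2) * t))"
        by (simp add: exp_add[symmetric] field_simps)
      finally show "norm (exp (- (s * t)) * h t) \<le> norm (C * (1 + 2 / s) * exp (- ((s / 2) * t)))"
        using C s by (simp add: abs_mult)
    qed
  qed
qed

lemma laplace_const: "s > 0 \<Longrightarrow> laplace (\<lambda>_. c) s = c / s"
  unfolding laplace_def using set_integral_exp_half_line[of s] by simp

lemma laplace_add:
  "laplace_exists g s \<Longrightarrow> laplace_exists h s \<Longrightarrow> laplace (\<lambda>t. g t + h t) s = laplace g s + laplace h s"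
  unfolding laplace_def laplace_exists_def by (simp add: distrib_left)

lemma laplace_exists_add:
  "laplace_exists g s \<Longrightarrow> laplace_exists h s \<Longrightarrow> laplace_exists (\<lambda>t. g t + h t) s"
  unfolding laplace_exists_def by (simp add: distrib_left)

lemma laplace_diff:
  "laplace_exists g s \<Longrightarrow> laplace_exists h s \<Longrightarrow> laplace (\<lambda>t. g t - h t) s = laplace g s - laplace h s"
  unfolding laplace_def laplace_exists_def by (simp add: right_diff_distrib)

lemma laplace_exists_diff:
  "laplace_exists g s \<Longrightarrow> laplace_exists h s \<Longrightarrow> laplace_exists (\<lambda>t. g t - h t) s"
  unfolding laplace_exists_def by (simp add: right_diff_distrib)

lemma laplace_cmult: "laplace (\<lambda>t. c * h t) s = c * laplace h s"
proof -
  have "(\<lambda>t. exp (- (s * t)) * (c * h t)) = (\<lambda>t. c * (exp (- (s * t)) * h t))" by (simp add: ac_simps)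
  then show ?thesis unfolding laplace_def by simp
qed

lemma laplace_exists_cmult: "laplace_exists h s \<Longrightarrow> laplace_exists (\<lambda>t. c * h t) s"
proof -
  have "(\<lambda>t. exp (- (s * t)) * (c * h t)) = (\<lambda>t. c * (exp (- (s * t)) * h t))" by (simp add: ac_simps)
  then show "laplace_exists h s \<Longrightarrow> ?thesis" unfolding laplace_exists_def by simp
qed

lemma laplace_cong: "(\<And>t. t \<ge> 0 \<Longrightarrow> g t = h t) \<Longrightarrow> laplace g s = laplace h s"
  unfolding laplace_def by (intro set_lebesgue_integral_cong) auto

lemma laplace_exists_cong: "(\<And>t. t \<ge> 0 \<Longrightarrow> g t = h t) \<Longrightarrow> laplace_exists g s = laplace_exists h s"
  unfolding laplace_exists_def by (intro set_integrable_cong) auto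

lemma integral_convolution:
  fixes W Y :: "real \<Rightarrow> real"
  assumes W: "integrable lborel W" and Y: "integrable lborel Y"
  shows "integrable lborel (\<lambda>t. \<integral>r. W (t - r) * Y r \<partial>lborel)"
    and "(\<integral>t. (\<integral>r. W (t - r) * Y r \<partial>lborel) \<partial>lborel) = (\<integral>t. W t \<partial>lborel) * (\<integral>t. Y t \<partial>lborel)"
proof -
  have [measurable]: "W \<in> borel_measurable borel" "Y \<in> borel_measurable borel"
    using W Y by (auto dest: borel_measurable_integrable)
  have shift: "(\<integral>t. F (t - r) \<partial>lborel) = (\<integral>t. F t \<partial>lborel)" for F :: "real \<Rightarrow> real" and r
    using lborel_integral_real_affine[of 1 F "- r"] by simp
  have shift': "integrable lborel (\<lambda>t. F (t - r))" if "integrable lborel F" for F :: "real \<Rightarrow> real" and r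
    using lborel_integrable_real_affine[OF that, of 1 "- r"] by simp
  let ?g = "\<lambda>(r, t). W (t - r) * Y r"
  have int: "integrable (lborel \<Otimes>\<^sub>M lborel) ?g"
  proof (rule lborel_pair.Fubini_integrable)
    have "(\<lambda>r. \<integral>t. norm (W (t - r) * Y r) \<partial>lborel) = (\<lambda>r. (\<integral>t. \<bar>W t\<bar> \<partial>lborel) * \<bar>Y r\<bar>)"
      using shift[of "\<lambda>x. \<bar>W x\<bar>"] by (simp add: abs_mult)
    then show "integrable lborel (\<lambda>r. \<integral>t. norm (case (r, t) of (r, t) \<Rightarrow> W (t - r) * Y r) \<partial>lborel)"
      using Y by simp
    show "AE r in lborel. integrable lborel (\<lambda>t. case (r, t) of (r, t) \<Rightarrow> W (t - r) * Y r)"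
      using shift'[OF W] by simp
  qed measurable
  show "integrable lborel (\<lambda>t. \<integral>r. W (t - r) * Y r \<partial>lborel)"
    using lborel_pair.integrable_snd[OF int] by simp
  have "(\<integral>t. (\<integral>r. W (t - r) * Y r \<partial>lborel) \<partial>lborel) = (\<integral>r. (\<integral>t. W (t - r) * Y r \<partial>lborel) \<partial>lborel)"
    using lborel_pair.Fubini_integral[OF int] by simp
  also have "\<dots> = (\<integral>t. W t \<partial>lborel) * (\<integral>t. Y t \<partial>lborel)"
    by (simp add: shift)
  finally show "(\<integral>t. (\<integral>r. W (t - r) * Y r \<partial>lborel) \<partial>lborel) = (\<integral>t. W t \<partial>lborel) * (\<integral>t. Y t \<partial>lborel)" .
qed

lemma
  assumes w: "laplace_exists w s" and y: "laplace_exists y s"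
  shows laplace_exists_causal_convolution: "laplace_exists (causal_convolution w y) s"
    and laplace_causal_convolution: "laplace (causal_convolution w y) s = laplace w s * laplace y s"
proof -
  define W where "W t = indicator {0..} t * (exp (- (s * t)) * w t)" for t
  define Y where "Y t = indicator {0..} t * (exp (- (s * t)) * y t)" for t
  have W: "integrable lborel W" and Y: "integrable lborel Y"
    using w y by (simp_all add: laplace_exists_def set_integrable_def W_def[abs_def] Y_def[abs_def])
  have eq: "(\<integral>r. W (t - r) * Y r \<partial>lborel) = indicator {0..} t * (exp (- (s * t)) * causal_convolution w y t)" for t
  proof -
    have "(\<lambda>r. W (t - r) * Y r)
        = (\<lambda>r. indicator {0..} t * (exp (- (s * t)) * (indicator {0..t} r *\<^sub>R (w (t - r) * y r))))"
    proof
      fix r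
      have "exp (- (s * (t - r))) * exp (- (s * r)) = exp (- (s * t))"
        by (simp add: exp_add[symmetric] algebra_simps)
      then show "W (t - r) * Y r
          = indicator {0..} t * (exp (- (s * t)) * (indicator {0..t} r *\<^sub>R (w (t - r) * y r)))"
        by (auto simp: W_def Y_def indicator_def)
    qed
    then show ?thesis by (simp add: causal_convolution_def set_lebesgue_integral_def)
  qed
  show "laplace_exists (causal_convolution w y) s"
    using integral_convolution(1)[OF W Y] by (simp add: eq laplace_exists_def set_integrable_def)
  show "laplace (causal_convolution w y) s = laplace w s * laplace y s"
    using integral_convolution(2)[OF W Y]
    unfolding eq by (simp add: laplace_def set_lebesgue_integral_def W_def Y_def)
qed

text \<open>As \<open>y\<close> vanishes at \<open>0\<close>, it extends continuously by \<open>0\<close> to the negative half-line; after the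
  substitution \<open>r \<mapsto> t - r\<close> the domain of integration no longer depends on \<open>t\<close>, and dominated
  convergence applies.\<close>

lemma continuous_on_causal_convolution:
  fixes w y :: "real \<Rightarrow> real"
  assumes w: "\<And>t. t \<ge> 0 \<Longrightarrow> set_integrable lborel {0..t} w"
    and y: "continuous_on {0..} y" and y0: "y 0 = 0" and C: "\<And>t. t \<ge> 0 \<Longrightarrow> \<bar>y t\<bar> \<le> C"
  shows "continuous_on {0..} (causal_convolution w y)"
proof -
  define Y where "Y x = y (max 0 x)" for x
  have Yc: "continuous_on UNIV Y" unfolding Y_def
    by (rule continuous_on_compose2[OF y]) (auto intro!: continuous_intros)
  then have [measurable]: "Y \<in> borel_measurable borel" by (rule borel_measurable_continuous_onI)
  have Y0: "Y x = 0" if "x \<le> 0" for x using that y0 by (simp add: Y_def max_def)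
  have conv: "causal_convolution w y t = (\<integral>r. indicator {0..b} r * w r * Y (t - r) \<partial>lborel)"
    if t: "0 \<le> t" "t \<le> b" for t b
  proof -
    have "causal_convolution w y t = (\<integral>r. indicator {0..t} r * (w (t - r) * y r) \<partial>lborel)"
      by (simp add: causal_convolution_def set_lebesgue_integral_def)
    also have "\<dots> = (\<integral>r. indicator {0..t} (t - r) * (w (t - (t - r)) * y (t - r)) \<partial>lborel)"
      using lborel_integral_real_affine[of "-1" "\<lambda>r. indicator {0..t} r * (w (t - r) * y r)" t] by simp
    also have "\<dots> = (\<integral>r. indicator {0..b} r * w r * Y (t - r) \<partial>lborel)"
      using t Y0 by (intro Bochner_Integration.integral_cong) (auto simp: indicator_def Y_def)
    finally show ?thesis .
  qed
  have "isCont (\<lambda>t. \<integral>r. indicator {0..b} r * w r * Y (t - r) \<partial>lborel) t" if b: "b \<ge> 0" for b t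
  proof (rule continuous_at_sequentiallyI, rule integral_dominated_convergence[where w = "\<lambda>r. C * \<bar>indicator {0..b} r * w r\<bar>"])
    fix u :: "nat \<Rightarrow> real" assume u: "u \<longlonglongrightarrow> t"
    have int: "integrable lborel (\<lambda>r. indicator {0..b} r * w r)"
      using w[OF b] by (simp add: set_integrable_def)
    then have [measurable]: "(\<lambda>r. indicator {0..b} r * w r) \<in> borel_measurable borel" by auto
    show "(\<lambda>r. indicator {0..b} r * w r * Y (t - r)) \<in> borel_measurable lborel"
      "(\<lambda>r. indicator {0..b} r * w r * Y (u n - r)) \<in> borel_measurable lborel" for n by measurable
    show "integrable lborel (\<lambda>r. C * \<bar>indicator {0..b} r * w r\<bar>)" using int by simp
    have "(\<lambda>n. Y (u n - r)) \<longlonglongrightarrow> Y (t - r)" for r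
      using u by (intro continuous_on_tendsto_compose[OF Yc] tendsto_intros) auto
    then show "AE r in lborel. (\<lambda>n. indicator {0..b} r * w r * Y (u n - r)) \<longlonglongrightarrow> indicator {0..b} r * w r * Y (t - r)"
      by (intro AE_I2 tendsto_intros)
    show "AE r in lborel. norm (indicator {0..b} r * w r * Y (u n - r)) \<le> C * \<bar>indicator {0..b} r * w r\<bar>" for n
    proof (intro AE_I2)
      fix r
      have "\<bar>Y (u n - r)\<bar> \<le> C" unfolding Y_def by (rule C) simp
      from mult_left_mono[OF this, of "\<bar>indicator {0..b} r * w r\<bar>"]
      show "norm (indicator {0..b} r * w r * Y (u n - r)) \<le> C * \<bar>indicator {0..b} r * w r\<bar>"
        by (simp add: abs_mult ac_simps)
    qed
  qed
  then have c: "continuous_on {0..<b} (causal_convolution w y)" if "b \<ge> 0" for b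
    using that by (subst continuous_on_cong[OF refl, OF conv[of _ b]]) (auto intro!: continuous_at_imp_continuous_on)
  show ?thesis
    unfolding continuous_on_eq_continuous_within
  proof
    fix t :: real assume t: "t \<in> {0..}"
    have "continuous (at t within {0..<t + 1}) (causal_convolution w y)"
      using c[of "t + 1"] t by (auto simp: continuous_on_eq_continuous_within)
    moreover have "at t within {0..<t + 1} = at t within {0..}"
      using t by (intro at_within_nhd[of _ "{..<t+1}"]) auto
    ultimately show "continuous (at t within {0..}) (causal_convolution w y)" by simp
  qed
qed

text \<open>Lerch's theorem for continuous functions. The values at \<open>s = 1, 2, 3, \<dots>\<close> say that
  \<open>G t = exp (- t) * h t\<close> is orthogonal to all powers of \<open>exp (- t)\<close>, hence by Weierstrass to every
  continuous function of \<open>exp (- t)\<close>. A bump function supported where \<open>h\<close> has a constant sign then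
  excludes \<open>h t0 \<noteq> 0\<close>.\<close>

lemma laplace_eq_0_imp_eq_0:
  fixes h :: "real \<Rightarrow> real"
  assumes h: "continuous_on {0..} h" and ex: "\<And>s. s > 0 \<Longrightarrow> laplace_exists h s"
    and zero: "\<And>s. s > 0 \<Longrightarrow> laplace h s = 0" and t: "t \<ge> 0"
  shows "h t = 0"
proof -
  define G where "G t = indicator {0..} t * (exp (- t) * h t)" for t
  have G: "integrable lborel G" using ex[of 1] by (simp add: laplace_exists_def set_integrable_def G_def[abs_def])
  then have [measurable]: "G \<in> borel_measurable borel" by auto
  have Gpow: "integrable lborel (\<lambda>t. exp (- t) ^ n * G t)" "(\<integral>t. exp (- t) ^ n * G t \<partial>lborel) = 0" for n :: nat
  proof -
    have "exp (- t) ^ n * G t = indicator {0..} t *\<^sub>R (exp (- ((real n + 1) * t)) * h t)" for t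
      by (simp add: G_def exp_of_nat_mult[symmetric] algebra_simps flip: exp_add)
    then show "integrable lborel (\<lambda>t. exp (- t) ^ n * G t)" "(\<integral>t. exp (- t) ^ n * G t \<partial>lborel) = 0"
      using ex[of "real n + 1"] zero[of "real n + 1"]
      by (simp_all add: laplace_exists_def set_integrable_def laplace_def set_lebesgue_integral_def)
  qed
  have Gc: "(\<integral>t. c (exp (- t)) * G t \<partial>lborel) = 0" if c: "continuous_on UNIV c" for c :: "real \<Rightarrow> real"
  proof -
    have [measurable]: "c \<in> borel_measurable borel" using c by (rule borel_measurable_continuous_onI)
    define J where "J = (\<integral>t. \<bar>G t\<bar> \<partial>lborel)"
    have J: "J \<ge> 0" by (simp add: J_def)
    have "\<bar>\<integral>t. c (exp (- t)) * G t \<partial>lborel\<bar> \<le> e * J" if e: "e > 0" for e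
    proof -
      obtain p where p: "real_polynomial_function p" "\<And>x. x \<in> {0..1} \<Longrightarrow> \<bar>c x - p x\<bar> < e"
        using Stone_Weierstrass_real_polynomial_function[of "{0..1::real}" c e] continuous_on_subset[OF c] e by auto
      obtain a n where pa: "p = (\<lambda>x. \<Sum>i\<le>n. a i * x ^ i)"
        using p(1) by (auto simp: real_polynomial_function_iff_sum)
      have pG: "(\<lambda>t. p (exp (- t)) * G t) = (\<lambda>t. \<Sum>i\<le>n. a i * (exp (- t) ^ i * G t))"
        by (simp add: pa sum_distrib_right mult.assoc)
      have p0: "integrable lborel (\<lambda>t. p (exp (- t)) * G t)" "(\<integral>t. p (exp (- t)) * G t \<partial>lborel) = 0"
        unfolding pG using Gpow by (simp_all add: Bochner_Integration.integral_sum)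
      have bd: "\<bar>c (exp (- t)) * G t - p (exp (- t)) * G t\<bar> \<le> e * \<bar>G t\<bar>" for t
      proof (cases "t \<ge> 0")
        case True
        then have "\<bar>c (exp (- t)) - p (exp (- t))\<bar> \<le> e" using p(2)[of "exp (- t)"] by simp
        from mult_right_mono[OF this, of "\<bar>G t\<bar>"] show ?thesis by (simp add: abs_mult[symmetric] algebra_simps)
      qed (simp add: G_def)
      have i: "integrable lborel (\<lambda>t. c (exp (- t)) * G t - p (exp (- t)) * G t)"
      proof (rule Bochner_Integration.integrable_bound)
        show "integrable lborel (\<lambda>t. e * \<bar>G t\<bar>)" using G by simp
        show "(\<lambda>t. c (exp (- t)) * G t - p (exp (- t)) * G t) \<in> borel_measurable lborel"
          using borel_measurable_integrable[OF p0(1)] by measurable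
      qed (use bd e in \<open>simp add: abs_mult\<close>)
      have "(\<integral>t. c (exp (- t)) * G t \<partial>lborel)
          = (\<integral>t. (c (exp (- t)) * G t - p (exp (- t)) * G t) + p (exp (- t)) * G t \<partial>lborel)" by simp
      also have "\<dots> = (\<integral>t. c (exp (- t)) * G t - p (exp (- t)) * G t \<partial>lborel)"
        by (subst Bochner_Integration.integral_add[OF i p0(1)]) (simp add: p0(2))
      also have "\<bar>\<dots>\<bar> \<le> (\<integral>t. e * \<bar>G t\<bar> \<partial>lborel)"
        by (rule order_trans[OF integral_abs_bound integral_mono]) (use i G bd in auto)
      finally show ?thesis by (simp add: J_def)
    qed
    note * = this
    show ?thesis
    proof (rule ccontr)
      assume ne: "(\<integral>t. c (exp (- t)) * G t \<partial>lborel) \<noteq> 0" (is "?I \<noteq> 0")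
      have "\<bar>?I\<bar> / (2 * (J + 1)) * J < \<bar>?I\<bar>"
      proof -
        have "\<bar>?I\<bar> * J < \<bar>?I\<bar> * (2 * (J + 1))" using ne J by (intro mult_strict_left_mono) auto
        then show ?thesis using J by (simp only: times_divide_eq_left) (subst pos_divide_less_eq, auto)
      qed
      then show False using *[of "\<bar>?I\<bar> / (2 * (J + 1))"] ne J by simp
    qed
  qed
  have pos: "h t0 = 0" if t0: "t0 > 0" for t0
  proof (rule ccontr)
    assume ne: "h t0 \<noteq> 0"
    define \<sigma> where "\<sigma> = sgn (h t0)"
    have \<sigma>: "\<sigma> * h t0 > 0" using ne by (simp add: \<sigma>_def sgn_real_def)
    have "isCont h t0" using h t0 continuous_on_interior[of "{0..}" h t0] by simp
    then have "isCont (\<lambda>t. \<sigma> * h t) t0" by (intro continuous_intros)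
    then have "((\<lambda>t. \<sigma> * h t) \<longlongrightarrow> \<sigma> * h t0) (nhds t0)"
      using tendsto_at_iff_tendsto_nhds[of "\<lambda>t. \<sigma> * h t" t0] by (simp add: isCont_def)
    then have "\<forall>\<^sub>F t in nhds t0. \<sigma> * h t > 0" using \<sigma> by (rule order_tendstoD)
    then obtain d where d: "d > 0" "\<And>t. dist t t0 < d \<Longrightarrow> \<sigma> * h t > 0"
      by (auto simp: eventually_nhds_metric)
    define x0 where "x0 = exp (- t0)"
    define \<rho> where "\<rho> = min (x0 - exp (- (t0 + d))) (exp (- (t0 - d)) - x0)"
    have \<rho>: "\<rho> > 0" using d(1) by (simp add: \<rho>_def x0_def)
    have near: "\<sigma> * h t > 0" if "\<bar>exp (- t) - x0\<bar> < \<rho>" for t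
    proof -
      have "exp (- (t0 + d)) < exp (- t)" "exp (- t) < exp (- (t0 - d))"
        using that unfolding \<rho>_def min_less_iff_conj by linarith+
      then show ?thesis using d(2)[of t] by (auto simp: dist_real_def)
    qed
    define c where "c x = \<sigma> * max 0 (\<rho> - \<bar>x - x0\<bar>)" for x
    have "continuous_on UNIV c" unfolding c_def by (intro continuous_intros)
    then have I0: "(\<integral>t. c (exp (- t)) * G t \<partial>lborel) = 0" and [measurable]: "c \<in> borel_measurable borel"
      by (auto intro: Gc borel_measurable_continuous_onI)
    have ceq: "c (exp (- t)) * G t = max 0 (\<rho> - \<bar>exp (- t) - x0\<bar>) * (indicator {0..} t * exp (- t)) * (\<sigma> * h t)" for t
      by (simp add: c_def G_def)
    have nn: "c (exp (- t)) * G t \<ge> 0" for t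
      unfolding ceq using near[of t] by (cases "\<bar>exp (- t) - x0\<bar> < \<rho>") (auto intro!: mult_nonneg_nonneg)
    have ci: "integrable lborel (\<lambda>t. c (exp (- t)) * G t)"
    proof (rule Bochner_Integration.integrable_bound)
      show "integrable lborel (\<lambda>t. \<rho> * \<bar>G t\<bar>)" using G by simp
      have "\<bar>\<sigma>\<bar> \<le> 1" by (simp add: \<sigma>_def sgn_real_def)
      then have "\<bar>c x\<bar> \<le> 1 * \<rho>" for x unfolding c_def abs_mult using \<rho> by (intro mult_mono) auto
      then show "AE t in lborel. norm (c (exp (- t)) * G t) \<le> norm (\<rho> * \<bar>G t\<bar>)"
        using \<rho> by (auto simp: abs_mult intro!: mult_right_mono)
    qed measurable
    have AE0: "AE t in lborel. c (exp (- t)) * G t = 0"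
      using integral_nonneg_eq_0_iff_AE[OF ci] nn I0 by simp
    have "\<forall>\<^sub>F t in nhds t0. \<bar>exp (- t) - x0\<bar> < \<rho> \<and> t > 0"
    proof (rule eventually_conj)
      have "isCont (\<lambda>t. \<bar>exp (- t) - x0\<bar>) t0" by (intro continuous_intros)
      then have "((\<lambda>t. \<bar>exp (- t) - x0\<bar>) \<longlongrightarrow> \<bar>exp (- t0) - x0\<bar>) (nhds t0)"
        using tendsto_at_iff_tendsto_nhds[of "\<lambda>t. \<bar>exp (- t) - x0\<bar>" t0] by (simp add: isCont_def)
      then show "\<forall>\<^sub>F t in nhds t0. \<bar>exp (- t) - x0\<bar> < \<rho>"
        by (rule order_tendstoD) (simp add: x0_def \<rho>)
      show "\<forall>\<^sub>F t in nhds t0. t > 0" by (rule order_tendstoD[OF filterlim_ident t0])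
    qed
    then obtain b where b: "b > 0" "\<And>t. dist t t0 < b \<Longrightarrow> \<bar>exp (- t) - x0\<bar> < \<rho> \<and> t > 0"
      by (auto simp: eventually_nhds_metric)
    from AE0 have "AE t in lborel. t \<notin> {t0 - b<..<t0 + b}"
    proof eventually_elim
      case (elim t)
      show ?case
      proof
        assume "t \<in> {t0 - b<..<t0 + b}"
        then have "\<bar>exp (- t) - x0\<bar> < \<rho>" "t > 0" using b(2)[of t] by (auto simp: dist_real_def)
        then have "c (exp (- t)) * G t > 0" unfolding ceq using near[of t] by (auto intro!: mult_pos_pos)
        then show False using elim by simp
      qed
    qed
    then have "emeasure lborel {t0 - b<..<t0 + b} = 0"
      by (subst (asm) AE_iff_measurable[of "{t0 - b<..<t0 + b}"]) auto
    then show False using b(1) by simp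
  qed
  show ?thesis
  proof (cases "t = 0")
    case True
    have "(h \<longlongrightarrow> h 0) (at_right 0)"
      using h by (auto simp: continuous_on_def intro: tendsto_within_subset)
    moreover have "(h \<longlongrightarrow> 0) (at_right 0)"
      by (rule tendsto_eventually) (use pos in \<open>simp add: eventually_at_filter\<close>)
    ultimately show ?thesis using True tendsto_unique[OF trivial_limit_at_right_real] by blast
  qed (use pos t in auto)
qed

lemma pos_if_inverse_less: "1 / (1 + real n) < z \<Longrightarrow> 0 < z"
  by (rule le_less_trans[of 0 "1 / (1 + real n)"]) auto

section \<open>The tail of a Levy measure\<close>

locale levy_measure =
  fixes \<mu> :: "real measure"
  assumes sets_mu: "sets \<mu> = sets (restrict_space borel {0<..})"
    and min_finite: "(\<integral>\<^sup>+z. ennreal (min 1 z) \<partial>\<mu>) < \<infinity>"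
begin

lemma space_mu: "space \<mu> = {0<..}"
  using sets_eq_imp_space_eq[OF sets_mu] by (simp add: space_restrict_space)

lemma borel_measurable_mu: "f \<in> borel_measurable borel \<Longrightarrow> f \<in> borel_measurable \<mu>"
  using measurable_restrict_space1[of f borel borel "{0<..}"] measurable_cong_sets[OF sets_mu refl] by blast

lemma greaterThan_sets: "r \<ge> 0 \<Longrightarrow> {r<..} \<in> sets \<mu>"
  unfolding sets_mu by (auto simp: sets_restrict_space_iff)

lemma emeasure_tail_finite: "r > 0 \<Longrightarrow> emeasure \<mu> {r<..} < \<infinity>"
proof -
  assume r: "r > 0"
  have "ennreal (min 1 r) * emeasure \<mu> {r<..} = (\<integral>\<^sup>+z. ennreal (min 1 r) * indicator {r<..} z \<partial>\<mu>)"
    using r greaterThan_sets by (simp add: nn_integral_cmult_indicator)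
  also have "\<dots> \<le> (\<integral>\<^sup>+z. ennreal (min 1 z) \<partial>\<mu>)"
    by (intro nn_integral_mono) (auto simp: indicator_def intro!: ennreal_leI)
  finally have "ennreal (min 1 r) * emeasure \<mu> {r<..} < \<infinity>" using min_finite by (rule le_less_trans)
  moreover have "ennreal (min 1 r) \<noteq> 0" using r by simp
  ultimately show ?thesis by (auto simp: ennreal_mult_less_top)
qed

lemma ennreal_tail: "r > 0 \<Longrightarrow> ennreal (tail \<mu> r) = emeasure \<mu> {r<..}"
  unfolding tail_def using emeasure_tail_finite[of r] by (simp add: emeasure_eq_ennreal_measure less_top)

lemma tail_nonneg: "tail \<mu> r \<ge> 0" by (simp add: tail_def)

lemma sigma_finite_mu: "sigma_finite_measure \<mu>"
proof
  show "\<exists>A. countable A \<and> A \<subseteq> sets \<mu> \<and> \<Union>A = space \<mu> \<and> (\<forall>a\<in>A. emeasure \<mu> a \<noteq> \<infinity>)"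
  proof (intro exI[of _ "range (\<lambda>n::nat. {1 / Suc n<..})"] conjI)
    show "\<Union>(range (\<lambda>n::nat. {1 / Suc n<..})) = space \<mu>"
    proof (intro equalityI subsetI)
      fix z assume "z \<in> space \<mu>"
      then obtain n where "inverse (real (Suc n)) < z" using reals_Archimedean by (auto simp: space_mu)
      then show "z \<in> \<Union>(range (\<lambda>n::nat. {1 / Suc n<..}))" by (auto simp: inverse_eq_divide)
    qed (auto simp: space_mu dest: pos_if_inverse_less)
  qed (use greaterThan_sets emeasure_tail_finite in \<open>auto simp: less_top\<close>)
qed

lemma measurable_less_pair[measurable]: "{p \<in> space (lborel \<Otimes>\<^sub>M \<mu>). fst p < snd p} \<in> sets (lborel \<Otimes>\<^sub>M \<mu>)"
  "(\<lambda>p. fst p) \<in> borel_measurable (lborel \<Otimes>\<^sub>M \<mu>)"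
proof -
  have [measurable]: "fst \<in> borel_measurable (lborel \<Otimes>\<^sub>M \<mu>)"
    using measurable_fst[of lborel \<mu>] by simp
  have [measurable]: "snd \<in> borel_measurable (lborel \<Otimes>\<^sub>M \<mu>)"
    using measurable_compose[OF measurable_snd borel_measurable_mu[of "\<lambda>z. z"]] by simp
  show "{p \<in> space (lborel \<Otimes>\<^sub>M \<mu>). fst p < snd p} \<in> sets (lborel \<Otimes>\<^sub>M \<mu>)" by measurable
  show "(\<lambda>p. fst p) \<in> borel_measurable (lborel \<Otimes>\<^sub>M \<mu>)" by measurable
qed

lemma tail_measurable: "set_borel_measurable lborel {0..} (tail \<mu>)"
proof -
  interpret sigma_finite_measure \<mu> by (rule sigma_finite_mu)
  have "(\<lambda>p. indicator {p \<in> space (lborel \<Otimes>\<^sub>M \<mu>). fst p < snd p} p :: ennreal) \<in> borel_measurable (lborel \<Otimes>\<^sub>M \<mu>)"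
    by (intro borel_measurable_indicator measurable_less_pair)
  then have "(\<lambda>r. \<integral>\<^sup>+z. indicator {p \<in> space (lborel \<Otimes>\<^sub>M \<mu>). fst p < snd p} (r, z) \<partial>\<mu>) \<in> borel_measurable lborel"
    by (intro borel_measurable_nn_integral) (simp add: split_beta')
  then have [measurable]: "(\<lambda>r. enn2real (\<integral>\<^sup>+z. indicator {p \<in> space (lborel \<Otimes>\<^sub>M \<mu>). fst p < snd p} (r, z) \<partial>\<mu>)) \<in> borel_measurable borel"
    by simp
  have eq: "(\<integral>\<^sup>+z. indicator {p \<in> space (lborel \<Otimes>\<^sub>M \<mu>). fst p < snd p} (r, z) \<partial>\<mu>) = emeasure \<mu> {r<..}" if "r \<ge> 0" for r
  proof -
    have "(\<integral>\<^sup>+z. indicator {p \<in> space (lborel \<Otimes>\<^sub>M \<mu>). fst p < snd p} (r, z) \<partial>\<mu>) = (\<integral>\<^sup>+z. indicator {r<..} z \<partial>\<mu>)"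
      by (intro nn_integral_cong) (auto simp: indicator_def space_pair_measure)
    then show ?thesis using greaterThan_sets[OF that] by simp
  qed
  have "(\<lambda>r. indicator {0..} r *\<^sub>R tail \<mu> r) = (\<lambda>r. indicator {0..} r *
      enn2real (\<integral>\<^sup>+z. indicator {p \<in> space (lborel \<Otimes>\<^sub>M \<mu>). fst p < snd p} (r, z) \<partial>\<mu>))"
  proof
    fix r show "indicator {0..} r *\<^sub>R tail \<mu> r = indicator {0..} r *
      enn2real (\<integral>\<^sup>+z. indicator {p \<in> space (lborel \<Otimes>\<^sub>M \<mu>). fst p < snd p} (r, z) \<partial>\<mu>)"
      using eq[of r] by (cases "r \<ge> 0") (simp_all add: tail_def measure_def)
  qed
  moreover have "(\<lambda>r. indicator {0..} r *
      enn2real (\<integral>\<^sup>+z. indicator {p \<in> space (lborel \<Otimes>\<^sub>M \<mu>). fst p < snd p} (r, z) \<partial>\<mu>)) \<in> borel_measurable borel"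
    by measurable
  ultimately show ?thesis unfolding set_borel_measurable_def by simp
qed

text \<open>Tonelli, writing the tail as the integral of the indicator of \<open>r < z\<close> against \<open>\<mu>\<close>.\<close>

lemma nn_integral_tail:
  assumes c[measurable]: "c \<in> borel_measurable borel"
  shows "(\<integral>\<^sup>+r. c r * (indicator {0<..} r * ennreal (tail \<mu> r)) \<partial>lborel)
       = (\<integral>\<^sup>+z. (\<integral>\<^sup>+r. c r * indicator {0<..<z} r \<partial>lborel) \<partial>\<mu>)"
proof -
  interpret sigma_finite_measure \<mu> by (rule sigma_finite_mu)
  interpret P: pair_sigma_finite lborel \<mu> by (simp add: pair_sigma_finite_def sigma_finite_mu lborel.sigma_finite_measure_axioms)
  let ?Q = "{p \<in> space (lborel \<Otimes>\<^sub>M \<mu>). fst p < snd p}"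
  let ?g = "\<lambda>p. c (fst p) * (indicator {0<..} (fst p) * indicator ?Q p)"
  have [measurable]: "?g \<in> borel_measurable (lborel \<Otimes>\<^sub>M \<mu>)"
    using measurable_less_pair by measurable
  have "(\<integral>\<^sup>+r. c r * (indicator {0<..} r * ennreal (tail \<mu> r)) \<partial>lborel) = (\<integral>\<^sup>+r. (\<integral>\<^sup>+z. ?g (r, z) \<partial>\<mu>) \<partial>lborel)"
  proof (rule nn_integral_cong)
    fix r :: real
    have "(\<integral>\<^sup>+z. ?g (r, z) \<partial>\<mu>) = (\<integral>\<^sup>+z. c r * (indicator {0<..} r * indicator {r<..} z) \<partial>\<mu>)"
      by (intro nn_integral_cong) (auto simp: indicator_def space_pair_measure)
    also have "\<dots> = c r * (indicator {0<..} r * ennreal (tail \<mu> r))"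
    proof (cases "r > 0")
      case True
      then show ?thesis using greaterThan_sets[of r] by (simp add: nn_integral_cmult_indicator ennreal_tail)
    qed simp
    finally show "c r * (indicator {0<..} r * ennreal (tail \<mu> r)) = (\<integral>\<^sup>+z. ?g (r, z) \<partial>\<mu>)" by simp
  qed
  also have "\<dots> = (\<integral>\<^sup>+z. (\<integral>\<^sup>+r. ?g (r, z) \<partial>lborel) \<partial>\<mu>)"
    by (rule P.Fubini'[symmetric]) simp
  also have "\<dots> = (\<integral>\<^sup>+z. (\<integral>\<^sup>+r. c r * indicator {0<..<z} r \<partial>lborel) \<partial>\<mu>)"
    by (intro nn_integral_cong) (auto simp: indicator_def space_pair_measure)
  finally show ?thesis .
qed

lemma tail_integrable:
  assumes t: "t \<ge> 0"
  shows "set_integrable lborel {0..t} (tail \<mu>)"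
proof -
  let ?C = "\<integral>\<^sup>+z. ennreal (min 1 z) \<partial>\<mu>"
  have m: "(\<lambda>r. indicator {0..t} r * tail \<mu> r) \<in> borel_measurable lborel"
  proof -
    have "(\<lambda>r. indicator {0..t} r * (indicator {0..} r *\<^sub>R tail \<mu> r)) \<in> borel_measurable lborel"
      using tail_measurable unfolding set_borel_measurable_def by measurable
    also have "(\<lambda>r. indicator {0..t} r * (indicator {0..} r *\<^sub>R tail \<mu> r)) = (\<lambda>r. indicator {0..t} r * tail \<mu> r)"
      by (auto simp: indicator_def)
    finally show ?thesis .
  qed
  have "(\<integral>\<^sup>+r. ennreal (indicator {0..t} r * tail \<mu> r) \<partial>lborel)
      = (\<integral>\<^sup>+r. indicator {0..t} r * (indicator {0<..} r * ennreal (tail \<mu> r)) \<partial>lborel)"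
    by (intro nn_integral_cong_AE, use AE_lborel_singleton[of 0] in eventually_elim)
       (auto simp: indicator_def)
  also have "\<dots> = (\<integral>\<^sup>+z. (\<integral>\<^sup>+r. indicator {0..t} r * indicator {0<..<z} r \<partial>lborel) \<partial>\<mu>)"
    by (rule nn_integral_tail) measurable
  also have "\<dots> \<le> (\<integral>\<^sup>+z. ennreal (1 + t) * ennreal (min 1 z) \<partial>\<mu>)"
  proof (rule nn_integral_mono)
    fix z assume "z \<in> space \<mu>"
    then have z: "z > 0" by (simp add: space_mu)
    have "(\<integral>\<^sup>+r. indicator {0..t} r * indicator {0<..<z} r \<partial>lborel) \<le> (\<integral>\<^sup>+r. indicator {0..min t z} r \<partial>lborel)"
      by (intro nn_integral_mono) (auto simp: indicator_def)
    also have "\<dots> = ennreal (min t z)" using t z by simp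
    also have "\<dots> \<le> ennreal ((1 + t) * min 1 z)"
    proof (rule ennreal_leI, cases "z \<ge> 1")
      case False
      have "min t z \<le> z" "0 \<le> t * z" using t z by auto
      then have "min t z \<le> (1 + t) * z" unfolding distrib_right by linarith
      then show "min t z \<le> (1 + t) * min 1 z" using False by simp
    qed auto
    finally show "(\<integral>\<^sup>+r. indicator {0..t} r * indicator {0<..<z} r \<partial>lborel) \<le> ennreal (1 + t) * ennreal (min 1 z)"
      using t z by (simp add: ennreal_mult)
  qed
  also have "\<dots> = ennreal (1 + t) * ?C" by (intro nn_integral_cmult borel_measurable_mu) measurable
  finally have le: "(\<integral>\<^sup>+r. ennreal (indicator {0..t} r * tail \<mu> r) \<partial>lborel) \<le> ennreal (1 + t) * ?C" .
  also have "\<dots> < \<infinity>" using min_finite by (simp add: ennreal_mult_less_top)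
  finally have fin: "(\<integral>\<^sup>+r. ennreal (indicator {0..t} r * tail \<mu> r) \<partial>lborel) < \<infinity>" .
  show "set_integrable lborel {0..t} (tail \<mu>)"
    unfolding set_integrable_def using m fin tail_nonneg by (intro integrableI_bounded) auto
qed

lemma integrable_levy:
  assumes s: "s > 0"
  shows "integrable \<mu> (\<lambda>z. 1 - exp (- s * z))"
proof (rule integrableI_bounded)
  have "(\<integral>\<^sup>+z. ennreal (norm (1 - exp (- s * z))) \<partial>\<mu>) \<le> (\<integral>\<^sup>+z. ennreal (1 + s) * ennreal (min 1 z) \<partial>\<mu>)"
  proof (rule nn_integral_mono)
    fix z assume "z \<in> space \<mu>"
    then have z: "z > 0" by (simp add: space_mu)
    have "1 - exp (- s * z) \<le> s * z" using exp_ge_add_one_self[of "- s * z"] by simp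
    moreover have "1 - exp (- s * z) \<le> 1" by simp
    moreover have "exp (- s * z) \<le> 1" using s z by simp
    ultimately have "norm (1 - exp (- s * z)) \<le> (1 + s) * min 1 z"
      using s z by (auto simp: min_def algebra_simps)
    then show "ennreal (norm (1 - exp (- s * z))) \<le> ennreal (1 + s) * ennreal (min 1 z)"
      using s z by (subst ennreal_mult[symmetric]) (auto intro!: ennreal_leI simp del: ennreal_plus)
  qed
  also have "\<dots> = ennreal (1 + s) * (\<integral>\<^sup>+z. ennreal (min 1 z) \<partial>\<mu>)" by (intro nn_integral_cmult borel_measurable_mu) measurable
  also have "\<dots> < \<infinity>" using min_finite by (simp add: ennreal_mult_less_top)
  finally show "(\<integral>\<^sup>+z. ennreal (norm (1 - exp (- s * z))) \<partial>\<mu>) < \<infinity>" .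
qed (intro borel_measurable_mu, measurable)

lemma levy_integral_nonneg: "s > 0 \<Longrightarrow> (\<integral>z. (1 - exp (- s * z)) \<partial>\<mu>) \<ge> 0"
  by (intro integral_nonneg_AE AE_I2) (auto simp: space_mu)

lemma
  assumes s: "s > 0"
  shows laplace_exists_tail: "laplace_exists (tail \<mu>) s"
    and laplace_tail: "laplace (tail \<mu>) s = (\<integral>z. (1 - exp (- s * z)) \<partial>\<mu>) / s"
proof -
  let ?h = "\<lambda>r. indicator {0..} r * (exp (- (s * r)) * tail \<mu> r)"
  have m: "?h \<in> borel_measurable lborel"
  proof -
    have "(\<lambda>r. exp (- (s * r)) * (indicator {0..} r *\<^sub>R tail \<mu> r)) \<in> borel_measurable lborel"
      using tail_measurable unfolding set_borel_measurable_def by measurable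
    then show ?thesis by (simp add: ac_simps)
  qed
  have "(\<integral>\<^sup>+r. ennreal (?h r) \<partial>lborel)
      = (\<integral>\<^sup>+r. ennreal (exp (- (s * r))) * (indicator {0<..} r * ennreal (tail \<mu> r)) \<partial>lborel)"
    by (intro nn_integral_cong_AE, use AE_lborel_singleton[of 0] in eventually_elim)
       (auto simp: indicator_def ennreal_mult tail_nonneg)
  also have "\<dots> = (\<integral>\<^sup>+z. (\<integral>\<^sup>+r. ennreal (exp (- (s * r))) * indicator {0<..<z} r \<partial>lborel) \<partial>\<mu>)"
    by (rule nn_integral_tail) measurable
  also have "\<dots> = (\<integral>\<^sup>+z. ennreal ((1 - exp (- s * z)) / s) \<partial>\<mu>)"
  proof (rule nn_integral_cong)
    fix z assume "z \<in> space \<mu>"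
    then have z: "z > 0" by (simp add: space_mu)
    have "(\<integral>\<^sup>+r. ennreal (exp (- (s * r))) * indicator {0<..<z} r \<partial>lborel)
        = (\<integral>\<^sup>+r. ennreal (exp (- (s * r))) * indicator {0..z} r \<partial>lborel)"
      by (intro nn_integral_cong_AE, use AE_lborel_singleton[of 0] AE_lborel_singleton[of z] in eventually_elim)
         (auto simp: indicator_def)
    also have "\<dots> = ennreal (- exp (- (s * z)) / s - (- exp (- (s * 0)) / s))"
      by (rule nn_integral_FTC_Icc) (use z s in \<open>auto intro!: derivative_eq_intros\<close>)
    finally show "(\<integral>\<^sup>+r. ennreal (exp (- (s * r))) * indicator {0<..<z} r \<partial>lborel) = ennreal ((1 - exp (- s * z)) / s)"
      by (simp add: diff_divide_distrib)
  qed
  also have "\<dots> = ennreal (\<integral>z. (1 - exp (- s * z)) / s \<partial>\<mu>)"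
    using integrable_levy[OF s] s
    by (intro nn_integral_eq_integral) (auto simp: space_mu intro!: AE_I2)
  finally have eq: "(\<integral>\<^sup>+r. ennreal (?h r) \<partial>lborel) = ennreal ((\<integral>z. (1 - exp (- s * z)) \<partial>\<mu>) / s)" by simp
  have int: "has_bochner_integral lborel ?h ((\<integral>z. (1 - exp (- s * z)) \<partial>\<mu>) / s)"
    using m eq tail_nonneg levy_integral_nonneg[OF s] s by (intro has_bochner_integral_nn_integral) auto
  show "laplace_exists (tail \<mu>) s"
    using integrable.intros[OF int] by (simp add: laplace_exists_def set_integrable_def)
  show "laplace (tail \<mu>) s = (\<integral>z. (1 - exp (- s * z)) \<partial>\<mu>) / s"
    using has_bochner_integral_integral_eq[OF int] by (simp add: laplace_def set_lebesgue_integral_def)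
qed

text \<open>For \<open>z > 1 / n\<close> the integrand is at least \<open>1 / 2\<close>, so a bound on all these integrals would bound the
  mass of \<open>{1 / n<..}\<close> uniformly in \<open>n\<close>.\<close>

lemma levy_integral_unbounded:
  assumes inf: "emeasure \<mu> {0<..} = \<infinity>"
  shows "\<exists>n::nat. n > 0 \<and> B < (\<integral>z. (1 - exp (- real n * z)) \<partial>\<mu>)"
proof (rule ccontr)
  assume "\<not> ?thesis"
  then have le: "(\<integral>z. (1 - exp (- real n * z)) \<partial>\<mu>) \<le> B" if "n > 0" for n :: nat
    using that by (meson not_less)
  have bound: "emeasure \<mu> {1 / Suc n<..} \<le> ennreal (2 * B)" for n
  proof -
    let ?s = "real (Suc n)"
    have "tail \<mu> (1 / ?s) / 2 = (\<integral>z. (indicator {1 / ?s<..} z / 2 :: real) \<partial>\<mu>)"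
      using greaterThan_sets[of "1 / ?s"] emeasure_tail_finite[of "1 / ?s"]
      by (simp add: tail_def)
    also have "\<dots> \<le> (\<integral>z. (1 - exp (- ?s * z)) \<partial>\<mu>)"
    proof (rule integral_mono)
      show "integrable \<mu> (\<lambda>z. indicator {1 / ?s<..} z / 2 :: real)"
        using greaterThan_sets[of "1 / ?s"] emeasure_tail_finite[of "1 / ?s"]
        by (intro integrable_divide_zero integrable_real_indicator) auto
      show "integrable \<mu> (\<lambda>z. 1 - exp (- ?s * z))" by (rule integrable_levy) simp
      fix z assume z: "z \<in> space \<mu>"
      show "indicator {1 / ?s<..} z / 2 \<le> 1 - exp (- ?s * z)"
      proof (cases "z > 1 / ?s")
        case True
        then have "?s * z \<ge> 1" by (simp add: field_simps)
        then have "exp (?s * z) \<ge> 2" using exp_ge_add_one_self[of "?s * z"] by linarith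
        then have "1 / exp (?s * z) \<le> 1 / 2" by (intro frac_le) auto
        moreover have "exp (- ?s * z) = 1 / exp (?s * z)"
          unfolding mult_minus_left exp_minus by (rule inverse_eq_divide)
        ultimately have "exp (- ?s * z) \<le> 1 / 2" by simp
        then show ?thesis using True by simp
      next
        case False
        have "?s * z \<ge> 0" using z by (simp add: space_mu)
        then have "exp (- ?s * z) \<le> 1" unfolding mult_minus_left exp_le_one_iff by linarith
        then show ?thesis using False by simp
      qed
    qed
    also have "\<dots> \<le> B" using le[of "Suc n"] by simp
    finally have "tail \<mu> (1 / ?s) \<le> 2 * B" by simp
    then show ?thesis using ennreal_tail[of "1 / ?s"] ennreal_leI by fastforce
  qed
  have "(SUP n. emeasure \<mu> {1 / real (Suc n)<..}) = emeasure \<mu> (\<Union>n. {1 / real (Suc n)<..})"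
  proof (rule SUP_emeasure_incseq)
    show "range (\<lambda>n. {1 / real (Suc n)<..}) \<subseteq> sets \<mu>" using greaterThan_sets by auto
    show "incseq (\<lambda>n. {1 / real (Suc n)<..})"
      unfolding incseq_def by (auto simp: less_le_trans intro: le_less_trans[rotated] divide_left_mono)
  qed
  moreover have "(\<Union>n. {1 / real (Suc n)<..}) = {0<..}"
  proof (intro equalityI subsetI)
    fix z :: real assume "z \<in> {0<..}"
    then obtain n where "inverse (real (Suc n)) < z" using reals_Archimedean by auto
    then show "z \<in> (\<Union>n. {1 / real (Suc n)<..})" by (auto simp: inverse_eq_divide)
  qed (auto dest: pos_if_inverse_less)
  ultimately have "emeasure \<mu> {0<..} \<le> ennreal (2 * B)"
    using bound by (metis SUP_least)
  then show False using inf by (simp add: top_unique)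
qed

end

section \<open>The inverse of a killed subordinator\<close>

text \<open>\<open>\<Phi>\<close> is the Laplace exponent of \<open>D\<close>, without the killing rate \<open>a\<close>.\<close>

locale killed_subordinator =
  fixes M :: "'w measure" and D :: "real \<Rightarrow> 'w \<Rightarrow> real" and S :: "'w \<Rightarrow> real" and a :: real
    and \<Phi> :: "real \<Rightarrow> real"
  assumes sub: "subordinator M D"
    and laplace_D: "\<And>t s. t \<ge> 0 \<Longrightarrow> s > 0 \<Longrightarrow> (\<integral>\<omega>. exp (- s * D t \<omega>) \<partial>M) = exp (- t * \<Phi> s)"
    and killing: "independent_killing_time M D a S"
    and a: "a > 0"
    and exponent_nonneg: "\<And>s. s > 0 \<Longrightarrow> \<Phi> s \<ge> 0"
    and exponent_unbounded: "\<And>B. \<exists>s>0. B < \<Phi> s"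
begin

sublocale prob_space M using sub by (simp add: subordinator_def)

definition E :: "real \<Rightarrow> 'w \<Rightarrow> real" where "E = general_inverse (killed D S)"

lemma D_measurable: "t \<ge> 0 \<Longrightarrow> D t \<in> borel_measurable M"
  and D_zero: "\<omega> \<in> space M \<Longrightarrow> D 0 \<omega> = 0"
  and D_mono: "\<omega> \<in> space M \<Longrightarrow> 0 \<le> s \<Longrightarrow> s \<le> t \<Longrightarrow> D s \<omega> \<le> D t \<omega>"
  and D_right_continuous: "\<omega> \<in> space M \<Longrightarrow> 0 \<le> t \<Longrightarrow> continuous (at_right t) (\<lambda>s. D s \<omega>)"
  and D_increments: "0 \<le> s \<Longrightarrow> 0 \<le> t \<Longrightarrow> distr M borel (\<lambda>\<omega>. D (s + t) \<omega> - D s \<omega>) = distr M borel (D t)"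
  using sub by (auto simp: subordinator_def mono_on_def)

lemma D_nonneg: "\<omega> \<in> space M \<Longrightarrow> 0 \<le> t \<Longrightarrow> 0 \<le> D t \<omega>"
  using D_mono[of \<omega> 0 t] D_zero by simp

lemma S_distributed: "distributed M lborel S (exponential_density a)"
  using killing by (simp add: independent_killing_time_def)

lemma S_measurable[measurable]: "S \<in> borel_measurable M"
  using distributed_measurable[OF S_distributed] by simp

definition passed :: "real \<Rightarrow> 'w \<Rightarrow> real set" where
  "passed t \<omega> = {s. 0 < s \<and> (S \<omega> \<le> s \<or> t < D s \<omega>)}"

lemma E_eq: "E t \<omega> = Inf (passed t \<omega>)"
proof -
  have "{s. 0 < s \<and> ereal t < killed D S s \<omega>} = passed t \<omega>" by (auto simp: killed_def passed_def)
  then show ?thesis by (simp add: E_def general_inverse_def)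
qed

lemma passed_nonempty: "passed t \<omega> \<noteq> {}"
proof -
  have "max 1 (S \<omega>) \<in> passed t \<omega>" by (simp add: passed_def)
  then show ?thesis by blast
qed

lemma passed_bdd: "bdd_below (passed t \<omega>)"
  by (intro bdd_belowI[of _ 0]) (auto simp: passed_def)

lemma E_nonneg: "0 \<le> E t \<omega>"
  unfolding E_eq by (intro cInf_greatest passed_nonempty) (auto simp: passed_def)

lemma E_less_iff: "E t \<omega> < c \<longleftrightarrow> (\<exists>s<c. 0 < s \<and> (S \<omega> \<le> s \<or> t < D s \<omega>))"
  unfolding E_eq cInf_less_iff[OF passed_nonempty passed_bdd] by (auto simp: passed_def)

lemma passed_upward: "\<omega> \<in> space M \<Longrightarrow> 0 < s \<Longrightarrow> s \<le> s' \<Longrightarrow> S \<omega> \<le> s \<or> t < D s \<omega> \<Longrightarrow> S \<omega> \<le> s' \<or> t < D s' \<omega>"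
  using D_mono[of \<omega> s s'] by auto

lemma E_less_iff_rational:
  assumes \<omega>: "\<omega> \<in> space M"
  shows "E t \<omega> < c \<longleftrightarrow> (\<exists>q\<in>\<rat> \<inter> {0<..<c}. S \<omega> \<le> q \<or> t < D q \<omega>)"
  unfolding E_less_iff
proof
  assume "\<exists>s<c. 0 < s \<and> (S \<omega> \<le> s \<or> t < D s \<omega>)"
  then obtain s where s: "s < c" "0 < s" "S \<omega> \<le> s \<or> t < D s \<omega>" by blast
  obtain q where "q \<in> \<rat>" "s < q" "q < c" using Rats_dense_in_real[OF s(1)] by blast
  then show "\<exists>q\<in>\<rat> \<inter> {0<..<c}. S \<omega> \<le> q \<or> t < D q \<omega>"
    using passed_upward[OF \<omega> s(2) _ s(3), of q] s by (intro bexI[of _ q]) auto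
qed auto

text \<open>Joint measurability is what makes it possible to evaluate \<open>E\<close> at an independent random time.\<close>

lemma E_jointly_measurable: "(\<lambda>(\<omega>, t). E t \<omega>) \<in> borel_measurable (M \<Otimes>\<^sub>M borel)"
proof (rule borel_measurableI_less)
  fix c :: real
  have "{p \<in> space (M \<Otimes>\<^sub>M borel). (case p of (\<omega>, t) \<Rightarrow> E t \<omega>) < c}
      = (\<Union>q\<in>\<rat> \<inter> {0<..<c}. {p \<in> space (M \<Otimes>\<^sub>M borel). S (fst p) \<le> q \<or> snd p < D q (fst p)})"
    by (auto simp: space_pair_measure E_less_iff_rational Bex_def)
  also have "\<dots> \<in> sets (M \<Otimes>\<^sub>M borel)"
  proof (rule sets.countable_UN'')
    show "countable (\<rat> \<inter> {0<..<c})" using countable_rat by blast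
    fix q assume "q \<in> \<rat> \<inter> {0<..<c}"
    then have [measurable]: "D q \<in> borel_measurable M" by (intro D_measurable) auto
    show "{p \<in> space (M \<Otimes>\<^sub>M borel). S (fst p) \<le> q \<or> snd p < D q (fst p)} \<in> sets (M \<Otimes>\<^sub>M borel)"
      by measurable
  qed
  finally show "{p \<in> space (M \<Otimes>\<^sub>M borel). (case p of (\<omega>, t) \<Rightarrow> E t \<omega>) < c} \<in> sets (M \<Otimes>\<^sub>M borel)" .
qed

lemma E_measurable[measurable]: "E t \<in> borel_measurable M"
  using measurable_compose[OF measurable_Pair[OF measurable_ident measurable_const[of t]] E_jointly_measurable]
  by (simp add: id_def)

lemma E_measurable_nonneg: "E t \<in> M \<rightarrow>\<^sub>M restrict_space borel {0..}"
  by (intro measurable_restrict_space2) (auto simp: E_nonneg)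

lemma indep_S_D: assumes t: "t \<ge> 0" shows "indep_var borel S borel (D t)"
proof -
  let ?P = "\<lambda>\<omega>. \<lambda>t\<in>{0..}. D t \<omega>"
  let ?VD = "vimage_algebra (space M) ?P (PiM {0..} (\<lambda>_. borel))"
  let ?VS = "vimage_algebra (space M) S borel"
  have ind: "indep_set (sets ?VD) (sets ?VS)" using killing by (simp add: independent_killing_time_def)
  have 1: "{S -` A \<inter> space M |A. A \<in> sets borel} \<subseteq> sets ?VS"
    by (auto intro!: in_vimage_algebra)
  have 2: "{D t -` A \<inter> space M |A. A \<in> sets borel} \<subseteq> sets ?VD"
  proof clarify
    fix A :: "real set" assume A: "A \<in> sets borel"
    have "(\<lambda>x. x t) -` A \<inter> space (PiM {0..} (\<lambda>_. borel)) \<in> sets (PiM {0..} (\<lambda>_. borel :: real measure))"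
      by (rule measurable_sets[OF measurable_component_singleton[where M = "\<lambda>_. borel" and I = "{0..}" and i = t] A]) (use t in auto)
    from in_vimage_algebra[OF this, of ?P "space M"]
    have "?P -` ((\<lambda>x. x t) -` A \<inter> space (PiM {0..} (\<lambda>_. borel))) \<inter> space M \<in> sets ?VD" .
    also have "?P -` ((\<lambda>x. x t) -` A \<inter> space (PiM {0..} (\<lambda>_. borel))) \<inter> space M = D t -` A \<inter> space M"
      using t by (auto simp: space_PiM)
    finally show "D t -` A \<inter> space M \<in> sets ?VD" .
  qed
  have [measurable]: "D t \<in> borel_measurable M" using t by (rule D_measurable)
  have "indep_set {S -` A \<inter> space M |A. A \<in> sets borel} {D t -` A \<inter> space M |A. A \<in> sets borel}"
  proof (rule indep_setI)
    show "{S -` A \<inter> space M |A. A \<in> sets borel} \<subseteq> events" "{D t -` A \<inter> space M |A. A \<in> sets borel} \<subseteq> events"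
      by auto
    fix B C assume "B \<in> {S -` A \<inter> space M |A. A \<in> sets borel}" "C \<in> {D t -` A \<inter> space M |A. A \<in> sets borel}"
    then show "prob (B \<inter> C) = prob B * prob C"
      using indep_setD[OF ind, of C B] 1 2 by (auto simp: Int_commute mult.commute)
  qed
  moreover have "sigma_sets (space M) {X -` A \<inter> space M |A. A \<in> sets borel} = {X -` A \<inter> space M |A. A \<in> sets borel}"
    for X :: "'w \<Rightarrow> real"
    using sigma_sets_vimage_commute[of X "space M" UNIV "sets borel"] sets.sigma_sets_eq[of "borel :: real measure"]
    by simp
  ultimately show ?thesis unfolding indep_var_eq by simp
qed

text \<open>By independence of \<open>S\<close> and \<open>D r\<close>: killing at rate \<open>a\<close> adds \<open>a\<close> to the Laplace exponent.\<close>

lemma survival: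
  assumes s: "s > 0" and r: "r \<ge> 0"
  shows "(\<integral>\<omega>. indicator {r<..} (S \<omega>) * exp (- s * D r \<omega>) \<partial>M) = exp (- r * (a + \<Phi> s))"
proof -
  have [measurable]: "D r \<in> borel_measurable M" using r by (rule D_measurable)
  have "indep_var borel ((indicator {r<..} :: real \<Rightarrow> real) \<circ> S) borel ((\<lambda>x. exp (- s * x)) \<circ> D r)"
    by (rule indep_var_compose[OF indep_S_D[OF r]]) measurable
  then have ind: "indep_var borel (\<lambda>\<omega>. indicator {r<..} (S \<omega>) :: real) borel (\<lambda>\<omega>. exp (- s * D r \<omega>))"
    by (simp add: o_def)
  have i1: "integrable M (\<lambda>\<omega>. indicator {r<..} (S \<omega>) :: real)"
    by (rule integrable_const_bound[of _ 1]) auto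
  have i2: "integrable M (\<lambda>\<omega>. exp (- s * D r \<omega>))"
    by (rule integrable_const_bound[of _ 1]) (use s r D_nonneg in auto)
  have "(\<integral>\<omega>. indicator {r<..} (S \<omega>) \<partial>M) = (\<integral>\<omega>. indicator {\<omega>\<in>space M. r < S \<omega>} \<omega> \<partial>M)"
    by (intro Bochner_Integration.integral_cong) (auto simp: indicator_def)
  also have "\<dots> = prob {\<omega>\<in>space M. r < S \<omega>}" by simp
  also have "\<dots> = exp (- r * a)"
    using exponential_distributedD_gt[OF S_distributed r a] .
  finally have 1: "(\<integral>\<omega>. indicator {r<..} (S \<omega>) \<partial>M) = exp (- r * a)" .
  show ?thesis
    using indep_var_lebesgue_integral[OF ind i1 i2] laplace_D[OF r s]
    by (simp add: 1 exp_add[symmetric] algebra_simps)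
qed

lemma E_gt_imp: "\<omega> \<in> space M \<Longrightarrow> 0 \<le> r \<Longrightarrow> r < E t \<omega> \<Longrightarrow> r < S \<omega> \<and> D r \<omega> \<le> t"
proof -
  assume \<omega>: "\<omega> \<in> space M" and r: "0 \<le> r" and "r < E t \<omega>"
  then obtain r' where r': "r < r'" "r' < E t \<omega>" using dense by blast
  then have "\<not> E t \<omega> < E t \<omega>" "0 < r'" using r by auto
  then have "\<not> (S \<omega> \<le> r' \<or> t < D r' \<omega>)" using r' by (subst (asm) E_less_iff) auto
  moreover have "\<not> S \<omega> \<le> r"
  proof
    assume "S \<omega> \<le> r"
    then have "E t \<omega> < r'"
      using r r'(1) dense[OF r'(1)] unfolding E_less_iff by (auto intro: less_imp_le order_trans)
    then show False using r'(2) by simp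
  qed
  ultimately show ?thesis using D_mono[OF \<omega> r, of r'] r'(1) by auto
qed

lemma E_ge: "\<omega> \<in> space M \<Longrightarrow> 0 \<le> r \<Longrightarrow> r \<le> S \<omega> \<Longrightarrow> D r \<omega> \<le> t \<Longrightarrow> r \<le> E t \<omega>"
proof (rule ccontr)
  assume \<omega>: "\<omega> \<in> space M" and r: "0 \<le> r" "r \<le> S \<omega>" "D r \<omega> \<le> t" and "\<not> r \<le> E t \<omega>"
  then obtain s where "s < r" "0 < s" "S \<omega> \<le> s \<or> t < D s \<omega>" by (auto simp: not_le E_less_iff)
  then show False using D_mono[OF \<omega>, of s r] r by auto
qed

lemma E_gt: 
  assumes \<omega>: "\<omega> \<in> space M" and r: "0 \<le> r" "r < S \<omega>" "D r \<omega> < t"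
  shows "r < E t \<omega>"
proof -
  have "((\<lambda>s. D s \<omega>) \<longlongrightarrow> D r \<omega>) (at_right r)"
    using D_right_continuous[OF \<omega> r(1)] by (simp add: continuous_within)
  then have "\<forall>\<^sub>F s in at_right r. D s \<omega> < t" using r(3) by (rule order_tendstoD)
  moreover have "\<forall>\<^sub>F s in at_right r. s < S \<omega>" by (rule order_tendstoD(2)[OF tendsto_ident_at r(2)])
  moreover have "\<forall>\<^sub>F s in at_right r. r < s" by (rule eventually_at_right_less)
  ultimately have "\<forall>\<^sub>F s in at_right r. r < E t \<omega>"
  proof eventually_elim
    case (elim s)
    then have "s \<le> E t \<omega>" using r by (intro E_ge[OF \<omega>]) auto
    then show ?case using elim by simp
  qed
  then show ?thesis by (simp add: trivial_limit_at_right_real eventually_const)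
qed

text \<open>The key fact: an independent exponential time with rate \<open>s\<close> turns \<open>E\<close> into an exponential random
  variable with rate \<open>a + \<Phi> s\<close>. Indeed, up to the null event that \<open>D r\<close> hits the exponential time
  \<open>t\<close> exactly, \<open>r < E t\<close> means \<open>r < S\<close> and \<open>D r < t\<close>; integrating out \<open>t\<close> leaves the expectation
  computed in \<open>survival\<close>.\<close>

lemma exponential_sampling:
  assumes s: "s > 0"
  shows "distributed (M \<Otimes>\<^sub>M density lborel (exponential_density s)) lborel (\<lambda>(\<omega>, t). E t \<omega>)
           (exponential_density (a + \<Phi> s))"
proof -
  let ?N = "density lborel (exponential_density s)"
  let ?P = "M \<Otimes>\<^sub>M ?N"
  interpret N: prob_space ?N by (rule prob_space_exponential_density[OF s])
  interpret P: pair_prob_space M ?N ..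
  have [measurable_cong]: "sets ?N = sets borel" by simp
  have Em[measurable]: "(\<lambda>(\<omega>, t). E t \<omega>) \<in> borel_measurable ?P"
    using E_jointly_measurable by (simp cong: measurable_cong_sets sets_pair_measure_cong)
  have pos: "a + \<Phi> s > 0" using a exponent_nonneg[OF s] by simp
  have N_gt: "measure ?N {x<..} = exp (- x * s)" if "x \<ge> 0" for x
  proof -
    have "distributed ?N lborel (\<lambda>x. x) (exponential_density s)"
      using s by (auto simp: distributed_def distr_id2 exponential_density_nonneg)
    from N.exponential_distributedD_gt[OF this that s] show ?thesis
      by (simp add: greaterThan_def)
  qed
  have dich: "A = {d<..} \<or> A = {d..}" if "A \<subseteq> {d..}" "{d<..} \<subseteq> A" for A :: "real set" and d
  proof (cases "d \<in> A")
    case True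
    have "x \<in> A" if "x \<ge> d" for x using \<open>{d<..} \<subseteq> A\<close> True that by (cases "x = d") auto
    then have "{d..} \<subseteq> A" by auto
    then show ?thesis using \<open>A \<subseteq> {d..}\<close> by (metis subset_antisym)
  next
    case False
    have "d < x" if "x \<in> A" for x using \<open>A \<subseteq> {d..}\<close> False that by (cases "x = d") auto
    then have "A \<subseteq> {d<..}" by auto
    then show ?thesis using \<open>{d<..} \<subseteq> A\<close> by (metis subset_antisym)
  qed
  have gt: "measure ?P {p \<in> space ?P. r < (case p of (\<omega>, t) \<Rightarrow> E t \<omega>)} = exp (- r * (a + \<Phi> s))"
    if r: "r \<ge> 0" for r
  proof -
    have [measurable]: "D r \<in> borel_measurable M" using r by (rule D_measurable)
    let ?A = "{p \<in> space ?P. r < (case p of (\<omega>, t) \<Rightarrow> E t \<omega>)}"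
    have A: "?A \<in> sets ?P" by measurable
    have slice: "measure ?N (Pair \<omega> -` ?A) = indicator {r<..} (S \<omega>) * exp (- s * D r \<omega>)"
      if \<omega>: "\<omega> \<in> space M" for \<omega>
    proof (cases "r < S \<omega>")
      case True
      have "Pair \<omega> -` ?A \<subseteq> {D r \<omega>..}" using E_gt_imp[OF \<omega> r] by (auto simp: space_pair_measure)
      moreover have "{D r \<omega><..} \<subseteq> Pair \<omega> -` ?A"
        using E_gt[OF \<omega> r True] \<omega> by (auto simp: space_pair_measure)
      ultimately have "Pair \<omega> -` ?A = {D r \<omega><..} \<or> Pair \<omega> -` ?A = {D r \<omega>..}" by (rule dich)
      moreover have "measure ?N {D r \<omega>..} = measure ?N {D r \<omega><..}"
      proof (rule measure_eq_AE)
        show "AE x in ?N. x \<in> {D r \<omega>..} \<longleftrightarrow> x \<in> {D r \<omega><..}"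
          by (subst AE_density) (use AE_lborel_singleton[of "D r \<omega>"] in \<open>auto elim: eventually_mono\<close>)
      qed auto
      ultimately have "measure ?N (Pair \<omega> -` ?A) = measure ?N {D r \<omega><..}" by (elim disjE) (simp_all only:)
      also have "\<dots> = exp (- s * D r \<omega>)"
        unfolding N_gt[OF D_nonneg[OF \<omega> r]] by (simp add: mult.commute)
      finally show ?thesis using True by simp
    next
      case False
      have empty: "Pair \<omega> -` ?A = {}" using E_gt_imp[OF \<omega> r] False by (auto simp: space_pair_measure)
      show ?thesis unfolding empty using False by simp
    qed
    have "ennreal (measure ?P ?A) = emeasure ?P ?A" by (rule P.emeasure_eq_measure[symmetric])
    also have "\<dots> = (\<integral>\<^sup>+\<omega>. emeasure ?N (Pair \<omega> -` ?A) \<partial>M)" by (rule N.emeasure_pair_measure_alt[OF A])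
    also have "\<dots> = (\<integral>\<^sup>+\<omega>. ennreal (indicator {r<..} (S \<omega>) * exp (- s * D r \<omega>)) \<partial>M)"
      by (intro nn_integral_cong) (simp only: N.emeasure_eq_measure slice)
    also have "\<dots> = ennreal (\<integral>\<omega>. indicator {r<..} (S \<omega>) * exp (- s * D r \<omega>) \<partial>M)"
    proof (intro nn_integral_eq_integral integrable_const_bound[of _ 1] AE_I2)
      fix \<omega> assume "\<omega> \<in> space M"
      then have "exp (- s * D r \<omega>) \<le> 1" using s D_nonneg[of \<omega> r] r by simp
      then show "norm (indicator {r<..} (S \<omega>) * exp (- s * D r \<omega>)) \<le> 1" by (simp add: indicator_def)
    qed (simp, measurable)
    finally show ?thesis unfolding survival[OF s r] by simp
  qed
  show ?thesis
  proof (subst P.exponential_distributed_iff[OF pos], intro conjI allI impI Em)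
    fix r :: real assume r: "0 \<le> r"
    have gm: "{p \<in> space ?P. r < (case p of (\<omega>, t) \<Rightarrow> E t \<omega>)} \<in> sets ?P" by measurable
    have "P.prob {p \<in> space ?P. (case p of (\<omega>, t) \<Rightarrow> E t \<omega>) \<le> r}
        = P.prob (space ?P - {p \<in> space ?P. r < (case p of (\<omega>, t) \<Rightarrow> E t \<omega>)})"
      by (intro arg_cong[where f = P.prob]) auto
    also have "\<dots> = 1 - exp (- r * (a + \<Phi> s))"
      unfolding P.prob_compl[OF gm] gt[OF r] ..
    finally show "P.prob {p \<in> space ?P. (case p of (\<omega>, t) \<Rightarrow> E t \<omega>) \<le> r} = 1 - exp (- r * (a + \<Phi> s))" .
  qed
qed

text \<open>The same fact read as a formula for Laplace transforms in time: the left-hand side averages \<open>f (E t)\<close>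
  over an exponential time \<open>t\<close>.\<close>

lemma laplace_E:
  fixes f :: "real \<Rightarrow> real"
  assumes s: "s > 0" and m[measurable]: "f \<in> borel_measurable borel" and b: "\<And>x. \<bar>f x\<bar> \<le> C"
  shows "s * laplace (\<lambda>t. \<integral>\<omega>. f (E t \<omega>) \<partial>M) s = (a + \<Phi> s) * laplace f (a + \<Phi> s)"
proof -
  let ?N = "density lborel (exponential_density s)"
  let ?P = "M \<Otimes>\<^sub>M ?N"
  let ?\<phi> = "a + \<Phi> s"
  interpret N: prob_space ?N by (rule prob_space_exponential_density[OF s])
  interpret P: pair_prob_space M ?N ..
  have [measurable_cong]: "sets ?N = sets borel" by simp
  have pos: "?\<phi> > 0" using a exponent_nonneg[OF s] by simp
  have Em[measurable]: "(\<lambda>(\<omega>, t). E t \<omega>) \<in> borel_measurable ?P"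
    using distributed_measurable[OF exponential_sampling[OF s]] by simp
  have density: "(\<integral>t. h t * exponential_density r t \<partial>lborel) = r * laplace h r" if r: "r > 0" for h r
  proof -
    have "(\<integral>t. h t * exponential_density r t \<partial>lborel) = (\<integral>t. r * (indicator {0..} t *\<^sub>R (exp (- (r * t)) * h t)) \<partial>lborel)"
      by (intro Bochner_Integration.integral_cong) (auto simp: exponential_density_def indicator_def ac_simps)
    then show ?thesis by (simp add: laplace_def set_lebesgue_integral_def)
  qed
  have int: "integrable ?P (\<lambda>(\<omega>, t). f (E t \<omega>))"
    by (rule P.integrable_const_bound[of _ C]) (use b in auto)
  let ?h = "\<lambda>t. \<integral>\<omega>. f (E t \<omega>) \<partial>M"
  have hm[measurable]: "?h \<in> borel_measurable borel"
    using borel_measurable_integrable[OF P.integrable_snd[OF int]] by simp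
  have "s * laplace ?h s = (\<integral>t. ?h t * exponential_density s t \<partial>lborel)" by (simp add: density[OF s])
  also have "\<dots> = (\<integral>t. ?h t \<partial>?N)"
    by (subst integral_density) (auto simp: exponential_density_nonneg[OF s] mult.commute)
  also have "\<dots> = (\<integral>p. (case p of (\<omega>, t) \<Rightarrow> f (E t \<omega>)) \<partial>?P)" using P.integral_snd[OF int] by simp
  also have "\<dots> = (\<integral>p. f ((\<lambda>(\<omega>, t). E t \<omega>) p) \<partial>?P)" by (simp add: split_beta')
  also have "\<dots> = (\<integral>x. exponential_density ?\<phi> x * f x \<partial>lborel)"
    by (rule distributed_integral[OF exponential_sampling[OF s], symmetric])
       (auto simp: exponential_density_nonneg[OF pos])
  also have "\<dots> = ?\<phi> * laplace f ?\<phi>" by (simp add: density[OF pos, symmetric] mult.commute)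
  finally show "s * laplace ?h s = ?\<phi> * laplace f ?\<phi>" .
qed

text \<open>The probability is at most \<open>exp (- h * \<Phi> s)\<close> for every \<open>s\<close>, and \<open>\<Phi>\<close> is unbounded. The
  exponent of a Levy measure is unbounded if its mass is infinite.\<close>

lemma prob_D_eq_0:
  assumes h: "h > 0"
  shows "prob {\<omega>\<in>space M. D h \<omega> = 0} = 0"
proof -
  have [measurable]: "D h \<in> borel_measurable M" using h by (intro D_measurable) simp
  have bound: "prob {\<omega>\<in>space M. D h \<omega> = 0} \<le> exp (- h * \<Phi> s)" if s: "s > 0" for s
  proof -
    have "prob {\<omega>\<in>space M. D h \<omega> = 0} = (\<integral>\<omega>. indicator {\<omega>\<in>space M. D h \<omega> = 0} \<omega> \<partial>M)" by simp
    also have "\<dots> \<le> (\<integral>\<omega>. exp (- s * D h \<omega>) \<partial>M)"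
    proof (rule integral_mono)
      show "integrable M (\<lambda>\<omega>. exp (- s * D h \<omega>))"
        by (rule integrable_const_bound[of _ 1]) (use s h D_nonneg in auto)
      show "integrable M (indicator {\<omega>\<in>space M. D h \<omega> = 0} :: 'w \<Rightarrow> real)"
        by (rule integrable_const_bound[of _ 1]) auto
    qed (auto simp: indicator_def emeasure_eq_measure)
    also have "\<dots> = exp (- h * \<Phi> s)" by (rule laplace_D) (use h s in auto)
    finally show ?thesis .
  qed
  show ?thesis
  proof (rule ccontr)
    assume "prob {\<omega>\<in>space M. D h \<omega> = 0} \<noteq> 0"
    then have p: "prob {\<omega>\<in>space M. D h \<omega> = 0} > 0" (is "?p > 0") by (simp add: zero_less_measure_iff)
    obtain s where s: "s > 0" "- ln ?p / h < \<Phi> s" using exponent_unbounded by blast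
    then have "- h * \<Phi> s < ln ?p" using h by (simp add: field_simps)
    then have "exp (- h * \<Phi> s) < ?p" using p by (metis exp_less_cancel_iff exp_ln)
    then show False using bound[OF s(1)] by simp
  qed
qed

text \<open>Strictness between rational times is strictness everywhere, by monotonicity. It rules out flat pieces
  of \<open>D\<close>, that is, jumps of \<open>E\<close>.\<close>

lemma AE_D_strict_mono: "AE \<omega> in M. \<forall>r\<ge>0. \<forall>r'>r. D r \<omega> < D r' \<omega>"
proof -
  have step: "AE \<omega> in M. D q \<omega> < D q' \<omega>" if q: "0 \<le> q" "q < q'" for q q'
  proof -
    have [measurable]: "D q \<in> borel_measurable M" "D q' \<in> borel_measurable M" "D (q' - q) \<in> borel_measurable M"
      using q by (auto intro: D_measurable)
    have "measure (distr M borel (\<lambda>\<omega>. D (q + (q' - q)) \<omega> - D q \<omega>)) {0} = measure (distr M borel (D (q' - q))) {0}"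
      using D_increments[of q "q' - q"] q by simp
    then have "prob {\<omega>\<in>space M. D q' \<omega> - D q \<omega> = 0} = prob {\<omega>\<in>space M. D (q' - q) \<omega> = 0}"
      by (simp add: measure_distr vimage_def Int_def conj_commute)
    also have "\<dots> = 0" using q by (intro prob_D_eq_0) simp
    finally have "AE \<omega> in M. \<omega> \<notin> {\<omega>\<in>space M. D q' \<omega> - D q \<omega> = 0}"
      by (intro AE_not_in) (auto simp: null_sets_def emeasure_eq_measure)
    from this AE_space show ?thesis
    proof eventually_elim
      case (elim \<omega>)
      then show ?case using D_mono[of \<omega> q q'] q by auto
    qed
  qed
  have "AE \<omega> in M. \<forall>q\<in>\<rat>. \<forall>q'\<in>\<rat>. 0 \<le> q \<longrightarrow> q < q' \<longrightarrow> D q \<omega> < D q' \<omega>"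
    by (simp only: AE_ball_countable[OF countable_rat]) (auto intro!: step)
  with AE_space show ?thesis
  proof eventually_elim
    case (elim \<omega>)
    show ?case
    proof (intro allI impI)
      fix r r' :: real assume r: "0 \<le> r" "r < r'"
      obtain q where q: "q \<in> \<rat>" "r < q" "q < r'" using Rats_dense_in_real[OF r(2)] by blast
      obtain q' where q': "q' \<in> \<rat>" "q < q'" "q' < r'" using Rats_dense_in_real[OF q(3)] by blast
      have "D r \<omega> \<le> D q \<omega>" "D q \<omega> < D q' \<omega>" "D q' \<omega> \<le> D r' \<omega>"
        using elim q q' r by (auto intro: D_mono)
      then show "D r \<omega> < D r' \<omega>" by simp
    qed
  qed
qed

lemma AE_E_zero: "AE \<omega> in M. E 0 \<omega> = 0"
  using AE_D_strict_mono AE_space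
proof eventually_elim
  case (elim \<omega>)
  have "E 0 \<omega> < c" if c: "c > 0" for c
  proof -
    have "D 0 \<omega> < D (c / 2) \<omega>" using elim(1) c by simp
    then show ?thesis unfolding E_less_iff using c D_zero[OF elim(2)] by (intro exI[of _ "c / 2"]) auto
  qed
  then have "\<not> E 0 \<omega> > 0" by blast
  then show ?case using E_nonneg[of 0 \<omega>] by simp
qed

lemma AE_E_continuous: "AE \<omega> in M. \<forall>t. ((\<lambda>s. E s \<omega>) \<longlongrightarrow> E t \<omega>) (at t)"
  using AE_D_strict_mono AE_space
proof eventually_elim
  case (elim \<omega>)
  show ?case
  proof (intro allI order_tendstoI)
    fix t c assume c: "c < E t \<omega>"
    show "\<forall>\<^sub>F s in at t. c < E s \<omega>"
    proof (cases "c < 0")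
      case True
      then show ?thesis using E_nonneg less_le_trans by (intro always_eventually) blast
    next
      case False
      obtain c' where c': "c < c'" "c' < E t \<omega>" using dense[OF c] by blast
      obtain c'' where c'': "c' < c''" "c'' < E t \<omega>" using dense[OF c'(2)] by blast
      have *: "c'' < S \<omega>" "D c'' \<omega> \<le> t" using E_gt_imp[OF elim(2), of c'' t] c' c'' False by auto
      have "D c' \<omega> < D c'' \<omega>" using elim(1) c' c'' False by auto
      then have "D c' \<omega> < t" using * by simp
      then have "\<forall>\<^sub>F s in at t. D c' \<omega> < s" by (rule order_tendstoD(1)[OF tendsto_ident_at])
      then show ?thesis
      proof eventually_elim
        case (elim s)
        have "c' \<le> E s \<omega>" using E_ge[OF \<open>\<omega> \<in> space M\<close>, of c' s] elim * c' c'' False by auto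
        then show ?case using c' by simp
      qed
    qed
  next
    fix t c assume "E t \<omega> < c"
    then obtain r where r: "r < c" "0 < r" "S \<omega> \<le> r \<or> t < D r \<omega>" by (auto simp: E_less_iff)
    have ev: "\<forall>\<^sub>F s in at t. S \<omega> \<le> r \<or> s < D r \<omega>"
    proof (cases "S \<omega> \<le> r")
      case False
      then have "\<forall>\<^sub>F s in at t. s < D r \<omega>" using r by (intro order_tendstoD(2)[OF tendsto_ident_at]) auto
      then show ?thesis by eventually_elim simp
    qed simp
    then show "\<forall>\<^sub>F s in at t. E s \<omega> < c"
      by eventually_elim (use r in \<open>auto simp: E_less_iff\<close>)
  qed
qed

end

section \<open>The memory term of the equation\<close>

lemma has_vector_derivative_iff_quotient:
  fixes f :: "real \<Rightarrow> 'b::real_normed_vector"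
  shows "(f has_vector_derivative d) (at t) \<longleftrightarrow> ((\<lambda>h. (1 / h) *\<^sub>R (f (t + h) - f t)) \<longlongrightarrow> d) (at 0)"
proof -
  have "norm (f (t + h) - f t - h *\<^sub>R d) / norm h = norm ((1 / h) *\<^sub>R (f (t + h) - f t) - d)" if "h \<noteq> 0" for h
  proof -
    have "(1 / h) *\<^sub>R (f (t + h) - f t) - d = (1 / h) *\<^sub>R (f (t + h) - f t - h *\<^sub>R d)"
      using that by (simp add: scaleR_diff_right)
    then show ?thesis by (simp add: divide_inverse mult.commute)
  qed
  then have "((\<lambda>h. norm (f (t + h) - f t - h *\<^sub>R d) / norm h) \<longlongrightarrow> 0) (at 0)
      \<longleftrightarrow> ((\<lambda>h. norm ((1 / h) *\<^sub>R (f (t + h) - f t) - d)) \<longlongrightarrow> 0) (at 0)"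
    by (intro filterlim_cong refl) (auto simp: eventually_at_filter)
  then show ?thesis
    unfolding has_vector_derivative_def has_derivative_at
    by (simp add: bounded_linear_scaleR_left tendsto_norm_zero_iff LIM_zero_iff)
qed

context levy_measure
begin

text \<open>A solution is a function \<open>v\<close> with \<open>v 0 = f\<close> for which this one has derivative \<open>L v - a v + a f\<close>.\<close>

definition memory :: "real \<Rightarrow> (real \<Rightarrow> 'b::banach) \<Rightarrow> real \<Rightarrow> 'b" where
  "memory k v t = k *\<^sub>R (v t - v 0) + frac_convolution (tail \<mu>) v t"

definition exponent :: "real \<Rightarrow> real \<Rightarrow> real" where
  "exponent k s = k * s + (\<integral>z. (1 - exp (- s * z)) \<partial>\<mu>)"

context
  fixes v :: "real \<Rightarrow> 'b::banach" and l :: "'b \<Rightarrow> real" and B :: real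
  assumes v: "continuous_on {0..} v" and B: "\<forall>t\<ge>0. norm (v t) \<le> B" and l: "bounded_linear l"
begin

lemma functional_continuous: "continuous_on {0..} (\<lambda>t. l (v t))"
  using bounded_linear.continuous_on[OF l v] .

lemma functional_bounded: "\<exists>C. \<forall>t\<ge>0. \<bar>l (v t)\<bar> \<le> C"
proof -
  obtain K where K: "K > 0" "\<And>y. norm (l y) \<le> norm y * K" using bounded_linear.pos_bounded[OF l] by blast
  have "\<bar>l (v t)\<bar> \<le> B * K" if "t \<ge> 0" for t
    by (rule order_trans[OF K(2)[of "v t", unfolded real_norm_def] mult_right_mono[OF B[rule_format, OF that]]]) (use K(1) in simp)
  then show ?thesis by blast
qed

lemma functional_measurable: "set_borel_measurable lborel {0..} (\<lambda>t. l (v t))"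
  using functional_continuous borel_measurable_continuous_on_indicator[of "{0..}" "\<lambda>t. l (v t)"]
  by (simp add: set_borel_measurable_def)

lemma functional_laplace_exists: "s > 0 \<Longrightarrow> laplace_exists (\<lambda>t. l (v t)) s"
proof -
  assume s: "s > 0"
  obtain C where C: "\<And>t. t \<ge> 0 \<Longrightarrow> \<bar>l (v t)\<bar> \<le> C" using functional_bounded by blast
  show ?thesis
  proof (rule laplace_exists_exp_bounded[OF s functional_measurable])
    fix t :: real assume t: "t \<ge> 0"
    have "C \<ge> 0" using C[of 0] by simp
    then show "\<bar>l (v t)\<bar> \<le> C * (1 + t)" using C[OF t] t by (simp add: distrib_left add_increasing2)
  qed
qed

text \<open>Under a functional the memory integral becomes a real convolution, which is integrable because the
  tail is.\<close>

lemma functional_memory: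
  assumes t: "t \<ge> 0"
  shows "l (memory k v t) = k * (l (v t) - l (v 0)) + causal_convolution (tail \<mu>) (\<lambda>r. l (v r) - l (v 0)) t"
proof -
  interpret l: bounded_linear l by fact
  have w: "set_integrable lborel {0..t} (\<lambda>r. tail \<mu> (t - r))"
  proof -
    have "(\<lambda>r. indicator {0..t} (t - r) * tail \<mu> (t - r)) = (\<lambda>r. indicator {0..t} r * tail \<mu> (t - r))"
      by (auto simp: indicator_def)
    then show ?thesis
      using lborel_integrable_real_affine[of "\<lambda>r. indicator {0..t} r * tail \<mu> r" "-1" t] tail_integrable[OF t]
      by (simp add: set_integrable_def)
  qed
  then have wa: "(\<lambda>r. tail \<mu> (t - r)) absolutely_integrable_on {0..t}"
    unfolding set_integrable_def by (subst integrable_completion) (auto dest: borel_measurable_integrable)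
  have vi: "continuous_on {0..t} (\<lambda>r. v r - v 0)"
    by (intro continuous_intros continuous_on_subset[OF v]) auto
  have int: "(\<lambda>r. tail \<mu> (t - r) *\<^sub>R (v r - v 0)) integrable_on {0..t}"
    by (rule integrable_on_scaleR_continuous[OF wa _ vi]) (rule tail_nonneg)
  obtain C where C: "\<And>t. t \<ge> 0 \<Longrightarrow> \<bar>l (v t)\<bar> \<le> C" using functional_bounded by blast
  have si: "set_integrable lborel {0..t} (\<lambda>r. tail \<mu> (t - r) * (l (v r) - l (v 0)))"
  proof (rule set_integrable_bound)
    show "set_integrable lborel {0..t} (\<lambda>r. 2 * C * tail \<mu> (t - r))"
      using w by (rule set_integrable_mult_right[rotated])
    have 1: "(\<lambda>r. indicator {0..t} r *\<^sub>R tail \<mu> (t - r)) \<in> borel_measurable lborel"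
      using w unfolding set_integrable_def by (rule borel_measurable_integrable)
    have 2: "(\<lambda>r. indicator {0..t} r *\<^sub>R (l (v r) - l (v 0))) \<in> borel_measurable lborel"
      using borel_measurable_continuous_on_indicator[of "{0..t}" "\<lambda>r. l (v r) - l (v 0)"]
        bounded_linear.continuous_on[OF l vi] by (simp add: l.diff)
    have "(\<lambda>r. (indicator {0..t} r *\<^sub>R tail \<mu> (t - r)) * (indicator {0..t} r *\<^sub>R (l (v r) - l (v 0)))) \<in> borel_measurable lborel"
      using 1 2 by (rule borel_measurable_times)
    then show "set_borel_measurable lborel {0..t} (\<lambda>r. tail \<mu> (t - r) * (l (v r) - l (v 0)))"
      unfolding set_borel_measurable_def by (rule measurable_cong[THEN iffD1, rotated]) (auto simp: indicator_def)
    show "AE r in lborel. r \<in> {0..t} \<longrightarrow>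
        norm (tail \<mu> (t - r) * (l (v r) - l (v 0))) \<le> norm (2 * C * tail \<mu> (t - r))"
    proof (intro AE_I2 impI)
      fix r assume "r \<in> {0..t}"
      then have "\<bar>l (v r) - l (v 0)\<bar> \<le> \<bar>2 * C\<bar>" using C[of r] C[of 0] by auto
      from mult_left_mono[OF this tail_nonneg[of "t - r"]]
      show "norm (tail \<mu> (t - r) * (l (v r) - l (v 0))) \<le> norm (2 * C * tail \<mu> (t - r))"
        using tail_nonneg[of "t - r"] by (simp add: abs_mult mult.commute)
    qed
  qed
  have "l (frac_convolution (tail \<mu>) v t) = integral {0..t} (\<lambda>r. tail \<mu> (t - r) * (l (v r) - l (v 0)))"
    unfolding frac_convolution_def using integral_linear[OF int l] by (simp add: o_def l.scaleR l.diff)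
  also have "\<dots> = causal_convolution (tail \<mu>) (\<lambda>r. l (v r) - l (v 0)) t"
    unfolding causal_convolution_def using set_borel_integral_eq_integral(2)[OF si] by simp
  finally show ?thesis by (simp add: memory_def l.add l.diff l.scaleR)
qed

lemma continuous_on_functional_memory: "continuous_on {0..} (\<lambda>t. l (memory k v t))"
proof -
  obtain C where C: "\<And>t. t \<ge> 0 \<Longrightarrow> \<bar>l (v t)\<bar> \<le> C" using functional_bounded by blast
  have c: "continuous_on {0..} (causal_convolution (tail \<mu>) (\<lambda>r. l (v r) - l (v 0)))"
  proof (rule continuous_on_causal_convolution[OF tail_integrable, where C = "2 * C"])
    show "\<bar>l (v t) - l (v 0)\<bar> \<le> 2 * C" if "t \<ge> 0" for t using C[OF that] C[of 0] by auto
  qed (auto intro!: continuous_intros functional_continuous)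
  show ?thesis
    by (subst continuous_on_cong[OF refl functional_memory])
       (auto intro!: continuous_intros functional_continuous c)
qed

text \<open>The Laplace transform of the tail is \<open>\<integral>z. (1 - exp (- s * z)) \<partial>\<mu>\<close> divided by \<open>s\<close>; together with
  the local term \<open>k\<close> this makes the exponent appear.\<close>

lemma laplace_functional_memory:
  assumes s: "s > 0"
  shows "laplace_exists (\<lambda>t. l (memory k v t)) s"
    and "s * laplace (\<lambda>t. l (memory k v t)) s = exponent k s * (laplace (\<lambda>t. l (v t)) s - l (v 0) / s)"
proof -
  have c: "laplace_exists (\<lambda>_. c) s" for c
    by (rule laplace_exists_exp_bounded[OF s, of _ "\<bar>c\<bar>"]) (auto simp: set_borel_measurable_def distrib_left)
  have y: "laplace_exists (\<lambda>r. l (v r) - l (v 0)) s"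
    "laplace (\<lambda>r. l (v r) - l (v 0)) s = laplace (\<lambda>t. l (v t)) s - l (v 0) / s"
    using functional_laplace_exists[OF s] c
    by (auto intro: laplace_exists_diff simp: laplace_diff laplace_const[OF s])
  note conv = laplace_exists_causal_convolution[OF laplace_exists_tail[OF s] y(1)]
    laplace_causal_convolution[OF laplace_exists_tail[OF s] y(1)]
  show "laplace_exists (\<lambda>t. l (memory k v t)) s"
    using laplace_exists_add[OF laplace_exists_cmult[OF y(1)] conv(1)]
    by (subst laplace_exists_cong[OF functional_memory]) auto
  have "laplace (\<lambda>t. l (memory k v t)) s
      = k * laplace (\<lambda>r. l (v r) - l (v 0)) s + laplace (tail \<mu>) s * laplace (\<lambda>r. l (v r) - l (v 0)) s"
    by (subst laplace_cong[OF functional_memory])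
       (auto simp: laplace_add[OF laplace_exists_cmult[OF y(1)] conv(1)] laplace_cmult conv(2))
  also have "s * \<dots> = exponent k s * laplace (\<lambda>r. l (v r) - l (v 0)) s"
    unfolding laplace_tail[OF s] exponent_def using s by (simp add: distrib_left distrib_right ac_simps)
  finally show "s * laplace (\<lambda>t. l (memory k v t)) s = exponent k s * (laplace (\<lambda>t. l (v t)) s - l (v 0) / s)"
    unfolding y(2) .
qed

lemma functional_set_integral: "t \<ge> 0 \<Longrightarrow> (LBINT r:{0..t}. l (v r)) = integral {0..t} (\<lambda>r. l (v r))"
  by (rule set_borel_integral_eq_integral(2), rule borel_integrable_atLeastAtMost')
     (rule continuous_on_subset[OF functional_continuous], auto)

lemma functional_integral:
  assumes t: "t \<ge> 0"
  shows "l (integral {0..t} v) = (LBINT r:{0..t}. l (v r))"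
proof -
  have "v integrable_on {0..t}"
    by (rule integrable_continuous_interval, rule continuous_on_subset[OF v]) auto
  from integral_linear[OF this l] show ?thesis by (simp add: functional_set_integral[OF t] o_def)
qed

lemma continuous_on_functional_integral: "continuous_on {0..} (\<lambda>t. LBINT r:{0..t}. l (v r))"
  unfolding continuous_on_eq_continuous_within
proof
  fix t :: real assume t: "t \<in> {0..}"
  have "continuous_on {0..t + 1} (\<lambda>t. integral {0..t} (\<lambda>r. l (v r)))"
    by (rule indefinite_integral_continuous_1, rule integrable_continuous_interval,
        rule continuous_on_subset[OF functional_continuous]) auto
  then have "continuous_on {0..t + 1} (\<lambda>t. LBINT r:{0..t}. l (v r))"
    by (subst continuous_on_cong[OF refl functional_set_integral]) auto
  then have "continuous (at t within {0..t + 1}) (\<lambda>t. LBINT r:{0..t}. l (v r))"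
    using t by (auto simp: continuous_on_eq_continuous_within)
  moreover have "at t within {0..t + 1} = at t within {0..}"
    using t by (intro at_within_nhd[of _ "{..<t+1}"]) auto
  ultimately show "continuous (at t within {0..}) (\<lambda>t. LBINT r:{0..t}. l (v r))" by simp
qed

lemma laplace_functional_integral:
  assumes s: "s > 0"
  shows "laplace_exists (\<lambda>t. LBINT r:{0..t}. l (v r)) s"
    and "s * laplace (\<lambda>t. LBINT r:{0..t}. l (v r)) s = laplace (\<lambda>t. l (v t)) s"
proof -
  have eq: "(\<lambda>t. LBINT r:{0..t}. l (v r)) = causal_convolution (\<lambda>_. 1) (\<lambda>t. l (v t))"
    by (simp add: causal_convolution_def fun_eq_iff)
  have c: "laplace_exists (\<lambda>_. 1) s"
    by (rule laplace_exists_exp_bounded[OF s, of _ 1]) (auto simp: set_borel_measurable_def)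
  show "laplace_exists (\<lambda>t. LBINT r:{0..t}. l (v r)) s"
    unfolding eq by (rule laplace_exists_causal_convolution[OF c functional_laplace_exists[OF s]])
  show "s * laplace (\<lambda>t. LBINT r:{0..t}. l (v r)) s = laplace (\<lambda>t. l (v t)) s"
    unfolding eq laplace_causal_convolution[OF c functional_laplace_exists[OF s]] laplace_const[OF s]
    using s by simp
qed

end

lemma memory_0: "memory k v 0 = 0"
  by (simp add: memory_def frac_convolution_def)

text \<open>The derivative is only given at \<open>t > 0\<close>. Under a functional, \<open>memory\<close> is continuous up to \<open>0\<close>, where
  it vanishes, so the fundamental theorem of calculus applies on the closed interval.\<close>

lemma memory_eq_integral_if_derivative:
  fixes v q :: "real \<Rightarrow> 'b::banach"
  assumes v: "continuous_on {0..} v" and B: "\<forall>t\<ge>0. norm (v t) \<le> B"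
    and q: "continuous_on {0..} q"
    and deriv: "\<And>t. t > 0 \<Longrightarrow> (memory k v has_vector_derivative q t) (at t)"
    and t: "t \<ge> 0"
  shows "memory k v t = integral {0..t} q"
proof (rule eq_if_functionals_eq)
  fix l :: "'b \<Rightarrow> real" assume l: "bounded_linear l"
  interpret l: bounded_linear l by fact
  have "((\<lambda>t. l (q t)) has_integral l (memory k v t) - l (memory k v 0)) {0..t}"
  proof (rule fundamental_theorem_of_calculus_interior[OF t])
    show "continuous_on {0..t} (\<lambda>t. l (memory k v t))"
      by (rule continuous_on_subset[OF continuous_on_functional_memory[OF v B l]]) auto
    show "((\<lambda>t. l (memory k v t)) has_vector_derivative l (q r)) (at r)" if "r \<in> {0<..<t}" for r
      using l.has_vector_derivative[OF deriv[of r]] that by simp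
  qed
  then have "l (memory k v t) = integral {0..t} (\<lambda>t. l (q t))"
    by (simp add: memory_0 l.zero integral_unique)
  also have "\<dots> = l (integral {0..t} q)"
  proof -
    have "q integrable_on {0..t}"
      by (rule integrable_continuous_interval, rule continuous_on_subset[OF q]) auto
    from integral_linear[OF this l] show ?thesis by (simp add: o_def)
  qed
  finally show "l (memory k v t) = l (integral {0..t} q)" .
qed

lemma derivative_if_memory_eq_integral:
  fixes v q :: "real \<Rightarrow> 'b::banach"
  assumes q: "continuous_on {0..} q"
    and eq: "\<And>t. t \<ge> 0 \<Longrightarrow> memory k v t = integral {0..t} q" and t: "t > 0"
  shows "(memory k v has_vector_derivative q t) (at t)"
proof -
  have "((\<lambda>t. integral {0..t} q) has_vector_derivative q t) (at t within {0..t + 1})"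
    by (rule integral_has_vector_derivative[OF continuous_on_subset[OF q]]) (use t in auto)
  then have "((\<lambda>t. integral {0..t} q) has_vector_derivative q t) (at t)"
    using t by (simp add: at_within_Icc_at)
  then show ?thesis
  proof (rule has_vector_derivative_transform_within_open)
    show "t \<in> {0<..}" using t by simp
  qed (auto simp: eq)
qed

lemma fractional_solution_iff:
  "fractional_solution T a k (tail \<mu>) f u \<longleftrightarrow>
     u 0 = f \<and> bdd_above ((\<lambda>t. norm (u t)) ` {0..}) \<and> (\<forall>t\<ge>0. u t \<in> generator_domain T) \<and>
     bdd_above ((\<lambda>t. norm (generator T (u t))) ` {0..}) \<and> continuous_on {0..} u \<and>
     continuous_on {0..} (\<lambda>t. generator T (u t)) \<and>
     (\<forall>t>0. (memory k u has_vector_derivative generator T (u t) - a *\<^sub>R u t + a *\<^sub>R f) (at t))"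
proof -
  have eq: "k *\<^sub>R (u (t + \<delta>) - u t) + frac_convolution (tail \<mu>) u (t + \<delta>) - frac_convolution (tail \<mu>) u t
      = memory k u (t + \<delta>) - memory k u t" for t \<delta>
    by (simp add: memory_def scaleR_diff_right)
  show ?thesis
    unfolding fractional_solution_def has_vector_derivative_iff_quotient eq ..
qed

end

section \<open>Bounded semigroups and their resolvents\<close>

locale bounded_semigroup =
  fixes T :: "real \<Rightarrow> 'b::banach \<Rightarrow>\<^sub>L 'b"
  assumes strongly_continuous: "strongly_continuous_semigroup T"
    and uniformly_bounded: "uniformly_bounded_semigroup T"
begin

definition growth :: real where "growth = (SUP t\<in>{0..}. norm (T t))"

lemma T_0: "T 0 x = x"
  and T_add: "s \<ge> 0 \<Longrightarrow> t \<ge> 0 \<Longrightarrow> T (s + t) x = T s (T t x)"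
  and T_lim: "((\<lambda>t. T t x) \<longlongrightarrow> x) (at_right 0)"
  using strongly_continuous by (auto simp: strongly_continuous_semigroup_def)

lemma norm_T_le: "t \<ge> 0 \<Longrightarrow> norm (T t x) \<le> growth * norm x"
proof -
  assume t: "t \<ge> 0"
  have "norm (T t) \<le> growth"
    unfolding growth_def using t uniformly_bounded
    by (intro cSUP_upper) (auto simp: uniformly_bounded_semigroup_def)
  then show ?thesis by (rule order_trans[OF norm_blinfun mult_right_mono]) simp
qed

lemma growth_nonneg: "growth \<ge> 0"
proof -
  have "norm (T 0) \<le> growth"
    unfolding growth_def using uniformly_bounded
    by (intro cSUP_upper) (auto simp: uniformly_bounded_semigroup_def)
  then show ?thesis by (rule order_trans[OF norm_ge_zero])
qed

lemma T_diff_le: "s \<ge> 0 \<Longrightarrow> t \<ge> 0 \<Longrightarrow> norm (T s x - T t x) \<le> growth * norm (T \<bar>s - t\<bar> x - x)"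
proof (induction s t rule: linorder_wlog)
  case (le s t)
  have "T t x = T s (T (t - s) x)" using T_add[of s "t - s" x] le by simp
  then have "T s x - T t x = T s (x - T (t - s) x)" by (simp add: blinfun.diff_right)
  also have "norm \<dots> \<le> growth * norm (x - T (t - s) x)" by (rule norm_T_le) fact
  finally show ?case using le by (simp add: norm_minus_commute)
next
  case (sym s t)
  then show ?case by (simp add: norm_minus_commute abs_minus_commute)
qed

lemma T_continuous: "continuous_on {0..} (\<lambda>t. T t x)"
  unfolding continuous_on_iff
proof (intro ballI allI impI)
  fix t e :: real assume t: "t \<in> {0..}" and e: "e > 0"
  have "\<forall>\<^sub>F h in at_right 0. dist (T h x) x < e / (growth + 1)"
    using e growth_nonneg by (intro tendstoD[OF T_lim]) simp
  then obtain d where d: "d > 0" "\<And>h. 0 < h \<Longrightarrow> h < d \<Longrightarrow> norm (T h x - x) < e / (growth + 1)"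
    by (auto simp: eventually_at_right_field dist_norm)
  have "dist (T s x) (T t x) < e" if s: "s \<in> {0..}" "dist s t < d" for s
  proof (cases "s = t")
    case False
    then have "norm (T \<bar>s - t\<bar> x - x) < e / (growth + 1)" using s d by (auto simp: dist_real_def)
    then have "growth * norm (T \<bar>s - t\<bar> x - x) \<le> growth * (e / (growth + 1))"
      using growth_nonneg by (intro mult_left_mono) auto
    also have "\<dots> < e" using e growth_nonneg by (simp add: field_simps)
    finally show ?thesis using T_diff_le[of s t x] s t by (simp add: dist_norm)
  qed (use e in simp)
  then show "\<exists>d>0. \<forall>s\<in>{0..}. dist s t < d \<longrightarrow> dist (T s x) (T t x) < e" using d(1) by blast
qed

lemma generator_tendsto:
  "x \<in> generator_domain T \<Longrightarrow> ((\<lambda>t. (T t x - x) /\<^sub>R t) \<longlongrightarrow> generator T x) (at_right 0)"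
  unfolding generator_domain_def generator_def
  using tendsto_Lim[OF trivial_limit_at_right_real] by blast

lemma generatorI:
  assumes "((\<lambda>t. (T t x - x) /\<^sub>R t) \<longlongrightarrow> y) (at_right 0)"
  shows "x \<in> generator_domain T" "generator T x = y"
  using assms tendsto_Lim[OF trivial_limit_at_right_real assms]
  by (auto simp: generator_domain_def generator_def)

text \<open>The functional \<open>l\<close> composed with the resolvent of the generator at \<open>p\<close>.\<close>

definition resolvent :: "('b \<Rightarrow> real) \<Rightarrow> real \<Rightarrow> 'b \<Rightarrow> real" where
  "resolvent l p x = laplace (\<lambda>s. l (T s x)) p"

lemma orbit_bounded:
  fixes l :: "'b \<Rightarrow> real"
  assumes l: "bounded_linear l"
  obtains K where "K \<ge> 0" "\<And>s x. s \<ge> 0 \<Longrightarrow> \<bar>l (T s x)\<bar> \<le> K * norm x"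
proof -
  obtain K where K: "K > 0" "\<And>y. norm (l y) \<le> norm y * K" using bounded_linear.pos_bounded[OF l] by blast
  have "\<bar>l (T s x)\<bar> \<le> K * growth * norm x" if "s \<ge> 0" for s x
  proof -
    have "\<bar>l (T s x)\<bar> \<le> K * norm (T s x)" using K(2)[of "T s x"] by (simp add: mult.commute)
    also have "\<dots> \<le> K * (growth * norm x)" using norm_T_le[OF that] K(1) by (intro mult_left_mono) auto
    finally show ?thesis by (simp add: mult.assoc)
  qed
  then show ?thesis using that[of "K * growth"] K(1) growth_nonneg by simp
qed

context
  fixes l :: "'b \<Rightarrow> real" and p :: real
  assumes l: "bounded_linear l" and p: "p > 0"
begin

lemma orbit_continuous: "continuous_on {0..} (\<lambda>s. l (T s x))"
  using bounded_linear.continuous_on[OF l T_continuous] .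

lemma orbit_laplace_exists: "laplace_exists (\<lambda>s. l (T s x)) p"
proof -
  obtain K where K: "K \<ge> 0" "\<And>s x. s \<ge> 0 \<Longrightarrow> \<bar>l (T s x)\<bar> \<le> K * norm x" using orbit_bounded[OF l] by metis
  show ?thesis
  proof (rule laplace_exists_exp_bounded[OF p])
    show "set_borel_measurable lborel {0..} (\<lambda>s. l (T s x))"
      using orbit_continuous borel_measurable_continuous_on_indicator[of "{0..}" "\<lambda>s. l (T s x)"]
      by (simp add: set_borel_measurable_def)
    fix s :: real assume s: "s \<ge> 0"
    have "K * norm x \<ge> 0" using K(1) by simp
    then show "\<bar>l (T s x)\<bar> \<le> K * norm x * (1 + s)" using K(2)[OF s, of x] s
      unfolding distrib_left by (simp add: add_increasing2)
  qed
qed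

lemma bounded_linear_resolvent: "bounded_linear (resolvent l p)"
proof -
  interpret l: bounded_linear l by fact
  obtain K where K: "K \<ge> 0" "\<And>s x. s \<ge> 0 \<Longrightarrow> \<bar>l (T s x)\<bar> \<le> K * norm x" using orbit_bounded[OF l] by metis
  show ?thesis
  proof (rule bounded_linear_intro)
    show "resolvent l p (x + y) = resolvent l p x + resolvent l p y" for x y
      unfolding resolvent_def blinfun.add_right l.add by (intro laplace_add orbit_laplace_exists)
    show "resolvent l p (r *\<^sub>R x) = r *\<^sub>R resolvent l p x" for r x
      unfolding resolvent_def blinfun.scaleR_right l.scaleR by (simp add: laplace_cmult)
    show "norm (resolvent l p x) \<le> norm x * (K / p)" for x
    proof -
      have i: "set_integrable lborel {0..} (\<lambda>s. exp (- (p * s)) * l (T s x))"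
        using orbit_laplace_exists by (simp add: laplace_exists_def)
      have "norm (resolvent l p x) \<le> (LBINT s:{0..}. norm (exp (- (p * s)) * l (T s x)))"
        unfolding resolvent_def laplace_def by (rule set_integral_norm_bound[OF i])
      also have "\<dots> \<le> (LBINT s:{0..}. exp (- (p * s)) * (K * norm x))"
      proof (rule set_integral_mono)
        show "set_integrable lborel {0..} (\<lambda>s. norm (exp (- (p * s)) * l (T s x)))"
          by (rule set_integrable_norm[OF i])
        show "set_integrable lborel {0..} (\<lambda>s. exp (- (p * s)) * (K * norm x))"
          using set_integrable_exp_half_line[OF p] by (rule set_integrable_mult_left[rotated])
        show "norm (exp (- (p * s)) * l (T s x)) \<le> exp (- (p * s)) * (K * norm x)" if "s \<in> {0..}" for s
          using K(2)[of s x] that by (simp add: abs_mult)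
      qed
      also have "\<dots> = norm x * (K / p)"
        using laplace_const[OF p, of "K * norm x"] by (simp add: laplace_def)
      finally show ?thesis .
    qed
  qed
qed

text \<open>The substitution \<open>s \<mapsto> s - h\<close>. Continuity of the orbit makes the right-hand side differentiable in
  \<open>h\<close>; on the left-hand side this would need differentiability of \<open>T h x\<close>.\<close>

lemma resolvent_shift:
  assumes h: "h \<ge> 0"
  shows "resolvent l p (T h x) = exp (p * h) * (resolvent l p x - (LBINT s:{0..h}. exp (- (p * s)) * l (T s x)))"
proof -
  let ?q = "\<lambda>s. exp (- (p * s)) * l (T s x)"
  have i: "set_integrable lborel {0..} ?q" using orbit_laplace_exists by (simp add: laplace_exists_def)
  have "resolvent l p (T h x) = (\<integral>s. indicator {0..} s * (exp (- (p * s)) * l (T s (T h x))) \<partial>lborel)"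
    by (simp add: resolvent_def laplace_def set_lebesgue_integral_def)
  also have "\<dots> = (\<integral>s. indicator {0..} (s - h) * (exp (- (p * (s - h))) * l (T (s - h) (T h x))) \<partial>lborel)"
    using lborel_integral_real_affine[of 1 "\<lambda>s. indicator {0..} s * (exp (- (p * s)) * l (T s (T h x)))" "- h"] by simp
  also have "\<dots> = (\<integral>s. exp (p * h) * (indicator {h<..} s * ?q s) \<partial>lborel)"
  proof (rule integral_cong_AE)
    have "(\<lambda>s. indicator {h<..} s * (indicator {0..} s * ?q s)) \<in> borel_measurable lborel"
      using borel_measurable_integrable[OF i[unfolded set_integrable_def]] by simp
    then have [measurable]: "(\<lambda>s. indicator {h<..} s * ?q s) \<in> borel_measurable lborel"
      by (rule measurable_cong[THEN iffD1, rotated]) (use h in \<open>auto simp: indicator_def\<close>)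
    show "(\<lambda>s. exp (p * h) * (indicator {h<..} s * ?q s)) \<in> borel_measurable lborel" by measurable
    have "continuous_on {0..} (\<lambda>s. exp (- (p * s)) * l (T s (T h x)))"
      by (intro continuous_intros orbit_continuous)
    then have [measurable]: "(\<lambda>s. indicator {0..} s *\<^sub>R (exp (- (p * s)) * l (T s (T h x)))) \<in> borel_measurable borel"
      by (intro borel_measurable_continuous_on_indicator) auto
    have "(\<lambda>s. (\<lambda>s. indicator {0..} s *\<^sub>R (exp (- (p * s)) * l (T s (T h x)))) (s - h)) \<in> borel_measurable lborel"
      by measurable
    then show "(\<lambda>s. indicator {0..} (s - h) * (exp (- (p * (s - h))) * l (T (s - h) (T h x)))) \<in> borel_measurable lborel"
      by simp
    show "AE s in lborel. indicator {0..} (s - h) * (exp (- (p * (s - h))) * l (T (s - h) (T h x)))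
        = exp (p * h) * (indicator {h<..} s * ?q s)"
      using AE_lborel_singleton[of h]
    proof eventually_elim
      case (elim s)
      show ?case
      proof (cases "s > h")
        case True
        have "T s x = T (s - h) (T h x)" using T_add[of "s - h" h x] True h by simp
        moreover have "exp (- (p * (s - h))) = exp (p * h) * exp (- (p * s))"
          by (simp add: exp_add[symmetric] algebra_simps)
        ultimately show ?thesis using True by simp
      qed (use elim in auto)
    qed
  qed
  also have "\<dots> = exp (p * h) * (LBINT s:{h<..}. ?q s)" by (simp add: set_lebesgue_integral_def)
  also have "(LBINT s:{h<..}. ?q s) = resolvent l p x - (LBINT s:{0..h}. ?q s)"
  proof -
    have "{0..} = {0..h} \<union> {h<..}" using h by auto
    moreover have "(LBINT s:{0..h} \<union> {h<..}. ?q s) = (LBINT s:{0..h}. ?q s) + (LBINT s:{h<..}. ?q s)"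
      by (rule set_integral_Un) (use h in \<open>auto intro: set_integrable_subset[OF i]\<close>)
    ultimately show ?thesis by (simp add: resolvent_def laplace_def)
  qed
  finally show ?thesis .
qed

text \<open>Compare the right derivatives at \<open>h = 0\<close> of both sides of \<open>resolvent_shift\<close>.\<close>

lemma resolvent_generator:
  assumes x: "x \<in> generator_domain T"
  shows "resolvent l p (generator T x) = p * resolvent l p x - l x"
proof -
  let ?q = "\<lambda>s. exp (- (p * s)) * l (T s x)"
  interpret R: bounded_linear "resolvent l p" by (rule bounded_linear_resolvent)
  have qc: "continuous_on {0..1} ?q"
    by (intro continuous_intros continuous_on_subset[OF orbit_continuous]) auto
  have LB: "(LBINT s:{0..h}. ?q s) = integral {0..h} ?q" if "h \<in> {0..1}" for h
    by (rule set_borel_integral_eq_integral(2), rule borel_integrable_atLeastAtMost')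
       (rule continuous_on_subset[OF qc], use that in auto)
  define g where "g h = exp (p * h) * (resolvent l p x - integral {0..h} ?q)" for h
  have "((\<lambda>h. integral {0..h} ?q) has_real_derivative ?q 0) (at 0 within {0..1})"
    using integral_has_real_derivative[OF qc, of 0] by simp
  then have "(g has_real_derivative p * resolvent l p x - l x) (at 0 within {0..1})"
    unfolding g_def by (auto intro!: derivative_eq_intros simp: T_0)
  then have "((\<lambda>h. (g h - g 0) / (h - 0)) \<longlongrightarrow> p * resolvent l p x - l x) (at 0 within {0..1})"
    by (simp add: has_field_derivative_iff)
  moreover have "at (0::real) within {0..1} = at_right 0"
    by (rule at_within_Icc_at_right) simp
  ultimately have 1: "((\<lambda>h. (g h - g 0) / h) \<longlongrightarrow> p * resolvent l p x - l x) (at_right 0)" by simp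
  have "((\<lambda>h. resolvent l p ((T h x - x) /\<^sub>R h)) \<longlongrightarrow> resolvent l p (generator T x)) (at_right 0)"
    by (rule R.tendsto[OF generator_tendsto[OF x]])
  moreover have "\<forall>\<^sub>F h in at_right 0. resolvent l p ((T h x - x) /\<^sub>R h) = (g h - g 0) / h"
  proof -
    have "\<forall>\<^sub>F h in at_right (0::real). 0 < h \<and> h < 1"
      by (auto simp: eventually_at_right_field intro: exI[of _ 1])
    then show ?thesis
    proof eventually_elim
      case (elim h)
      then have "g h = resolvent l p (T h x)" "g 0 = resolvent l p x"
        using resolvent_shift[of h x] LB[of h] by (auto simp: g_def)
      then show ?case by (simp add: R.diff R.scaleR divide_inverse mult.commute)
    qed
  qed
  ultimately have "((\<lambda>h. (g h - g 0) / h) \<longlongrightarrow> resolvent l p (generator T x)) (at_right 0)"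
    by (rule Lim_transform_eventually)
  then show ?thesis using 1 tendsto_unique[OF trivial_limit_at_right_real] by blast
qed

end

end

section \<open>The semigroup at the inverse time\<close>

locale time_change = bounded_semigroup T + levy_measure \<mu> +
    killed_subordinator M D S a "levy_measure.exponent \<mu> k"
  for T :: "real \<Rightarrow> 'b::banach \<Rightarrow>\<^sub>L 'b" and \<mu> :: "real measure" and M :: "'w measure"
    and D :: "real \<Rightarrow> 'w \<Rightarrow> real" and S :: "'w \<Rightarrow> real" and a k :: real
begin

definition Q :: "real \<Rightarrow> 'b \<Rightarrow> 'b" where "Q t x = expected_semigroup T M (E t) x"

lemma orbit_measurable:
  "bounded_linear l \<Longrightarrow> (\<lambda>r. l (T r x)) \<in> borel_measurable (restrict_space borel {0..})" for l :: "'b \<Rightarrow> real"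
  by (rule borel_measurable_continuous_on_restrict[OF bounded_linear.continuous_on[OF _ T_continuous]])

lemma integrable_orbit:
  fixes l :: "'b \<Rightarrow> real"
  assumes l: "bounded_linear l"
  shows "integrable M (\<lambda>\<omega>. l (T (E t \<omega>) x))"
proof -
  obtain K where "K \<ge> 0" "\<And>s x. s \<ge> 0 \<Longrightarrow> \<bar>l (T s x)\<bar> \<le> K * norm x"
    using orbit_bounded[OF l] by metis
  note K = this
  have "(\<lambda>\<omega>. l (T (E t \<omega>) x)) \<in> borel_measurable M"
    by (rule measurable_compose[OF E_measurable_nonneg orbit_measurable[OF l]])
  moreover have "AE \<omega> in M. norm (l (T (E t \<omega>) x)) \<le> K * norm x"
    unfolding real_norm_def by (rule AE_I2, rule K(2)[OF E_nonneg])
  ultimately show ?thesis by (intro integrable_const_bound)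
qed

lemma Q_functional:
  fixes l :: "'b \<Rightarrow> real"
  assumes l: "bounded_linear l"
  shows "l (Q t x) = (\<integral>\<omega>. l (T (E t \<omega>) x) \<partial>M)"
proof -
  interpret N: prob_space "distr M (restrict_space borel {0..}) (E t)"
    by (rule prob_space_distr[OF E_measurable_nonneg])
  have "l (Q t x) = (\<integral>r. l (T r x) \<partial>distr M (restrict_space borel {0..}) (E t))"
    unfolding Q_def expected_semigroup_def
    by (rule B_integral_functional[OF N.finite_measure_axioms _ T_continuous norm_T_le l]) auto
  also have "\<dots> = (\<integral>\<omega>. l (T (E t \<omega>) x) \<partial>M)"
    by (rule integral_distr[OF E_measurable_nonneg orbit_measurable[OF l]])
  finally show ?thesis .
qed

text \<open>The triangle inequality for the integral, read off from a functional that attains the norm of the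
  left-hand side.\<close>

lemma norm_Q_diff_le:
  "norm (Q t x - Q s y) \<le> (\<integral>\<omega>. norm (T (E t \<omega>) x - T (E s \<omega>) y) \<partial>M)"
  and integrable_norm_diff: "integrable M (\<lambda>\<omega>. norm (T (E t \<omega>) x - T (E s \<omega>) y))"
proof -
  have Tc: "continuous_on UNIV (\<lambda>r. T (max 0 r) z)" for z
    by (rule continuous_on_compose2[OF T_continuous]) (auto intro!: continuous_intros)
  have "continuous_on UNIV (\<lambda>p. norm (T (max 0 (fst p)) x - T (max 0 (snd p)) y))"
    by (intro continuous_intros continuous_on_compose2[OF Tc]) auto
  then have "(\<lambda>p. norm (T (max 0 (fst p)) x - T (max 0 (snd p)) y)) \<in> borel_measurable (borel \<Otimes>\<^sub>M borel)"
    unfolding borel_prod by (rule borel_measurable_continuous_onI)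
  then have "(\<lambda>\<omega>. (\<lambda>p. norm (T (max 0 (fst p)) x - T (max 0 (snd p)) y)) (E t \<omega>, E s \<omega>)) \<in> borel_measurable M"
    by (rule measurable_compose[OF measurable_Pair[OF E_measurable E_measurable]])
  then have m: "(\<lambda>\<omega>. norm (T (E t \<omega>) x - T (E s \<omega>) y)) \<in> borel_measurable M"
    by (simp only: fst_conv snd_conv max_absorb2[OF E_nonneg])
  show i: "integrable M (\<lambda>\<omega>. norm (T (E t \<omega>) x - T (E s \<omega>) y))"
  proof (rule integrable_const_bound[OF _ m, of "growth * norm x + growth * norm y"], intro AE_I2)
    fix \<omega>
    show "norm (norm (T (E t \<omega>) x - T (E s \<omega>) y)) \<le> growth * norm x + growth * norm y"
      using norm_triangle_ineq4[of "T (E t \<omega>) x" "T (E s \<omega>) y"]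
        norm_T_le[OF E_nonneg[of t \<omega>], of x] norm_T_le[OF E_nonneg[of s \<omega>], of y] by simp
  qed
  obtain l where l: "bounded_linear l" "l (Q t x - Q s y) = norm (Q t x - Q s y)" "\<And>z. \<bar>l z\<bar> \<le> norm z"
    using norming_functional[of "Q t x - Q s y"] by metis
  interpret l: bounded_linear l by fact
  have "norm (Q t x - Q s y) = (\<integral>\<omega>. l (T (E t \<omega>) x) - l (T (E s \<omega>) y) \<partial>M)"
    unfolding l(2)[symmetric] l.diff Q_functional[OF l(1)]
    by (rule Bochner_Integration.integral_diff[symmetric]) (intro integrable_orbit l(1))+
  also have "\<dots> \<le> (\<integral>\<omega>. norm (T (E t \<omega>) x - T (E s \<omega>) y) \<partial>M)"
  proof (rule integral_mono)
    show "integrable M (\<lambda>\<omega>. l (T (E t \<omega>) x) - l (T (E s \<omega>) y))"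
      by (intro Bochner_Integration.integrable_diff integrable_orbit l(1))
    show "l (T (E t \<omega>) x) - l (T (E s \<omega>) y) \<le> norm (T (E t \<omega>) x - T (E s \<omega>) y)" for \<omega>
      using l(3)[of "T (E t \<omega>) x - T (E s \<omega>) y"] by (simp add: l.diff)
  qed (rule i)
  finally show "norm (Q t x - Q s y) \<le> (\<integral>\<omega>. norm (T (E t \<omega>) x - T (E s \<omega>) y) \<partial>M)" .
qed

lemma bounded_linear_Q: "bounded_linear (Q t)"
  and norm_Q_le: "norm (Q t x) \<le> growth * norm x"
proof -
  have add: "Q t (x + y) = Q t x + Q t y" for x y
  proof (rule eq_if_functionals_eq)
    fix l :: "'b \<Rightarrow> real" assume l: "bounded_linear l"
    interpret l: bounded_linear l by fact
    show "l (Q t (x + y)) = l (Q t x + Q t y)"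
      unfolding l.add Q_functional[OF l] blinfun.add_right
      by (rule Bochner_Integration.integral_add) (intro integrable_orbit l)+
  qed
  have scale: "Q t (r *\<^sub>R x) = r *\<^sub>R Q t x" for r x
  proof (rule eq_if_functionals_eq)
    fix l :: "'b \<Rightarrow> real" assume l: "bounded_linear l"
    interpret l: bounded_linear l by fact
    show "l (Q t (r *\<^sub>R x)) = l (r *\<^sub>R Q t x)"
      unfolding l.scaleR Q_functional[OF l] blinfun.scaleR_right by simp
  qed
  have Q0: "Q t 0 = 0" using scale[of 0 0] by simp
  have bound: "norm (Q t x) \<le> growth * norm x" for x
  proof -
    have "norm (Q t x) \<le> (\<integral>\<omega>. norm (T (E t \<omega>) x) \<partial>M)"
      using norm_Q_diff_le[of t x t 0] by (simp add: Q0)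
    also have "\<dots> \<le> (\<integral>\<omega>. growth * norm x \<partial>M)"
      using integrable_norm_diff[of t x t 0] norm_T_le[OF E_nonneg] by (intro integral_mono) simp_all
    finally show ?thesis by (simp add: prob_space)
  qed
  show "norm (Q t x) \<le> growth * norm x" by (rule bound)
  show "bounded_linear (Q t)"
    by (rule bounded_linear_intro[OF add scale, of growth]) (subst mult.commute, rule bound)
qed

lemma Q_0: "Q 0 x = x"
proof (rule eq_if_functionals_eq)
  fix l :: "'b \<Rightarrow> real" assume l: "bounded_linear l"
  have "(\<integral>\<omega>. l (T (E 0 \<omega>) x) \<partial>M) = (\<integral>\<omega>. l x \<partial>M)"
    using AE_E_zero borel_measurable_integrable[OF integrable_orbit[OF l]]
    by (intro integral_cong_AE) (auto elim!: eventually_mono simp: T_0)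
  then show "l (Q 0 x) = l x" by (simp add: Q_functional[OF l] prob_space)
qed

text \<open>Dominated convergence, since almost every path of \<open>E\<close> is continuous.\<close>

lemma Q_continuous: "isCont (\<lambda>t. Q t x) t"
proof (rule continuous_at_sequentiallyI)
  fix u :: "nat \<Rightarrow> real" assume u: "u \<longlonglongrightarrow> t"
  have "(\<lambda>n. \<integral>\<omega>. norm (T (E (u n) \<omega>) x - T (E t \<omega>) x) \<partial>M) \<longlonglongrightarrow> (\<integral>\<omega>. 0 \<partial>M)"
  proof (rule integral_dominated_convergence[where w = "\<lambda>_. 2 * (growth * norm x)"])
    show "(\<lambda>\<omega>. norm (T (E (u n) \<omega>) x - T (E t \<omega>) x)) \<in> borel_measurable M" for n
      by (rule borel_measurable_integrable[OF integrable_norm_diff])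
    show "AE \<omega> in M. norm (norm (T (E (u n) \<omega>) x - T (E t \<omega>) x)) \<le> 2 * (growth * norm x)" for n
    proof (intro AE_I2)
      fix \<omega>
      show "norm (norm (T (E (u n) \<omega>) x - T (E t \<omega>) x)) \<le> 2 * (growth * norm x)"
        using norm_triangle_ineq4[of "T (E (u n) \<omega>) x" "T (E t \<omega>) x"]
          norm_T_le[OF E_nonneg[of "u n" \<omega>], of x] norm_T_le[OF E_nonneg[of t \<omega>], of x] by simp
    qed
    show "AE \<omega> in M. (\<lambda>n. norm (T (E (u n) \<omega>) x - T (E t \<omega>) x)) \<longlonglongrightarrow> 0"
      using AE_E_continuous
    proof eventually_elim
      case (elim \<omega>)
      then have "isCont (\<lambda>s. E s \<omega>) t" by (simp add: isCont_def)
      then have "(\<lambda>n. E (u n) \<omega>) \<longlonglongrightarrow> E t \<omega>" using u by (rule isCont_tendsto_compose)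
      then have "(\<lambda>n. T (E (u n) \<omega>) x) \<longlonglongrightarrow> T (E t \<omega>) x"
        by (rule continuous_on_tendsto_compose[OF T_continuous]) (auto simp: E_nonneg)
      then show ?case
        using tendsto_norm[OF tendsto_diff[OF _ tendsto_const[of "T (E t \<omega>) x"]]] by fastforce
    qed
  qed simp_all
  then have "(\<lambda>n. \<integral>\<omega>. norm (T (E (u n) \<omega>) x - T (E t \<omega>) x) \<partial>M) \<longlonglongrightarrow> 0" by simp
  then have "(\<lambda>n. Q (u n) x - Q t x) \<longlonglongrightarrow> 0"
    by (rule Lim_null_comparison[rotated]) (intro always_eventually allI norm_Q_diff_le)
  then show "(\<lambda>n. Q (u n) x) \<longlonglongrightarrow> Q t x" by (simp add: LIM_zero_iff)
qed

lemma Q_T_commute: "h \<ge> 0 \<Longrightarrow> T h (Q t x) = Q t (T h x)"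
proof (rule eq_if_functionals_eq)
  assume h: "h \<ge> 0"
  fix l :: "'b \<Rightarrow> real" assume l: "bounded_linear l"
  have lT: "bounded_linear (\<lambda>y. l (T h y))"
    using bounded_linear_compose[OF l blinfun.bounded_linear_right] .
  have "T h (T (E t \<omega>) x) = T (E t \<omega>) (T h x)" for \<omega>
    using T_add[OF h E_nonneg[of t \<omega>], of x] T_add[OF E_nonneg[of t \<omega>] h, of x] by (simp add: add.commute)
  then show "l (T h (Q t x)) = l (Q t (T h x))"
    unfolding Q_functional[OF l] Q_functional[OF lT] by simp
qed

lemma
  assumes x: "x \<in> generator_domain T"
  shows Q_domain: "Q t x \<in> generator_domain T" and generator_Q: "generator T (Q t x) = Q t (generator T x)"
proof -
  interpret Q: bounded_linear "Q t" by (rule bounded_linear_Q)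
  have "((\<lambda>h. Q t ((T h x - x) /\<^sub>R h)) \<longlongrightarrow> Q t (generator T x)) (at_right 0)"
    by (rule Q.tendsto[OF generator_tendsto[OF x]])
  moreover have "\<forall>\<^sub>F h in at_right 0. Q t ((T h x - x) /\<^sub>R h) = (T h (Q t x) - Q t x) /\<^sub>R h"
    by (auto simp: eventually_at_right_field Q_T_commute Q.diff Q.scaleR intro: exI[of _ 1])
  ultimately have "((\<lambda>h. (T h (Q t x) - Q t x) /\<^sub>R h) \<longlongrightarrow> Q t (generator T x)) (at_right 0)"
    by (rule Lim_transform_eventually)
  from generatorI[OF this]
  show "Q t x \<in> generator_domain T" "generator T (Q t x) = Q t (generator T x)" .
qed

text \<open>This is \<open>laplace_E\<close> for the function \<open>r \<mapsto> l (T r x)\<close>, extended by its value at \<open>0\<close> to negative \<open>r\<close>.\<close>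

lemma laplace_Q:
  fixes l :: "'b \<Rightarrow> real"
  assumes l: "bounded_linear l" and s: "s > 0"
  shows "s * laplace (\<lambda>t. l (Q t x)) s = (a + exponent k s) * resolvent l (a + exponent k s) x"
proof -
  let ?\<phi> = "a + exponent k s"
  obtain K where K: "K \<ge> 0" "\<And>s x. s \<ge> 0 \<Longrightarrow> \<bar>l (T s x)\<bar> \<le> K * norm x"
    using orbit_bounded[OF l] by metis
  have "continuous_on UNIV (\<lambda>r. T (max 0 r) x)"
    by (rule continuous_on_compose2[OF T_continuous]) (auto intro!: continuous_intros)
  then have m: "(\<lambda>r. l (T (max 0 r) x)) \<in> borel_measurable borel"
    by (intro borel_measurable_continuous_onI bounded_linear.continuous_on[OF l])
  have "s * laplace (\<lambda>t. \<integral>\<omega>. l (T (max 0 (E t \<omega>)) x) \<partial>M) s = ?\<phi> * laplace (\<lambda>r. l (T (max 0 r) x)) ?\<phi>"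
    by (rule laplace_E[OF s m, of "K * norm x"]) (simp add: K(2))
  moreover have "laplace (\<lambda>r. l (T (max 0 r) x)) ?\<phi> = resolvent l ?\<phi> x"
    unfolding resolvent_def by (rule laplace_cong) (simp add: max_absorb2)
  ultimately show ?thesis
    unfolding Q_functional[OF l] by (simp only: max_absorb2[OF E_nonneg])
qed

lemma \<phi>_pos: "s > 0 \<Longrightarrow> a + exponent k s > 0"
  using a exponent_nonneg[of s] by simp

lemma laplace_right_side:
  fixes l :: "'b \<Rightarrow> real" and v w :: "real \<Rightarrow> 'b"
  assumes l: "bounded_linear l" and s: "s > 0"
    and v: "continuous_on {0..} v" "\<forall>t\<ge>0. norm (v t) \<le> B"
    and w: "continuous_on {0..} w" "\<forall>t\<ge>0. norm (w t) \<le> C"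
  shows "laplace (\<lambda>t. l (w t - a *\<^sub>R v t + a *\<^sub>R x)) s
      = laplace (\<lambda>t. l (w t)) s - a * laplace (\<lambda>t. l (v t)) s + a * l x / s"
proof -
  interpret l: bounded_linear l by fact
  have c: "laplace_exists (\<lambda>_. a * l x) s"
    by (rule functional_laplace_exists[OF _ _ bounded_linear_mult_right[of "a * l x"] s, of "\<lambda>_. 1" 1, simplified])
  note ev = functional_laplace_exists[OF v l s] and ew = functional_laplace_exists[OF w l s]
  have "laplace (\<lambda>t. l (w t - a *\<^sub>R v t + a *\<^sub>R x)) s
      = laplace (\<lambda>t. (l (w t) - a * l (v t)) + a * l x) s"
    by (simp add: l.add l.diff l.scaleR)
  also have "\<dots> = laplace (\<lambda>t. l (w t)) s - a * laplace (\<lambda>t. l (v t)) s + a * l x / s"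
    by (simp add: laplace_add[OF laplace_exists_diff[OF ew laplace_exists_cmult[OF ev]] c]
        laplace_diff[OF ew laplace_exists_cmult[OF ev]] laplace_cmult laplace_const[OF s])
  finally show ?thesis .
qed

lemma right_side_regular:
  fixes v w :: "real \<Rightarrow> 'b"
  assumes v: "continuous_on {0..} v" "\<forall>t\<ge>0. norm (v t) \<le> B"
    and w: "continuous_on {0..} w" "\<forall>t\<ge>0. norm (w t) \<le> C"
  shows "continuous_on {0..} (\<lambda>t. w t - a *\<^sub>R v t + a *\<^sub>R x)"
    and "\<forall>t\<ge>0. norm (w t - a *\<^sub>R v t + a *\<^sub>R x) \<le> C + \<bar>a\<bar> * B + \<bar>a\<bar> * norm x"
proof -
  show "continuous_on {0..} (\<lambda>t. w t - a *\<^sub>R v t + a *\<^sub>R x)" by (intro continuous_intros v w)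
  show "\<forall>t\<ge>0. norm (w t - a *\<^sub>R v t + a *\<^sub>R x) \<le> C + \<bar>a\<bar> * B + \<bar>a\<bar> * norm x"
  proof (intro allI impI)
    fix t :: real assume t: "t \<ge> 0"
    have "norm (w t - a *\<^sub>R v t + a *\<^sub>R x) \<le> norm (w t) + norm (a *\<^sub>R v t) + norm (a *\<^sub>R x)"
      by (rule norm_triangle_le, rule add_right_mono, rule norm_triangle_ineq4)
    also have "\<dots> \<le> C + \<bar>a\<bar> * B + \<bar>a\<bar> * norm x"
      using v(2)[rule_format, OF t] w(2)[rule_format, OF t] by (auto intro!: add_mono mult_left_mono)
    finally show "norm (w t - a *\<^sub>R v t + a *\<^sub>R x) \<le> C + \<bar>a\<bar> * B + \<bar>a\<bar> * norm x" .
  qed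
qed

text \<open>Both sides of the integrated equation are continuous under each functional \<open>l\<close>, so it is enough to
  compare Laplace transforms. All of them are expressed by \<open>R\<close>, the resolvent of \<open>f\<close>: the one of
  \<open>Q t (L f)\<close> through \<open>resolvent_generator\<close>. With \<open>\<phi> = a + \<Phi>\<close> the difference is a polynomial identity.\<close>

theorem Q_fractional_solution:
  assumes f: "f \<in> generator_domain T"
  shows "fractional_solution T a k (tail \<mu>) f (\<lambda>t. Q t f)"
proof -
  let ?g = "generator T f"
  let ?q = "\<lambda>t. Q t ?g - a *\<^sub>R Q t f + a *\<^sub>R f"
  have Qc: "continuous_on {0..} (\<lambda>t. Q t x)" for x
    by (intro continuous_at_imp_continuous_on ballI Q_continuous)
  have Qb: "\<forall>t\<ge>0. norm (Q t x) \<le> growth * norm x" for x by (simp add: norm_Q_le)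
  note q = right_side_regular[OF Qc[of f] Qb[of f] Qc[of ?g] Qb[of ?g], where x = f]
  have eq: "memory k (\<lambda>t. Q t f) t = integral {0..t} ?q" if t: "t \<ge> 0" for t
  proof (rule eq_if_functionals_eq)
    fix l :: "'b \<Rightarrow> real" assume l: "bounded_linear l"
    note mem = continuous_on_functional_memory[OF Qc Qb l] laplace_functional_memory[OF Qc Qb l]
    note int = laplace_functional_integral[OF q l]
    let ?h = "\<lambda>t. l (memory k (\<lambda>t. Q t f) t) - (LBINT r:{0..t}. l (?q r))"
    have "?h t = 0"
    proof (rule laplace_eq_0_imp_eq_0[OF _ _ _ t])
      show "continuous_on {0..} ?h"
        by (rule continuous_on_diff[OF mem(1) continuous_on_functional_integral[OF q l]])
      fix s :: real assume s: "s > 0"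
      show "laplace_exists ?h s" by (rule laplace_exists_diff[OF mem(2)[OF s] int(1)[OF s]])
      define \<Phi> where "\<Phi> = exponent k s"
      define U where "U = laplace (\<lambda>t. l (Q t f)) s"
      define R where "R = resolvent l (a + \<Phi>) f"
      have 1: "s * U = (a + \<Phi>) * R" unfolding U_def R_def \<Phi>_def by (rule laplace_Q[OF l s])
      have 2: "s * laplace (\<lambda>t. l (Q t ?g)) s = (a + \<Phi>) * ((a + \<Phi>) * R - l f)"
        using laplace_Q[OF l s, of ?g] resolvent_generator[OF l \<phi>_pos[OF s] f]
        by (simp add: R_def \<Phi>_def)
      have 3: "s * laplace (\<lambda>t. l (memory k (\<lambda>t. Q t f) t)) s = \<Phi> * (U - l f / s)"
        using mem(3)[OF s] by (simp add: U_def \<Phi>_def Q_0)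
      have 4: "s * laplace (\<lambda>t. LBINT r:{0..t}. l (?q r)) s
          = laplace (\<lambda>t. l (Q t ?g)) s - a * U + a * l f / s"
        using int(2)[OF s] laplace_right_side[OF l s Qc[of f] Qb[of f] Qc[of ?g] Qb[of ?g], where x = f]
        by (simp add: U_def)
      have "s * s * laplace ?h s = s * (s * laplace (\<lambda>t. l (memory k (\<lambda>t. Q t f) t)) s)
          - s * (s * laplace (\<lambda>t. LBINT r:{0..t}. l (?q r)) s)"
        unfolding laplace_diff[OF mem(2)[OF s] int(1)[OF s]] by (simp only: right_diff_distrib mult.assoc)
      also have "\<dots> = \<Phi> * (s * U - l f) - ((a + \<Phi>) * ((a + \<Phi>) * R - l f) - a * (s * U) + a * l f)"
      proof -
        have "s * (\<Phi> * (U - l f / s)) = \<Phi> * (s * U - l f)" using s by (simp add: field_simps)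
        moreover have "s * (y - a * U + a * l f / s) = s * y - a * (s * U) + a * l f" for y
          using s by (simp add: field_simps)
        ultimately show ?thesis unfolding 3 4 by (simp only: 2)
      qed
      also have "\<dots> = 0" unfolding 1 by (simp add: algebra_simps)
      finally show "laplace ?h s = 0" using s by simp
    qed
    then show "l (memory k (\<lambda>t. Q t f) t) = l (integral {0..t} ?q)"
      using functional_integral[OF q l t] by simp
  qed
  have gen: "generator T (Q t f) = Q t ?g" for t by (rule generator_Q[OF f])
  have bdd: "bdd_above ((\<lambda>t. norm (Q t x)) ` {0..})" for x
    by (intro bdd_aboveI2[of _ _ "growth * norm x"] norm_Q_le)
  show ?thesis
    unfolding fractional_solution_iff gen
    using derivative_if_memory_eq_integral[OF q(1) eq]
    by (intro conjI allI impI Q_0 bdd Qc Q_domain[OF f]) auto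
qed

text \<open>The functional to apply to the integrated equation at the transform variable \<open>s\<close> is the resolvent at
  \<open>\<phi> = a + \<Phi>\<close>, not \<open>l\<close> itself: it turns the unknown \<open>L (v t)\<close> into \<open>\<phi>\<close> times the
  resolvent of \<open>v t\<close> minus \<open>l (v t)\<close>, the terms with the resolvent of \<open>v\<close> cancel, and the
  Laplace transform of \<open>l (v t)\<close> is determined.\<close>

theorem fractional_solution_unique:
  assumes v: "fractional_solution T a k (tail \<mu>) f v" and f: "f \<in> generator_domain T" and t: "t \<ge> 0"
  shows "v t = Q t f"
proof (rule eq_if_functionals_eq)
  fix l :: "'b \<Rightarrow> real" assume l: "bounded_linear l"
  let ?w = "\<lambda>t. generator T (v t)"
  let ?q = "\<lambda>t. ?w t - a *\<^sub>R v t + a *\<^sub>R f"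
  note sol = v[unfolded fractional_solution_iff]
  have v0: "v 0 = f" and dom: "\<And>t. t \<ge> 0 \<Longrightarrow> v t \<in> generator_domain T"
    and vc: "continuous_on {0..} v" and wc: "continuous_on {0..} ?w"
    and deriv: "\<And>t. t > 0 \<Longrightarrow> (memory k v has_vector_derivative ?q t) (at t)"
    using sol by blast+
  obtain B where B: "\<forall>t\<ge>0. norm (v t) \<le> B" using sol by (auto simp: bdd_above_def)
  obtain C where C: "\<forall>t\<ge>0. norm (?w t) \<le> C" using sol by (auto simp: bdd_above_def)
  note q = right_side_regular[OF vc B wc C, where x = f]
  have eq: "memory k v t = integral {0..t} ?q" if "t \<ge> 0" for t
    by (rule memory_eq_integral_if_derivative[OF vc B q(1) deriv that])
  have Qc: "continuous_on {0..} (\<lambda>t. Q t f)"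
    by (intro continuous_at_imp_continuous_on ballI Q_continuous)
  have Qb: "\<forall>t\<ge>0. norm (Q t f) \<le> growth * norm f" by (simp add: norm_Q_le)
  let ?h = "\<lambda>t. l (v t) - l (Q t f)"
  have "?h t = 0"
  proof (rule laplace_eq_0_imp_eq_0[OF _ _ _ t])
    show "continuous_on {0..} ?h"
      by (intro continuous_on_diff functional_continuous[OF vc B l] functional_continuous[OF Qc Qb l])
    fix s :: real assume s: "s > 0"
    note ev = functional_laplace_exists[OF vc B l s] and eQ = functional_laplace_exists[OF Qc Qb l s]
    show "laplace_exists ?h s" by (intro laplace_exists_diff ev eQ)
    define \<Phi> where "\<Phi> = exponent k s"
    let ?R = "resolvent l (a + \<Phi>)"
    have pos: "a + \<Phi> > 0" unfolding \<Phi>_def by (rule \<phi>_pos[OF s])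
    have R: "bounded_linear ?R" by (rule bounded_linear_resolvent[OF l pos])
    note eR = functional_laplace_exists[OF vc B R s]
    define V where "V = laplace (\<lambda>t. l (v t)) s"
    define V' where "V' = laplace (\<lambda>t. ?R (v t)) s"
    have 1: "laplace (\<lambda>t. ?R (?w t)) s = (a + \<Phi>) * V' - V"
    proof -
      have "laplace (\<lambda>t. ?R (?w t)) s = laplace (\<lambda>t. (a + \<Phi>) * ?R (v t) - l (v t)) s"
        by (rule laplace_cong) (simp add: resolvent_generator[OF l pos dom])
      then show ?thesis
        by (simp add: laplace_diff[OF laplace_exists_cmult[OF eR] ev] laplace_cmult V_def V'_def)
    qed
    have "s * laplace (\<lambda>t. ?R (memory k v t)) s = s * laplace (\<lambda>t. LBINT r:{0..t}. ?R (?q r)) s"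
      using functional_integral[OF q R] eq
      by (intro arg_cong[where f = "\<lambda>x. s * x"] laplace_cong) simp
    moreover have "s * laplace (\<lambda>t. ?R (memory k v t)) s = \<Phi> * (V' - ?R f / s)"
      using laplace_functional_memory(2)[OF vc B R s, of k] unfolding V'_def \<Phi>_def v0 .
    ultimately have "\<Phi> * (V' - ?R f / s) = laplace (\<lambda>t. ?R (?q t)) s"
      using laplace_functional_integral(2)[OF q R s] by (simp only:)
    also have "\<dots> = (a + \<Phi>) * V' - V - a * V' + a * ?R f / s"
      unfolding laplace_right_side[OF R s vc B wc C] 1 by (simp add: V'_def)
    \<comment> \<open>The terms with \<open>V'\<close> cancel, as \<open>\<Phi> = (a + \<Phi>) - a\<close>.\<close>
    finally have "V = (a + \<Phi>) * ?R f / s"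
      by (simp add: algebra_simps add_divide_distrib)
    moreover have "s * laplace (\<lambda>t. l (Q t f)) s = (a + \<Phi>) * ?R f"
      unfolding \<Phi>_def by (rule laplace_Q[OF l s])
    ultimately show "laplace ?h s = 0"
    proof -
      assume "V = (a + \<Phi>) * ?R f / s" "s * laplace (\<lambda>t. l (Q t f)) s = (a + \<Phi>) * ?R f"
      then have "V = laplace (\<lambda>t. l (Q t f)) s" using s by (metis nonzero_mult_div_cancel_left less_irrefl)
      then show ?thesis by (simp add: laplace_diff[OF ev eQ] V_def)
    qed
  qed
  then show "l (v t) = l (Q t f)" by simp
qed

end

theorem theorem2p1:
  fixes \<Omega> :: "'o set" and F :: "ennreal \<Rightarrow> 'o measure"
    and P :: "'x::t2_space \<Rightarrow> 'o measure" and X :: "real \<Rightarrow> 'o \<Rightarrow> 'x"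
    and m :: "'x measure"
    and V :: "('x \<Rightarrow> 'k::{real_normed_field, banach, second_countable_topology}) set"
    and cls :: "('x \<Rightarrow> 'k) \<Rightarrow> 'b::banach"
    and T :: "real \<Rightarrow> 'b \<Rightarrow>\<^sub>L 'b"
    and \<phi> :: "real \<Rightarrow> real" and a k :: real and \<mu> :: "real measure"
    and M :: "'w measure" and D :: "real \<Rightarrow> 'w \<Rightarrow> real" and S :: "'w \<Rightarrow> real"
    and f :: 'b
  assumes "locally_compact_space (euclidean :: 'x topology)"
    and "separable_space (euclidean :: 'x topology)"
    and "strong_markov_process \<Omega> F P X"
    and "function_space m V cls"
    and "transition_semigroup m V cls P X T"
    and "strongly_continuous_semigroup T"
    and "uniformly_bounded_semigroup T"
    and "bernstein_function \<phi>"
    and "characteristics \<phi> a k \<mu>"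
    and "subordinator M D"
    and "laplace_exponent_of M D k \<mu>"
    and "independent_killing_time M D a S"
    and "a > 0"
    and "emeasure \<mu> {0<..} = \<infinity>"
    and "f \<in> generator_domain T"
  shows "let w = tail \<mu>;
             E = general_inverse (killed D S);
             u = (\<lambda>t. expected_semigroup T M (E t) f)
         in fractional_solution T a k w f u \<and>
            (\<forall>v. fractional_solution T a k w f v \<longrightarrow> (\<forall>t\<ge>0. v t = u t))"
proof -
  have k: "k \<ge> 0" using \<open>characteristics \<phi> a k \<mu>\<close> by (simp add: characteristics_def)
  interpret levy_measure \<mu>
    using \<open>characteristics \<phi> a k \<mu>\<close> by unfold_locales (auto simp: characteristics_def)
  interpret time_change T \<mu> M D S a k
  proof unfold_locales
    show "(\<integral>\<omega>. exp (- s * D t \<omega>) \<partial>M) = exp (- t * exponent k s)" if "t \<ge> 0" "s > 0" for t s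
      using \<open>laplace_exponent_of M D k \<mu>\<close> that by (simp add: laplace_exponent_of_def exponent_def)
    show "0 \<le> exponent k s" if "s > 0" for s
      using k that levy_integral_nonneg[OF that] by (simp add: exponent_def)
    show "\<exists>s>0. B < exponent k s" for B
    proof -
      obtain n :: nat where n: "n > 0" "B < (\<integral>z. (1 - exp (- real n * z)) \<partial>\<mu>)"
        using levy_integral_unbounded[OF \<open>emeasure \<mu> {0<..} = \<infinity>\<close>, of B] by blast
      have "k * real n \<ge> 0" using k by simp
      then show ?thesis using n by (intro exI[of _ "real n"]) (auto simp: exponent_def)
    qed
  qed fact+
  have "expected_semigroup T M (general_inverse (killed D S) t) f = Q t f" for t
    by (simp add: Q_def E_def)
  then show ?thesis
    unfolding Let_def
    using Q_fractional_solution[OF \<open>f \<in> generator_domain T\<close>]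
      fractional_solution_unique[OF _ \<open>f \<in> generator_domain T\<close>]
    by (simp only:) blast
qed

end
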